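(* Let $\theta\in(0,1)$, let $0\in V$ be a fixed vertex, and let $c_*:=8c_G^{2/d}$. Suppose there exist constants $R_0\ge1$, $c_0\in(1/2,1)$ and $C>0$ such that: (i) for every $R_0<R<r_G$ and $R^\theta/2\le r\le 2R$, $$\sup_{x\in B(0,6R)}\sum_{y\in V:\rho(x,y)\le r}\frac{w_{x,y}}{\rho(x,y)^{d+\alpha-2}}\le C r^{2-\alpha},$$ $$\mu(B^w_z(x,r))\ge c_0\,\mu(B(x,r))\quad\text{for all }x,z\in B(0,6R),$$ $$\sup_{x\in B(0,6R)}\sum_{y\in B^w(x,c_*r)}w_{x,y}^{-1}\le C r^d;$$ (ii) for every $R_0<R<r_G$ and $r\ge R^\theta/2$, $$\sup_{x\in B(0,6R)}\sum_{y\in V:\rho(x,y)>r}\frac{w_{x,y}}{\rho(x,y)^{d+\alpha}}\le C r^{-\alpha}.$$ Let $C_0>0$ be the exit-time constant described in the context, and $Q(t,x,R)=(t,t+C_0R^\alpha)\times B(x,R)$. Then there exist constants $R_1\ge1$, $\delta\in(\theta,1)$, $\beta\in(0,1)$ and $C_1>0$, with $\delta,\beta,C_1$ independent of $R_0$, $R_1$ and $x_0$, such that for every $R_1<R<r_G/(2c_* )$, $x_0\in B(0,R)$, $R^\delta\le r\le R$, $t_0\ge0$ and every caloric function $q$ on $Q(t_0,x_0,2r)$, $$|q(s,x)-q(t,y)|\le C_1\|q\|_{\infty,r}\left(\frac{|t-s|^{1/\alpha}+\rho(x,y)}{r}\right)^\beta$$ holds for all $(s,x),(t,y)\in Q(t_0,x_0,r)$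 such that $(C_0^{-1}|s-t|)^{1/\alpha}+\rho(x,y)\ge2r^\delta$, where $\|q\|_{\infty,r}=\sup_{(s,x)\in[t_0,t_0+C_0(2r)^\alpha]\times V}|q(s,x)|$.
   Context: $G=(V,E_V)$ is a locally finite connected graph with graph distance $\rho$ and balls $B(x,r)=\{y\in V:\rho(x,y)\le r\}$. $\mu$ is a measure on $V$ with $\mu_x=\mu(\{x\})$ and $c_M^{-1}\le\mu_x\le c_M$ for all $x\in V$ and some $c_M\ge1$. There are $d>0$, $r_G\in[1,\infty]$ and $c_G\ge1$ such that $c_G^{-1}r^d\le\mu(B(x,r))\le c_Gr^d$ for all $x\in V$ and $1\le r<r_G$. $\alpha\in(0,2)$, and $\{w_{x,y}:x,y\in V\}$ satisfies $w_{x,x}=0$, $w_{x,y}=w_{y,x}\ge0$ for $x\ne y$, and $\sum_{y\in V}\frac{w_{x,y}}{\rho(x,y)^{d+\alpha}}\mu_y<\infty$ for each $x\in V$ (convention $0/0=0$). Notation: $B^w_z(x,r)=\{u\in B(x,r):w_{u,z}>0\}$ and $B^w(x,r)=B^w_x(x,r)$. $X=((X_t)_{t\ge0},(\mathbb{P}_x)_{x\in V})$ is the symmetric Hunt process associated with the regular symmetric Dirichlet form $D(f,f)=\frac12\sum_{x,y\in V}(f(x)-f(y))^2\frac{w_{x,y}}{\rho(x,y)^{d+\alpha}}\mu_x\mu_y$ on $L^2(V;\mu)$ with domain $\{f\in L^2(V;\mu):D(f,f)<\infty\}$; i.e. with $C_{x,y}=w_{x,y}/\rho(x,y)^{d+\alpha}$,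 from $x$ it waits an exponential time of parameter $C_x=\sum_yC_{x,y}\mu_y$ and jumps to $y$ with probability $C_{x,y}\mu_y/C_x$. Exit-time constant: under hypotheses (i)–(ii) of the claim there exist $C_0>0$, $R_\ast\ge1$ and $\delta_\ast\in(\theta,1)$ such that $\sup_{x\in B(0,2R)}\mathbb{P}_x(\tau_{B(x,r)}\le C_0r^\alpha)\le\frac14$ for all $R_\ast<R<r_G/(2c_* )$ and $R^{\delta_\ast}\le r\le R$, where $\tau_{B}=\inf\{t>0:X_t\notin B\}$ for $B\subset V$; $C_0$ is fixed with this property. $Z_t=(U_t,X_t)$ with $U_t=U_0+t$ is the time-space process on $[0,\infty)\times V$; $\mathbb{P}_{(s,x)}$, $\mathbb{E}_{(s,x)}$ refer to $Z$ started at $(s,x)$. For $A\subseteq[0,\infty)\times V$, $\tau_A=\inf\{s>0:Z_s\notin A\}$. A measurable function $q(t,x)$ on $[0,\infty)\times V$ is caloric in an open set $A\subseteq[0,\infty)\times V$ if $q(t,x)=\mathbb{E}_{(t,x)}q(Z_{\tau_{A_1}})$ for every relatively compact open subset $A_1$ of $A$ and every $(t,x)\in A_1$. Constants in the conclusion are independent of $r_G$; dependence on $c_G$, $c_M$ is allowed and not stressed. *)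

theory Defs
  imports "HOL-Probability.Probability"
begin

section \<open>Graphs with a vertex measure and symmetric weights\<close>

text \<open>
  The vertex set is a field of the record rather than a type, so that constants can be
  chosen before the graph: one theorem then covers, uniformly, all finite and infinite graphs
  over a given vertex type.
\<close>

record 'a wgraph =
  verts :: "'a set"
  edges :: "('a \<times> 'a) set"
  vmeas :: "'a measure"
  weight :: "'a \<Rightarrow> 'a \<Rightarrow> real"

definition connected_locally_finite_graph :: "('a, 'b) wgraph_scheme \<Rightarrow> bool" where
  "connected_locally_finite_graph G \<longleftrightarrow>
     edges G \<subseteq> verts G \<times> verts G \<and> sym (edges G) \<and>
     (\<forall>x\<in>verts G. finite {y. (x, y) \<in> edges G}) \<and>
     (\<forall>x\<in>verts G. \<forall>y\<in>verts G. (x, y) \<in> (edges G)\<^sup>*)"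

definition gdist :: "('a, 'b) wgraph_scheme \<Rightarrow> 'a \<Rightarrow> 'a \<Rightarrow> nat" where
  "gdist G x y = (LEAST n. (x, y) \<in> edges G ^^ n)"

definition gball :: "('a, 'b) wgraph_scheme \<Rightarrow> 'a \<Rightarrow> real \<Rightarrow> 'a set" where
  "gball G x r = {y \<in> verts G. real (gdist G x y) \<le> r}"

text \<open>\<open>wball G z x r\<close> is $B^w_z(x,r)$; in particular \<open>wball G x x r\<close> is $B^w(x,r)$.\<close>

definition wball :: "('a, 'b) wgraph_scheme \<Rightarrow> 'a \<Rightarrow> 'a \<Rightarrow> real \<Rightarrow> 'a set" where
  "wball G z x r = {u \<in> gball G x r. weight G u z > 0}"

abbreviation vmass :: "('a, 'b) wgraph_scheme \<Rightarrow> 'a \<Rightarrow> real" where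
  "vmass G x \<equiv> measure (vmeas G) {x}"

text \<open>
  On the diagonal the weight is \<open>0\<close> and \<open>0 powr a = 0\<close>, so that HOL's \<open>0 / 0 = 0\<close> is exactly
  the convention used for $C_{x,x}$.
\<close>

definition conductance ::
    "('a, 'b) wgraph_scheme \<Rightarrow> real \<Rightarrow> real \<Rightarrow> 'a \<Rightarrow> 'a \<Rightarrow> real" where
  "conductance G d \<alpha> x y = weight G x y / real (gdist G x y) powr (d + \<alpha>)"

definition stable_like_graph ::
    "('a, 'b) wgraph_scheme \<Rightarrow> real \<Rightarrow> real \<Rightarrow> real \<Rightarrow> real \<Rightarrow> ereal \<Rightarrow> bool" where
  "stable_like_graph G d \<alpha> c\<^sub>M c\<^sub>G r\<^sub>G \<longleftrightarrow>
     connected_locally_finite_graph G \<and>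
     space (vmeas G) = verts G \<and> sets (vmeas G) = Pow (verts G) \<and>
     (\<forall>x\<in>verts G. 1 / c\<^sub>M \<le> vmass G x \<and> vmass G x \<le> c\<^sub>M) \<and>
     1 \<le> r\<^sub>G \<and>
     (\<forall>x\<in>verts G. \<forall>r::real. 1 \<le> r \<and> ereal r < r\<^sub>G \<longrightarrow>
        r powr d / c\<^sub>G \<le> measure (vmeas G) (gball G x r) \<and>
        measure (vmeas G) (gball G x r) \<le> c\<^sub>G * r powr d) \<and>
     (\<forall>x\<in>verts G. weight G x x = 0) \<and>
     (\<forall>x\<in>verts G. \<forall>y\<in>verts G. weight G x y = weight G y x \<and> 0 \<le> weight G x y) \<and>
     (\<forall>x\<in>verts G. (\<lambda>y. conductance G d \<alpha> x y * vmass G y) summable_on verts G)"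

section \<open>The jump process\<close>

definition jump_rate :: "('a, 'b) wgraph_scheme \<Rightarrow> real \<Rightarrow> real \<Rightarrow> 'a \<Rightarrow> real" where
  "jump_rate G d \<alpha> x = (\<Sum>\<^sub>\<infinity>y\<in>verts G. conductance G d \<alpha> x y * vmass G y)"

text \<open>
  The law of the jump target from \<open>x\<close>. A vertex with jump rate \<open>0\<close> is absorbing: its holding
  time below is infinite, and its jump target is irrelevant.
\<close>

definition jump_pmf :: "('a, 'b) wgraph_scheme \<Rightarrow> real \<Rightarrow> real \<Rightarrow> 'a \<Rightarrow> 'a pmf" where
  "jump_pmf G d \<alpha> x =
     (if jump_rate G d \<alpha> x = 0 then return_pmf x
      else embed_pmf (\<lambda>y. if y \<in> verts G
                          then conductance G d \<alpha> x y * vmass G y / jump_rate G d \<alpha> x else 0))"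

text \<open>
  The process is realised, for all starting points at once, on one probability space.
  An outcome is a stream of independent steps. Step \<open>n\<close> consists of a standard exponential
  variable \<open>e\<close> and, independently of it and of one another, a jump target \<open>f z\<close> with law
  \<open>jump_pmf z\<close> for each vertex \<open>z\<close>. If \<open>z\<close> is the \<open>n\<close>-th vertex visited, the process stays there
  for the time \<open>e / jump_rate z\<close>, which is exponential of parameter \<open>jump_rate z\<close>, and then jumps
  to \<open>f z\<close>.
\<close>

type_synonym 'a outcome = "(real \<times> ('a \<Rightarrow> 'a)) stream"

definition step_law ::
    "('a, 'b) wgraph_scheme \<Rightarrow> real \<Rightarrow> real \<Rightarrow> (real \<times> ('a \<Rightarrow> 'a)) measure" where
  "step_law G d \<alpha> =
     density lborel (exponential_density 1) \<Otimes>\<^sub>M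
     (\<Pi>\<^sub>M z\<in>verts G. measure_pmf (jump_pmf G d \<alpha> z))"

definition path_law :: "('a, 'b) wgraph_scheme \<Rightarrow> real \<Rightarrow> real \<Rightarrow> 'a outcome measure" where
  "path_law G d \<alpha> = stream_space (step_law G d \<alpha>)"

primrec visited :: "'a \<Rightarrow> 'a outcome \<Rightarrow> nat \<Rightarrow> 'a" where
  "visited x \<omega> 0 = x"
| "visited x \<omega> (Suc n) = snd (\<omega> !! n) (visited x \<omega> n)"

definition jump_time ::
    "('a, 'b) wgraph_scheme \<Rightarrow> real \<Rightarrow> real \<Rightarrow> 'a \<Rightarrow> 'a outcome \<Rightarrow> nat \<Rightarrow> ennreal" where
  "jump_time G d \<alpha> x \<omega> n =
     (\<Sum>i<n. ennreal (fst (\<omega> !! i)) / ennreal (jump_rate G d \<alpha> (visited x \<omega> i)))"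

text \<open>\<open>None\<close> is the cemetery point, entered only if infinitely many jumps occur in finite time.\<close>

definition X_path ::
    "('a, 'b) wgraph_scheme \<Rightarrow> real \<Rightarrow> real \<Rightarrow> 'a \<Rightarrow> real \<Rightarrow> 'a outcome \<Rightarrow> 'a option" where
  "X_path G d \<alpha> x t \<omega> =
     (let in_step = (\<lambda>n. jump_time G d \<alpha> x \<omega> n \<le> ennreal t \<and>
                         ennreal t < jump_time G d \<alpha> x \<omega> (Suc n))
      in if \<exists>n. in_step n then Some (visited x \<omega> (THE n. in_step n)) else None)"

definition exit_time ::
    "('a, 'b) wgraph_scheme \<Rightarrow> real \<Rightarrow> real \<Rightarrow> 'a \<Rightarrow> 'a set \<Rightarrow> 'a outcome \<Rightarrow> ennreal" where
  "exit_time G d \<alpha> x B \<omega> = Inf {ennreal t |t. 0 < t \<and> X_path G d \<alpha> x t \<omega> \<notin> Some ` B}"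

section \<open>The time-space process and caloric functions\<close>

text \<open>\<open>Z_path G d \<alpha> (t, x) s\<close> is $Z_s$ for the time-space process started at $(t,x)$.\<close>

definition Z_path ::
    "('a, 'b) wgraph_scheme \<Rightarrow> real \<Rightarrow> real \<Rightarrow> real \<times> 'a \<Rightarrow> real \<Rightarrow> 'a outcome \<Rightarrow> real \<times> 'a option"
    where
  "Z_path G d \<alpha> z s \<omega> = (fst z + s, X_path G d \<alpha> (snd z) s \<omega>)"

definition Z_exit_time ::
    "('a, 'b) wgraph_scheme \<Rightarrow> real \<Rightarrow> real \<Rightarrow> real \<times> 'a \<Rightarrow> (real \<times> 'a) set \<Rightarrow> 'a outcome \<Rightarrow> ennreal"
    where
  "Z_exit_time G d \<alpha> z A \<omega> =
     Inf {ennreal s |s. 0 < s \<and> Z_path G d \<alpha> z s \<omega> \<notin> map_prod id Some ` A}"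

definition extend_cemetery :: "(real \<times> 'a \<Rightarrow> real) \<Rightarrow> real \<times> 'a option \<Rightarrow> real" where
  "extend_cemetery q z = (case snd z of Some x \<Rightarrow> q (fst z, x) | None \<Rightarrow> 0)"

definition spacetime_topology :: "('a, 'b) wgraph_scheme \<Rightarrow> (real \<times> 'a) topology" where
  "spacetime_topology G = prod_topology (top_of_set {0..}) (discrete_topology (verts G))"

definition spacetime_algebra :: "('a, 'b) wgraph_scheme \<Rightarrow> (real \<times> 'a) measure" where
  "spacetime_algebra G = restrict_space borel {0..} \<Otimes>\<^sub>M count_space (verts G)"

text \<open>
  ``Relatively compact open subset of \<open>A\<close>'' is read relative to \<open>A\<close>: the closure is compact
  and contained in \<open>A\<close>. Over such a set \<open>A\<^sub>1\<close> time is bounded and space is finite, so the exit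
  time is finite and, almost surely, the cemetery has not been reached.
\<close>

definition caloric ::
    "('a, 'b) wgraph_scheme \<Rightarrow> real \<Rightarrow> real \<Rightarrow> (real \<times> 'a) set \<Rightarrow> (real \<times> 'a \<Rightarrow> real) \<Rightarrow> bool" where
  "caloric G d \<alpha> A q \<longleftrightarrow>
     q \<in> borel_measurable (spacetime_algebra G) \<and>
     (\<forall>A\<^sub>1. openin (spacetime_topology G) A\<^sub>1 \<and>
           compactin (spacetime_topology G) (spacetime_topology G closure_of A\<^sub>1) \<and>
           spacetime_topology G closure_of A\<^sub>1 \<subseteq> A \<longrightarrow>
       (\<forall>z\<in>A\<^sub>1.
          let Zexit = (\<lambda>\<omega>. Z_path G d \<alpha> z (enn2real (Z_exit_time G d \<alpha> z A\<^sub>1 \<omega>)) \<omega>)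
          in integrable (path_law G d \<alpha>) (\<lambda>\<omega>. extend_cemetery q (Zexit \<omega>)) \<and>
             q z = (\<integral>\<omega>. extend_cemetery q (Zexit \<omega>) \<partial>path_law G d \<alpha>)))"

definition cylinder ::
    "('a, 'b) wgraph_scheme \<Rightarrow> real \<Rightarrow> real \<Rightarrow> real \<Rightarrow> 'a \<Rightarrow> real \<Rightarrow> (real \<times> 'a) set" where
  "cylinder G \<alpha> C\<^sub>0 t x R = {t<..<t + C\<^sub>0 * R powr \<alpha>} \<times> gball G x R"

definition sup_norm_on :: "(real \<times> 'a \<Rightarrow> real) \<Rightarrow> (real \<times> 'a) set \<Rightarrow> ennreal" where
  "sup_norm_on q S = (SUP z\<in>S. ennreal \<bar>q z\<bar>)"

definition cstar :: "real \<Rightarrow> real \<Rightarrow> real" where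
  "cstar c\<^sub>G d = 8 * c\<^sub>G powr (2 / d)"

section \<open>The hypotheses on the weights and the exit-time bound\<close>

definition local_weight_bounds ::
    "('a, 'b) wgraph_scheme \<Rightarrow> 'a \<Rightarrow> real \<Rightarrow> real \<Rightarrow> real \<Rightarrow> ereal \<Rightarrow> real \<Rightarrow> real \<Rightarrow> real \<Rightarrow> real \<Rightarrow> bool"
    where
  "local_weight_bounds G v\<^sub>0 d \<alpha> c\<^sub>G r\<^sub>G \<theta> R\<^sub>0 c\<^sub>0 C \<longleftrightarrow>
     (\<forall>R r::real. R\<^sub>0 < R \<and> ereal R < r\<^sub>G \<and> R powr \<theta> / 2 \<le> r \<and> r \<le> 2 * R \<longrightarrow>
        (\<forall>x\<in>gball G v\<^sub>0 (6 * R).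
           (\<Sum>y\<in>gball G x r. weight G x y / real (gdist G x y) powr (d + \<alpha> - 2))
             \<le> C * r powr (2 - \<alpha>)) \<and>
        (\<forall>x\<in>gball G v\<^sub>0 (6 * R). \<forall>z\<in>gball G v\<^sub>0 (6 * R).
           c\<^sub>0 * measure (vmeas G) (gball G x r) \<le> measure (vmeas G) (wball G z x r)) \<and>
        (\<forall>x\<in>gball G v\<^sub>0 (6 * R).
           (\<Sum>y\<in>wball G x x (cstar c\<^sub>G d * r). 1 / weight G x y) \<le> C * r powr d))"

definition tail_weight_bound ::
    "('a, 'b) wgraph_scheme \<Rightarrow> 'a \<Rightarrow> real \<Rightarrow> real \<Rightarrow> ereal \<Rightarrow> real \<Rightarrow> real \<Rightarrow> real \<Rightarrow> bool" where
  "tail_weight_bound G v\<^sub>0 d \<alpha> r\<^sub>G \<theta> R\<^sub>0 C \<longleftrightarrow>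
     (\<forall>R r::real. R\<^sub>0 < R \<and> ereal R < r\<^sub>G \<and> R powr \<theta> / 2 \<le> r \<longrightarrow>
        (\<forall>x\<in>gball G v\<^sub>0 (6 * R).
           (\<Sum>\<^sub>\<infinity>y\<in>{y \<in> verts G. r < real (gdist G x y)}.
              weight G x y / real (gdist G x y) powr (d + \<alpha>)) \<le> C * r powr (- \<alpha>)))"

definition exit_time_bound ::
    "('a, 'b) wgraph_scheme \<Rightarrow> 'a \<Rightarrow> real \<Rightarrow> real \<Rightarrow> real \<Rightarrow> ereal \<Rightarrow> real \<Rightarrow> real \<Rightarrow> real \<Rightarrow> bool"
    where
  "exit_time_bound G v\<^sub>0 d \<alpha> c\<^sub>G r\<^sub>G C\<^sub>0 R\<^sub>e \<delta>\<^sub>e \<longleftrightarrow>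
     (\<forall>R r::real. R\<^sub>e < R \<and> ereal R < r\<^sub>G / ereal (2 * cstar c\<^sub>G d) \<and>
                  R powr \<delta>\<^sub>e \<le> r \<and> r \<le> R \<longrightarrow>
        (\<forall>x\<in>gball G v\<^sub>0 (2 * R).
           measure (path_law G d \<alpha>)
             {\<omega> \<in> space (path_law G d \<alpha>).
                exit_time G d \<alpha> x (gball G x r) \<omega> \<le> ennreal (C\<^sub>0 * r powr \<alpha>)} \<le> 1 / 4))"

end

theory Submission
  imports Defs "HOL-Real_Asymp.Real_Asymp"
begin

text \<open>
  A caloric function solves the backward equation $\partial_t q + Lq = 0$ of the jump process,
  in the integrated form called a mild solution below. This is the definition of caloric applied
  to boxes $(a,b)\times\{x\}$ with a single vertex: the time-space process leaves such a box at
  its first jump or at time $b$, whichever comes first. Each cylinder contains only finitely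
  many vertices, and from there on the proof is analysis of mild solutions on finite balls; the
  process does not reappear.

  Hoelder continuity is geometric decay of oscillation. Over the cylinders $Q_n = [s,
  s+C_0r_n^\alpha]\times B(x,r_n)$ with $r_n=\gamma^n r_0$, the values of $q$ are kept in
  intervals of half-length $H_n=\eta^n H_0$ with $\eta=\gamma^\beta<1$. Normalised, $u_\pm = 1
  \pm (q-c)/H_n$ is nonnegative on $Q_n$, and at every point one of $u_+$, $u_-$ is at least
  $1$; so one of them is at least $1$ on half of a late part of $Q_n$, in the averaged sense.
  The growth lemma (\<open>growth_of_positive_solutions\<close>) turns this into a positive
  lower bound on all of $Q_{n+1}$, which cuts off a part of the interval. Long jumps see $q$
  outside $Q_n$, where only the weaker bounds from earlier cylinders hold. They allow $q$ to
  grow like distance to the power $\beta$, and by the tail bound the contribution of such growth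
  tends to $0$ with $\beta$ (\<open>jump_mean_hoelder_tail\<close>).

  The growth lemma compares $u$ with the explicit function $\frac14 S(t)h(t,y)$ minus an error,
  by a maximum principle (\<open>comparison_principle\<close>). The factor $S$ accumulates the
  rate at which the process jumps into the region where $u$ is large. Because $c_0>1/2$, every
  vertex is joined by positive weights to a fixed part of any set that fills half of a ball, and
  the bound on $\sum 1/w$ with Cauchy-Schwarz makes the total rate into the set at least of
  order $\rho^{-\alpha}$ (\<open>jump_rate_into_dense_set\<close>). The factor $h$ is a barrier:
  it is positive only inside the ball, and it is bounded below near its centre for a time of
  order $\rho^\alpha$ (\<open>staying_barrier\<close>).

  The barrier comes from the heat flow of a bump function in an auxiliary finite chain, which
  keeps only the jumps of length at most $\rho$ inside the ball of radius $2\rho$. What must be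
  shown is that this flow moves mass by at most $\rho/16$ on average in time of order
  $\rho^\alpha$, from every starting vertex. This is Nash's entropy argument. The weight bounds
  give a Nash inequality (\<open>ball_nash\<close>), hence decay of the $L^2$ norm of the
  density, hence a lower bound for its entropy; and the mean displacement grows at most like the
  square root of the entropy production (\<open>moment_growth\<close>).

  Nothing is known about the weights below distance $R^\theta$. This is harmless for the
  auxiliary chain as long as $\rho$ exceeds $R^\theta$ by a power of $R$, which absorbs every
  logarithm of $R$. The choice $\delta^2=(1+\theta)/2>\theta$ guarantees it: the iteration runs
  only down to the radius $2r^\delta\ge 2R^{\delta^2}$, and this is the reason for the lower
  bound on the separation of the two points.
\<close>

section \<open>The heat flow of a finite symmetric chain\<close>

text \<open>
  Vertices carry masses \<open>m\<close>, and \<open>k\<close> is the symmetric jump kernel, so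
  that \<open>k x y * m y\<close> is the jump rate from \<open>x\<close> to \<open>y\<close>.
  Only values on \<open>D\<close> matter. The heat flow is built by uniformization: the chain
  jumps at the ticks of a Poisson clock that is at least as fast as every jump rate, so that
  \<open>step\<close> is a Markov operator and the flow is a power series in time.
\<close>

locale finite_symmetric_chain =
  fixes D :: "'a set" and m :: "'a \<Rightarrow> real" and k :: "'a \<Rightarrow> 'a \<Rightarrow> real"
  assumes finite_D: "finite D"
    and m_pos: "x \<in> D \<Longrightarrow> 0 < m x"
    and k_nonneg: "x \<in> D \<Longrightarrow> y \<in> D \<Longrightarrow> 0 \<le> k x y"
    and k_sym: "x \<in> D \<Longrightarrow> y \<in> D \<Longrightarrow> k x y = k y x"
begin

definition gen :: "('a \<Rightarrow> real) \<Rightarrow> 'a \<Rightarrow> real" where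
  "gen f x = (\<Sum>y\<in>D. k x y * m y * (f y - f x))"

definition clock :: real where
  "clock = 1 + (\<Sum>x\<in>D. \<Sum>y\<in>D. k x y * m y)"

definition step :: "('a \<Rightarrow> real) \<Rightarrow> 'a \<Rightarrow> real" where
  "step f x = f x + gen f x / clock"

definition heat :: "real \<Rightarrow> ('a \<Rightarrow> real) \<Rightarrow> 'a \<Rightarrow> real" where
  "heat t f x = exp (- clock * t) * (\<Sum>n. clock ^ n / fact n * (step ^^ n) f x * t ^ n)"

definition energy :: "('a \<Rightarrow> real) \<Rightarrow> ('a \<Rightarrow> real) \<Rightarrow> real" where
  "energy f g = (\<Sum>x\<in>D. \<Sum>y\<in>D. k x y * m x * m y * (f x - f y) * (g x - g y)) / 2"

lemma weight_nonneg: "x \<in> D \<Longrightarrow> y \<in> D \<Longrightarrow> 0 \<le> k x y * m y"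
  using k_nonneg m_pos by (simp add: less_imp_le)

lemma clock_ge: "x \<in> D \<Longrightarrow> 1 + (\<Sum>y\<in>D. k x y * m y) \<le> clock"
proof -
  assume x: "x \<in> D"
  have "(\<Sum>y\<in>D. k x y * m y) \<le> (\<Sum>x\<in>D. \<Sum>y\<in>D. k x y * m y)"
    by (rule member_le_sum[where f="\<lambda>x. \<Sum>y\<in>D. k x y * m y"])
       (use x finite_D in \<open>auto intro!: sum_nonneg weight_nonneg\<close>)
  thus ?thesis unfolding clock_def by simp
qed

lemma clock_pos: "0 < clock"
proof -
  have "0 \<le> (\<Sum>x\<in>D. \<Sum>y\<in>D. k x y * m y)"
    by (auto intro!: sum_nonneg weight_nonneg)
  thus ?thesis unfolding clock_def by simp
qed

lemma step_const: "step (\<lambda>_. c) = (\<lambda>_. c)"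
  by (auto simp: step_def gen_def)

lemma step_mono:
  assumes "\<And>y. y \<in> D \<Longrightarrow> f y \<le> g y" "x \<in> D"
  shows "step f x \<le> step g x"
proof -
  have "step g x - step f x
      = (g x - f x) * (1 - (\<Sum>y\<in>D. k x y * m y) / clock) + (\<Sum>y\<in>D. k x y * m y * (g y - f y)) / clock"
    using clock_pos
    by (simp add: step_def gen_def field_simps sum_subtractf sum_distrib_left sum_distrib_right sum.distrib)
  moreover have "0 \<le> 1 - (\<Sum>y\<in>D. k x y * m y) / clock"
    using clock_ge[OF assms(2)] clock_pos by (simp add: field_simps)
  moreover have "0 \<le> (\<Sum>y\<in>D. k x y * m y * (g y - f y))"
    using assms by (auto intro!: sum_nonneg mult_nonneg_nonneg[OF weight_nonneg])
  ultimately show ?thesis using assms clock_pos by (smt (verit) divide_nonneg_pos mult_nonneg_nonneg)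
qed

lemma steps_mono:
  assumes "\<And>y. y \<in> D \<Longrightarrow> f y \<le> g y" "x \<in> D"
  shows "(step ^^ n) f x \<le> (step ^^ n) g x"
  using assms(2) by (induction n arbitrary: x) (auto intro!: step_mono assms)

lemma steps_const: "(step ^^ n) (\<lambda>_. c) = (\<lambda>_. c)"
  by (induction n) (auto simp: step_const)

lemma steps_bounded:
  assumes "\<And>y. y \<in> D \<Longrightarrow> \<bar>f y\<bar> \<le> K" "x \<in> D"
  shows "\<bar>(step ^^ n) f x\<bar> \<le> K"
proof -
  have "(step ^^ n) f x \<le> (step ^^ n) (\<lambda>_. K) x"
    by (intro steps_mono) (use assms in \<open>auto simp: abs_le_iff\<close>)
  moreover have "(step ^^ n) (\<lambda>_. -K) x \<le> (step ^^ n) f x"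
    by (intro steps_mono) (use assms in \<open>auto simp: abs_le_iff minus_le_iff\<close>)
  ultimately show ?thesis by (auto simp: steps_const)
qed

lemma heat_summable:
  assumes "x \<in> D"
  shows "summable (\<lambda>n. clock ^ n / fact n * (step ^^ n) f x * t ^ n)"
proof -
  define K where "K = (\<Sum>y\<in>D. \<bar>f y\<bar>)"
  have K: "\<And>y. y \<in> D \<Longrightarrow> \<bar>f y\<bar> \<le> K"
    unfolding K_def using finite_D by (intro member_le_sum[where f="\<lambda>y. \<bar>f y\<bar>"]) auto
  show ?thesis
  proof (rule summable_comparison_test'[where N=0 and g="\<lambda>n. K * ((clock * \<bar>t\<bar>) ^ n / fact n)"])
    show "summable (\<lambda>n. K * ((clock * \<bar>t\<bar>) ^ n / fact n))"
      using summable_exp[of "clock * \<bar>t\<bar>"] by (intro summable_mult) (simp add: field_simps)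
  next
    fix n
    have "norm (clock ^ n / fact n * (step ^^ n) f x * t ^ n)
        = \<bar>(step ^^ n) f x\<bar> * ((clock * \<bar>t\<bar>) ^ n / fact n)"
      using clock_pos by (simp add: abs_mult power_abs power_mult_distrib)
    also have "\<dots> \<le> K * ((clock * \<bar>t\<bar>) ^ n / fact n)"
      by (intro mult_right_mono steps_bounded K assms) (use clock_pos in auto)
    finally show "norm (clock ^ n / fact n * (step ^^ n) f x * t ^ n)
        \<le> K * ((clock * \<bar>t\<bar>) ^ n / fact n)" .
  qed
qed

lemma exp_clock_sums: "exp (- clock * t) * (\<Sum>n. clock ^ n / fact n * c * t ^ n) = c"
proof -
  have "(\<lambda>n. c * ((clock * t) ^ n /\<^sub>R fact n)) sums (c * exp (clock * t))"
    by (intro sums_mult exp_converges)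
  also have "(\<lambda>n. c * ((clock * t) ^ n /\<^sub>R fact n)) = (\<lambda>n. clock ^ n / fact n * c * t ^ n)"
    by (auto simp: field_simps power_mult_distrib)
  finally have "(\<Sum>n. clock ^ n / fact n * c * t ^ n) = c * exp (clock * t)"
    by (rule sums_unique[symmetric])
  moreover have "exp (- clock * t) * (c * exp (clock * t)) = c"
    by (simp add: exp_minus)
  ultimately show ?thesis by metis
qed

lemma heat_const: "heat t (\<lambda>_. c) x = c"
  unfolding heat_def steps_const by (rule exp_clock_sums)

lemma heat_mono:
  assumes "\<And>y. y \<in> D \<Longrightarrow> f y \<le> g y" "x \<in> D" "0 \<le> t"
  shows "heat t f x \<le> heat t g x"
  unfolding heat_def
  by (intro mult_left_mono suminf_le heat_summable mult_right_mono steps_mono assms)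
     (use clock_pos assms in auto)

lemma heat_0 [simp]: "heat 0 f x = f x"
proof -
  have "(\<lambda>n. clock ^ n / fact n * (step ^^ n) f x * 0 ^ n) sums (clock ^ 0 / fact 0 * (step ^^ 0) f x)"
    by (rule powser_sums_zero)
  thus ?thesis by (simp add: heat_def sums_iff)
qed

lemma gen_suminf:
  assumes "x \<in> D" "\<And>y. y \<in> D \<Longrightarrow> summable (\<lambda>n. F n y)"
  shows "gen (\<lambda>y. \<Sum>n. F n y) x = (\<Sum>n. gen (F n) x)"
proof -
  have "(\<Sum>n. gen (F n) x) = (\<Sum>y\<in>D. \<Sum>n. k x y * m y * (F n y - F n x))"
    unfolding gen_def by (intro suminf_sum summable_mult summable_diff assms)
  also have "\<dots> = gen (\<lambda>y. \<Sum>n. F n y) x"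
    unfolding gen_def using assms
    by (intro sum.cong refl) (simp add: suminf_mult summable_diff suminf_diff)
  finally show ?thesis by simp
qed

lemma gen_scale: "gen (\<lambda>y. c * f y) x = c * gen f x"
  by (simp add: gen_def sum_distrib_left algebra_simps)

lemma heat_deriv:
  assumes x: "x \<in> D"
  shows "((\<lambda>t. heat t f x) has_real_derivative gen (heat t f) x) (at t)"
proof -
  let ?c = "\<lambda>n. clock ^ n / fact n * (step ^^ n) f x"
  have D1: "((\<lambda>t. \<Sum>n. ?c n * t ^ n) has_real_derivative (\<Sum>n. diffs ?c n * t ^ n)) (at t)"
    by (rule termdiffs_strong_converges_everywhere) (rule heat_summable[OF x])
  have *: "diffs ?c n * t ^ n
      = clock * (clock ^ n / fact n * (step ^^ n) f x * t ^ n)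
        + gen (\<lambda>y. clock ^ n / fact n * (step ^^ n) f y * t ^ n) x" for n
  proof -
    have "diffs ?c n = clock * (clock ^ n / fact n) * step ((step ^^ n) f) x"
      by (simp add: diffs_def field_simps del: of_nat_Suc)
    also have "\<dots> = (clock ^ n / fact n) * (clock * (step ^^ n) f x + gen ((step ^^ n) f) x)"
      using clock_pos by (simp add: step_def[of _ x] field_simps)
    finally have "diffs ?c n * t ^ n
        = (clock ^ n / fact n) * (clock * (step ^^ n) f x + gen ((step ^^ n) f) x) * t ^ n"
      by simp
    also have "\<dots> = clock * (clock ^ n / fact n * (step ^^ n) f x * t ^ n)
        + (clock ^ n / fact n * t ^ n) * gen ((step ^^ n) f) x"
      by (simp only: algebra_simps)
    also have "(clock ^ n / fact n * t ^ n) * gen ((step ^^ n) f) x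
        = gen (\<lambda>y. (clock ^ n / fact n * t ^ n) * (step ^^ n) f y) x"
      by (rule gen_scale[symmetric])
    also have "(\<lambda>y. (clock ^ n / fact n * t ^ n) * (step ^^ n) f y)
        = (\<lambda>y. clock ^ n / fact n * (step ^^ n) f y * t ^ n)"
      by (simp add: mult_ac)
    finally show ?thesis .
  qed
  have sg: "summable (\<lambda>n. gen (\<lambda>y. clock ^ n / fact n * (step ^^ n) f y * t ^ n) x)"
    unfolding gen_def using x by (intro summable_sum summable_mult summable_diff heat_summable)
  have "(\<Sum>n. diffs ?c n * t ^ n) = clock * (\<Sum>n. ?c n * t ^ n)
      + gen (\<lambda>y. \<Sum>n. clock ^ n / fact n * (step ^^ n) f y * t ^ n) x"
    unfolding *
    by (subst gen_suminf[OF x heat_summable], assumption, subst suminf_mult[OF heat_summable[OF x], symmetric])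
       (intro suminf_add[symmetric] summable_mult heat_summable x sg)
  note D2 = D1[unfolded this]
  have cancel: "- c * E * S + (c * S + g) * E = E * g" for c E S g :: real
    by (simp add: algebra_simps)
  have D3: "((\<lambda>t. exp (- clock * t)) has_real_derivative - clock * exp (- clock * t)) (at t)"
    by (auto intro!: derivative_eq_intros)
  have "((\<lambda>t. exp (- clock * t) * (\<Sum>n. ?c n * t ^ n)) has_real_derivative
       exp (- clock * t) * gen (\<lambda>y. \<Sum>n. clock ^ n / fact n * (step ^^ n) f y * t ^ n) x) (at t)"
    by (rule DERIV_cong[OF DERIV_mult[OF D3 D2]]) (rule cancel)
  thus ?thesis unfolding heat_def gen_scale .
qed

lemma sum_gen_by_parts:
  "(\<Sum>x\<in>D. gen f x * g x * m x) = - energy f g"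
proof -
  let ?S = "\<Sum>x\<in>D. \<Sum>y\<in>D. k x y * m x * m y * (f y - f x) * g x"
  have 1: "(\<Sum>x\<in>D. gen f x * g x * m x) = ?S"
    by (simp add: gen_def sum_distrib_left sum_distrib_right algebra_simps)
  have 2: "?S = (\<Sum>x\<in>D. \<Sum>y\<in>D. k x y * m x * m y * (f x - f y) * g y)"
    by (subst sum.swap) (auto intro!: sum.cong simp: k_sym)
  have "?S + ?S = - (2 * energy f g)"
    by (subst (2) 2)
       (simp add: energy_def sum.distrib[symmetric] sum_negf[symmetric] algebra_simps)
  thus ?thesis using 1 by simp
qed

lemma gen_sym: "(\<Sum>x\<in>D. gen f x * g x * m x) = (\<Sum>x\<in>D. f x * gen g x * m x)"
  using sum_gen_by_parts[of f g] sum_gen_by_parts[of g f]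
  by (simp add: energy_def mult.commute mult.left_commute)

lemma steps_sym: "(\<Sum>x\<in>D. (step ^^ n) f x * g x * m x) = (\<Sum>x\<in>D. f x * (step ^^ n) g x * m x)"
proof (induction n arbitrary: f g)
  case (Suc n)
  have step_sym: "(\<Sum>x\<in>D. step f x * g x * m x) = (\<Sum>x\<in>D. f x * step g x * m x)" for f g
    using gen_sym[of f g] clock_pos
    by (simp add: step_def algebra_simps sum.distrib sum_divide_distrib[symmetric])
  have "(\<Sum>x\<in>D. (step ^^ Suc n) f x * g x * m x) = (\<Sum>x\<in>D. (step ^^ n) f x * step g x * m x)"
    by (simp add: step_sym)
  also have "\<dots> = (\<Sum>x\<in>D. f x * (step ^^ n) (step g) x * m x)" by (rule Suc.IH)
  also have "(step ^^ n) (step g) = (step ^^ Suc n) g" by (simp only: funpow_Suc_right o_apply)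
  finally show ?case .
qed simp

text \<open>
  Reversibility. It lets one function play two roles: \<open>heat t f x\<close> is the mean of
  \<open>f\<close> over the chain started at \<open>x\<close>, and also the density at time
  \<open>t\<close> of the chain started with density \<open>f\<close>.
\<close>

lemma heat_sym: "(\<Sum>x\<in>D. heat t f x * g x * m x) = (\<Sum>x\<in>D. f x * heat t g x * m x)"
proof -
  have *: "(\<Sum>x\<in>D. heat t f x * h x)
     = exp (- clock * t) * (\<Sum>n. clock ^ n / fact n * t ^ n * (\<Sum>x\<in>D. (step ^^ n) f x * h x))" for f h
  proof -
    have "(\<Sum>x\<in>D. heat t f x * h x)
      = exp (- clock * t) * (\<Sum>x\<in>D. (\<Sum>n. clock ^ n / fact n * (step ^^ n) f x * t ^ n) * h x)"
      by (simp only: heat_def sum_distrib_left mult.assoc)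
    also have "(\<Sum>x\<in>D. (\<Sum>n. clock ^ n / fact n * (step ^^ n) f x * t ^ n) * h x)
      = (\<Sum>x\<in>D. \<Sum>n. clock ^ n / fact n * (step ^^ n) f x * t ^ n * h x)"
      by (intro sum.cong refl suminf_mult2 heat_summable)
    also have "(\<Sum>x\<in>D. \<Sum>n. clock ^ n / fact n * (step ^^ n) f x * t ^ n * h x)
       = (\<Sum>n. \<Sum>x\<in>D. clock ^ n / fact n * (step ^^ n) f x * t ^ n * h x)"
      by (intro suminf_sum[symmetric] summable_mult2 heat_summable)
    finally show ?thesis by (simp add: sum_distrib_left algebra_simps)
  qed
  have "(\<Sum>x\<in>D. heat t f x * g x * m x) = (\<Sum>x\<in>D. heat t f x * (g x * m x))" by (simp add: mult.assoc)
  also have "\<dots> = (\<Sum>x\<in>D. heat t g x * (f x * m x))"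
    unfolding * using steps_sym[of _ f g] by (simp add: mult_ac)
  finally show ?thesis by (simp add: mult_ac)
qed

lemma heat_mass: "(\<Sum>x\<in>D. heat t f x * m x) = (\<Sum>x\<in>D. f x * m x)"
  using heat_sym[of t f "\<lambda>_. 1"] by (simp add: heat_const)

end

section \<open>Entropy and mean displacement\<close>

lemma exp_dominates_powr:
  fixes K p :: real
  shows "\<exists>L\<ge>1. \<forall>l\<ge>L. K * l powr p \<le> exp l"
proof -
  have "eventually (\<lambda>l. (\<bar>K\<bar> + 1) * l powr (\<bar>p\<bar> + 1) \<le> exp l) at_top"
    by real_asymp
  hence "eventually (\<lambda>l. (\<bar>K\<bar> + 1) * l powr (\<bar>p\<bar> + 1) \<le> exp l \<and> l \<ge> 1) at_top"
    by (intro eventually_conj eventually_ge_at_top)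
  then obtain L where L: "\<And>l. l \<ge> L \<Longrightarrow> (\<bar>K\<bar> + 1) * l powr (\<bar>p\<bar> + 1) \<le> exp l \<and> l \<ge> 1"
    by (auto simp: eventually_at_top_linorder)
  have "K * l powr p \<le> exp l" if "l \<ge> max L 1" for l
  proof -
    have "K * l powr p \<le> (\<bar>K\<bar> + 1) * l powr (\<bar>p\<bar> + 1)"
      using that by (intro mult_mono powr_mono) auto
    also have "\<dots> \<le> exp l" using L that by auto
    finally show ?thesis .
  qed
  thus ?thesis by (intro exI[of _ "max L 1"]) auto
qed

text \<open>
  Above this value of $\ell$ an exponential beats the power of $\ell$ that arises when the Nash
  inequality is used at the scale $\rho\,\ell^{-5/\alpha}$.
\<close>

definition entropy_threshold :: "real \<Rightarrow> real \<Rightarrow> real \<Rightarrow> real" where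
  "entropy_threshold d \<alpha> A = (SOME L. L \<ge> 1 \<and> (\<forall>l\<ge>L. 2 * A\<^sup>2 * l powr (5 * d / \<alpha>) \<le> exp l))"

lemma entropy_threshold:
  "entropy_threshold d \<alpha> A \<ge> 1"
  "l \<ge> entropy_threshold d \<alpha> A \<Longrightarrow> 2 * A\<^sup>2 * l powr (5 * d / \<alpha>) \<le> exp l"
proof -
  have "\<exists>L. L \<ge> 1 \<and> (\<forall>l\<ge>L. 2 * A\<^sup>2 * l powr (5 * d / \<alpha>) \<le> exp l)"
    using exp_dominates_powr[of "2 * A\<^sup>2" "5 * d / \<alpha>"] by simp
  from someI_ex[OF this] show "entropy_threshold d \<alpha> A \<ge> 1"
    "l \<ge> entropy_threshold d \<alpha> A \<Longrightarrow> 2 * A\<^sup>2 * l powr (5 * d / \<alpha>) \<le> exp l"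
    by (auto simp: entropy_threshold_def)
qed

lemma diff_sq_div_le_ln:
  fixes a b :: real
  assumes "0 < a" "0 < b"
  shows "(a - b)\<^sup>2 / (a + b) \<le> (a - b) * (ln a - ln b)"
proof -
  have *: "(a - b)\<^sup>2 / (a + b) \<le> (a - b) * (ln a - ln b)" if "0 < b" "b \<le> a" for a b :: real
  proof -
    have "ln (b / a) \<le> b / a - 1" using that by (intro ln_le_minus_one) auto
    hence "(a - b) / a \<le> ln a - ln b" using that by (simp add: ln_div field_simps)
    moreover have "(a - b) / (a + b) \<le> (a - b) / a" using that by (intro divide_left_mono) auto
    ultimately have "(a - b) * ((a - b) / (a + b)) \<le> (a - b) * (ln a - ln b)"
      using that by (intro mult_left_mono) auto
    thus ?thesis by (simp add: power2_eq_square)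
  qed
  show ?thesis
  proof (cases "b \<le> a")
    case True thus ?thesis using * assms by auto
  next
    case False
    hence "(b - a)\<^sup>2 / (b + a) \<le> (b - a) * (ln b - ln a)" using * assms by auto
    thus ?thesis by (simp add: power2_commute add.commute algebra_simps)
  qed
qed

context finite_symmetric_chain
begin

lemma energy_commute: "energy f g = energy g f"
  by (simp add: energy_def mult_ac)

lemma energy_nonneg: "0 \<le> energy f f"
proof -
  have "0 \<le> k x y * m x * m y * (f x - f y) * (f x - f y)" if "x \<in> D" "y \<in> D" for x y
    using that k_nonneg[of x y] m_pos[of x] m_pos[of y] by (simp add: mult.assoc)
  thus ?thesis by (auto simp: energy_def intro!: sum_nonneg)
qed

text \<open>
  Pointwise, $-ab \le a^2 s/(2\nu) + \nu b^2/(2s)$ with $a$, $b$ the increments of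
  \<open>\<zeta>\<close> and \<open>g\<close> and $s = g(x)+g(y)$; the last term is at most the
  entropy production, because $b^2/s \le b\,(\ln g(x) - \ln g(y))$. For \<open>g\<close> the
  density of the chain, the left side is the speed of the mean of \<open>\<zeta>\<close>, so
  displacement is paid for by entropy.
\<close>

lemma energy_entropy_bound:
  assumes g: "\<And>x. x \<in> D \<Longrightarrow> 0 < g x" and lam: "0 < \<nu>"
    and B: "\<And>x. x \<in> D \<Longrightarrow> (\<Sum>y\<in>D. k x y * m y * (\<zeta> x - \<zeta> y)\<^sup>2) \<le> B"
  shows "- energy \<zeta> g \<le> B * (\<Sum>x\<in>D. g x * m x) / (2 * \<nu>) + \<nu> / 2 * energy g (\<lambda>x. ln (g x))"
proof -
  (* Complete the square in a * s + \<nu> * b. *)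
  have pt: "- ((\<zeta> x - \<zeta> y) * (g x - g y))
     \<le> (\<zeta> x - \<zeta> y)\<^sup>2 * (g x + g y) / (2 * \<nu>) + \<nu> / 2 * ((g x - g y) * (ln (g x) - ln (g y)))"
    if "x \<in> D" "y \<in> D" for x y
  proof -
    define s where "s = g x + g y"
    have s: "0 < s" using g that by (auto simp: s_def intro: add_pos_pos)
    define a b where "a = \<zeta> x - \<zeta> y" and "b = g x - g y"
    have "0 \<le> (a * s + \<nu> * b)\<^sup>2 / (2 * \<nu> * s)" using s lam by simp
    also have "\<dots> = a\<^sup>2 * s / (2 * \<nu>) + \<nu> / 2 * (b\<^sup>2 / s) + a * b"
      using s lam by (simp add: field_simps power2_eq_square)
    finally have "- (a * b) \<le> a\<^sup>2 * s / (2 * \<nu>) + \<nu> / 2 * (b\<^sup>2 / s)" by simp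
    also have "\<dots> \<le> a\<^sup>2 * s / (2 * \<nu>) + \<nu> / 2 * (b * (ln (g x) - ln (g y)))"
      using diff_sq_div_le_ln[of "g x" "g y"] g that lam
      by (intro add_left_mono mult_left_mono) (auto simp: s_def b_def)
    finally show ?thesis by (simp add: a_def b_def s_def)
  qed
  define w where "w = (\<lambda>x y. k x y * m x * m y)"
  have w: "0 \<le> w x y" if "x \<in> D" "y \<in> D" for x y
    using that k_nonneg[of x y] m_pos[of x] m_pos[of y] by (simp add: w_def)
  have "2 * (- energy \<zeta> g) = (\<Sum>x\<in>D. \<Sum>y\<in>D. w x y * (- ((\<zeta> x - \<zeta> y) * (g x - g y))))"
    by (simp add: energy_def w_def sum_negf mult.assoc)
  also have "\<dots> \<le> (\<Sum>x\<in>D. \<Sum>y\<in>D. w x y * ((\<zeta> x - \<zeta> y)\<^sup>2 * (g x + g y) / (2 * \<nu>)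
      + \<nu> / 2 * ((g x - g y) * (ln (g x) - ln (g y)))))"
    by (intro sum_mono mult_left_mono pt w) auto
  also have "\<dots> = (\<Sum>x\<in>D. \<Sum>y\<in>D. w x y * (\<zeta> x - \<zeta> y)\<^sup>2 * (g x + g y) / (2 * \<nu>)
      + \<nu> / 2 * (w x y * (g x - g y) * (ln (g x) - ln (g y))))"
    by (intro sum.cong refl) (simp add: distrib_left mult_ac)
  also have "\<dots> = (\<Sum>x\<in>D. \<Sum>y\<in>D. w x y * (\<zeta> x - \<zeta> y)\<^sup>2 * (g x + g y)) / (2 * \<nu>)
      + \<nu> * energy g (\<lambda>x. ln (g x))"
    by (simp add: sum.distrib sum_distrib_left[symmetric] sum_divide_distrib[symmetric] energy_def)
       (simp add: w_def)
  also have "(\<Sum>x\<in>D. \<Sum>y\<in>D. w x y * (\<zeta> x - \<zeta> y)\<^sup>2 * (g x + g y))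
      = 2 * (\<Sum>x\<in>D. \<Sum>y\<in>D. w x y * (\<zeta> x - \<zeta> y)\<^sup>2 * g x)"
  proof -
    have "(\<Sum>x\<in>D. \<Sum>y\<in>D. w x y * (\<zeta> x - \<zeta> y)\<^sup>2 * g y) = (\<Sum>x\<in>D. \<Sum>y\<in>D. w x y * (\<zeta> x - \<zeta> y)\<^sup>2 * g x)"
      by (subst sum.swap) (auto intro!: sum.cong simp: w_def k_sym power2_commute mult_ac)
    thus ?thesis by (simp add: distrib_left sum.distrib)
  qed
  also have "(\<Sum>x\<in>D. \<Sum>y\<in>D. w x y * (\<zeta> x - \<zeta> y)\<^sup>2 * g x)
      = (\<Sum>x\<in>D. g x * m x * (\<Sum>y\<in>D. k x y * m y * (\<zeta> x - \<zeta> y)\<^sup>2))"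
    by (simp add: w_def sum_distrib_left mult_ac)
  also have "\<dots> \<le> (\<Sum>x\<in>D. g x * m x * B)"
    using g m_pos by (intro sum_mono mult_left_mono B) (auto simp: less_imp_le)
  also have "\<dots> = B * (\<Sum>x\<in>D. g x * m x)" by (simp add: sum_distrib_left mult_ac)
  finally show ?thesis using lam by (simp add: divide_right_mono field_simps)
qed

end

text \<open>
  The Nash inequality holds only at scales \<open>s\<close> between \<open>s0\<close> and
  \<open>\<rho>\<close>. The assumption \<open>bottom\<close> says that \<open>s0\<close> is so
  small that the argument never asks for a smaller scale: $\ln(A^2\rho^d)$ is the largest
  possible value of the quantity $\ell$ below.
\<close>

locale nash_chain = finite_symmetric_chain +
  fixes d \<alpha> A \<rho> s0 :: real
  assumes d_pos: "0 < d" and \<alpha>_pos: "0 < \<alpha>" and A_ge: "1 \<le> A" and \<rho>_ge: "1 \<le> \<rho>"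
    and nash: "s0 \<le> s \<Longrightarrow> s \<le> \<rho> \<Longrightarrow>
      (\<Sum>x\<in>D. (f x)\<^sup>2 * m x)
        \<le> A * (s powr (- d) * (\<Sum>x\<in>D. \<bar>f x\<bar> * m x)\<^sup>2 + s powr \<alpha> * energy f f)"
    and mass_le: "(\<Sum>x\<in>D. m x) \<le> A * \<rho> powr d"
    and bottom: "s0 * ln (A\<^sup>2 * \<rho> powr d) powr (5 / \<alpha>) \<le> \<rho>" and s0_pos: "0 < s0"
begin

context
  fixes f :: "'a \<Rightarrow> real" and c :: real
  assumes c_pos: "0 < c" and f_ge: "\<And>x. x \<in> D \<Longrightarrow> c \<le> f x" and f_le: "\<And>x. x \<in> D \<Longrightarrow> f x \<le> A"
    and f_mass: "(\<Sum>x\<in>D. f x * m x) = 1"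
begin

definition total where "total = (\<Sum>x\<in>D. m x)"
definition l2 where "l2 t = (\<Sum>x\<in>D. (heat t f x)\<^sup>2 * m x)"

lemma total_pos: "0 < total"
proof -
  have "D \<noteq> {}" using f_mass by auto
  thus ?thesis unfolding total_def using finite_D m_pos by (intro sum_pos) auto
qed

lemma p_pos: "x \<in> D \<Longrightarrow> 0 \<le> t \<Longrightarrow> 0 < heat t f x"
  using heat_mono[of "\<lambda>_. c" f x t] f_ge c_pos by (simp add: heat_const)

lemma p_mass: "(\<Sum>x\<in>D. heat t f x * m x) = 1"
  by (simp add: heat_mass f_mass)

lemma l2_ge: "1 \<le> total * l2 t"
proof -
  have "0 \<le> (\<Sum>x\<in>D. (total * heat t f x - 1)\<^sup>2 * m x)"
    using m_pos by (intro sum_nonneg) (auto simp: less_imp_le)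
  also have "\<dots> = (\<Sum>x\<in>D. total\<^sup>2 * ((heat t f x)\<^sup>2 * m x) - 2 * total * (heat t f x * m x) + m x)"
    by (intro sum.cong refl) (simp add: power2_eq_square algebra_simps)
  also have "\<dots> = total\<^sup>2 * l2 t - 2 * total * 1 + total"
    by (simp add: sum.distrib sum_subtractf sum_distrib_left[symmetric] p_mass l2_def total_def[symmetric])
  finally have "total * 1 \<le> total * (total * l2 t)" by (simp add: power2_eq_square algebra_simps)
  thus ?thesis using total_pos by (simp only: mult_le_cancel_left_pos)
qed

lemma l2_pos: "0 < l2 t"
  using l2_ge[of t] total_pos by (smt (verit) mult_nonneg_nonpos)

lemma l2_deriv: "(l2 has_real_derivative - 2 * energy (heat t f) (heat t f)) (at t)"
proof -
  have "((\<lambda>t. \<Sum>x\<in>D. (heat t f x)\<^sup>2 * m x) has_real_derivative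
      (\<Sum>x\<in>D. 2 * (gen (heat t f) x * heat t f x * m x))) (at t)"
    by (auto intro!: derivative_eq_intros DERIV_sum heat_deriv simp: mult_ac)
  moreover have "(\<Sum>x\<in>D. 2 * (gen (heat t f) x * heat t f x * m x)) = - 2 * energy (heat t f) (heat t f)"
    by (simp add: sum_distrib_left[symmetric] sum_gen_by_parts)
  ultimately show ?thesis unfolding l2_def by (simp only:)
qed

text \<open>
  The total mass makes this logarithm nonnegative; it bounds the gap between the entropy of the
  density and its largest possible value.
\<close>

definition ell where "ell t = ln (total * l2 t)"

lemma ell_deriv: "(ell has_real_derivative - 2 * energy (heat t f) (heat t f) / l2 t) (at t)"
  unfolding ell_def using total_pos l2_pos[of t]
  by (auto intro!: derivative_eq_intros l2_deriv simp: field_simps)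

lemma ell_antimono: "s \<le> t \<Longrightarrow> ell t \<le> ell s"
  by (rule DERIV_nonpos_imp_nonincreasing)
     (use ell_deriv energy_nonneg l2_pos in \<open>force simp: divide_nonneg_pos less_imp_le\<close>)+

lemma ell_0_le: "ell 0 \<le> ln (A\<^sup>2 * \<rho> powr d)"
proof -
  have "l2 0 \<le> (\<Sum>x\<in>D. A * (f x * m x))"
    unfolding l2_def
  proof (intro sum_mono)
    fix x assume x: "x \<in> D"
    have "0 \<le> f x * m x" using f_ge[OF x] c_pos m_pos[OF x] by simp
    thus "(heat 0 f x)\<^sup>2 * m x \<le> A * (f x * m x)"
      using f_le[OF x] by (simp add: power2_eq_square mult.assoc mult_right_mono)
  qed
  also have "\<dots> = A" by (simp add: sum_distrib_left[symmetric] f_mass)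
  finally have "total * l2 0 \<le> (A * \<rho> powr d) * A"
    using mass_le total_pos l2_pos[of 0] A_ge by (intro mult_mono) (auto simp: total_def)
  thus ?thesis unfolding ell_def using total_pos l2_pos[of 0]
    by (subst ln_le_cancel_iff) (auto simp: power2_eq_square mult_ac intro: less_le_trans[rotated])
qed

text \<open>
  The Nash inequality at the scale $s=\rho\,\ell^{-5/\alpha}$. The exponent $5$ is a choice: any
  power above $3$ gives $\ell' \le -c\,\ell^{p}$ with $\ell$ integrable against $t^{-1/2}$, and
  $5$ makes $\ell$ of order $t^{-1/4}$, a double square root. This scale is smaller than $\rho$
  only by a power of a logarithm, so that it stays above \<open>s0\<close>.
\<close>

lemma ell_decay_rate:
  assumes t: "0 \<le> t" and l: "entropy_threshold d \<alpha> A \<le> ell t"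
  shows "- 2 * energy (heat t f) (heat t f) / l2 t \<le> - (ell t ^ 5) / (A * \<rho> powr \<alpha>)"
proof -
  define l where "l = ell t"
  have l1: "1 \<le> l" using entropy_threshold(1) l l_def order_trans by blast
  define s where "s = \<rho> * l powr (- 5 / \<alpha>)"
  have s_pos: "0 < s" using l1 \<rho>_ge by (simp add: s_def)
  have "s \<le> \<rho>" unfolding s_def using l1 \<rho>_ge \<alpha>_pos powr_mono[of "-5/\<alpha>" 0 l]
    by (simp add: mult_le_cancel_left1)
  moreover have "s0 \<le> s"
  proof -
    have "l \<le> ln (A\<^sup>2 * \<rho> powr d)" using ell_antimono[OF t] ell_0_le unfolding l_def by simp
    hence "s0 * l powr (5 / \<alpha>) \<le> s0 * ln (A\<^sup>2 * \<rho> powr d) powr (5 / \<alpha>)"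
      using l1 \<alpha>_pos s0_pos by (intro mult_left_mono powr_mono2) auto
    also have "\<dots> \<le> \<rho>" by (rule bottom)
    finally show ?thesis using l1 by (simp add: s_def powr_minus field_simps)
  qed
  ultimately have N: "l2 t \<le> A * (s powr (- d) * (\<Sum>x\<in>D. \<bar>heat t f x\<bar> * m x)\<^sup>2
      + s powr \<alpha> * energy (heat t f) (heat t f))"
    unfolding l2_def by (intro nash)
  have "(\<Sum>x\<in>D. \<bar>heat t f x\<bar> * m x) = (\<Sum>x\<in>D. heat t f x * m x)"
    using p_pos t by (intro sum.cong) (auto simp: abs_of_pos)
  hence N: "l2 t \<le> A * s powr (- d) + A * s powr \<alpha> * energy (heat t f) (heat t f)"
    using N by (simp only: p_mass) (simp add: algebra_simps)
  have sa: "s powr \<alpha> = \<rho> powr \<alpha> / l ^ 5"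
  proof -
    have "(l powr (- 5 / \<alpha>)) powr \<alpha> = l powr (- 5)" using \<alpha>_pos by (simp only: powr_powr) simp
    also have "\<dots> = 1 / l ^ 5" using l1 by (simp add: powr_minus_divide powr_numeral)
    finally show ?thesis using l1 \<rho>_ge by (simp only: s_def powr_mult) simp
  qed
  have sd: "s powr (- d) = \<rho> powr (- d) * l powr (5 * d / \<alpha>)"
    using l1 \<rho>_ge \<alpha>_pos by (simp add: s_def powr_mult powr_powr mult.commute)
  have "A * s powr (- d) \<le> l2 t / 2"
  proof -
    have "2 * A\<^sup>2 * l powr (5 * d / \<alpha>) \<le> exp l"
      using l unfolding l_def by (rule entropy_threshold(2))
    also have "exp l = total * l2 t" using total_pos l2_pos[of t] by (simp add: l_def ell_def)
    also have "\<dots> \<le> A * \<rho> powr d * l2 t"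
      using mass_le l2_pos[of t] by (intro mult_right_mono) (auto simp: total_def)
    finally have "A * (2 * A * l powr (5 * d / \<alpha>)) \<le> A * (\<rho> powr d * l2 t)"
      by (simp add: power2_eq_square mult_ac)
    hence "2 * A * l powr (5 * d / \<alpha>) \<le> \<rho> powr d * l2 t" using A_ge by simp
    hence "\<rho> powr (- d) * (2 * A * l powr (5 * d / \<alpha>)) \<le> \<rho> powr (- d) * (\<rho> powr d * l2 t)"
      by (intro mult_left_mono) auto
    also have "\<dots> = l2 t" using \<rho>_ge by (simp add: powr_minus)
    finally show ?thesis by (simp add: sd mult_ac)
  qed
  hence "l2 t / 2 \<le> A * \<rho> powr \<alpha> / l ^ 5 * energy (heat t f) (heat t f)"
    using N unfolding sa times_divide_eq_right by linarith
  thus ?thesis using l2_pos[of t] A_ge \<rho>_ge l1 unfolding l_def[symmetric]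
    by (simp add: field_simps)
qed

text \<open>
  While $\ell$ is above the threshold, $\ell^{-4}$ grows at least linearly.
\<close>

lemma ell_le:
  assumes t: "0 < t"
  shows "ell t \<le> entropy_threshold d \<alpha> A + sqrt (sqrt (A * \<rho> powr \<alpha> / 4)) / sqrt (sqrt t)"
proof (cases "ell t \<le> entropy_threshold d \<alpha> A")
  case True
  moreover have "0 \<le> sqrt (sqrt (A * \<rho> powr \<alpha> / 4)) / sqrt (sqrt t)" using A_ge t by simp
  ultimately show ?thesis by linarith
next
  case False
  define K where "K = A * \<rho> powr \<alpha>"
  have K: "0 < K" using A_ge \<rho>_ge by (simp add: K_def)
  have big: "entropy_threshold d \<alpha> A \<le> ell \<tau>" "1 \<le> ell \<tau>" if "\<tau> \<le> t" for \<tau>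
    using False ell_antimono[OF that] entropy_threshold(1)[of d \<alpha> A] by linarith+
  have "1 / ell 0 ^ 4 - 4 / K * 0 \<le> 1 / ell t ^ 4 - 4 / K * t"
  proof (rule DERIV_nonneg_imp_nondecreasing[where f="\<lambda>\<tau>. 1 / ell \<tau> ^ 4 - 4 / K * \<tau>"])
    fix \<tau> assume tau: "0 \<le> \<tau>" "\<tau> \<le> t"
    let ?e = "- 2 * energy (heat \<tau> f) (heat \<tau> f) / l2 \<tau>"
    have pos: "1 \<le> ell \<tau>" using big tau by auto
    have "((\<lambda>\<tau>. 1 / ell \<tau> ^ 4 - 4 / K * \<tau>) has_real_derivative - 4 * ?e / ell \<tau> ^ 5 - 4 / K) (at \<tau>)"
    proof -
      have "((\<lambda>\<tau>. 1 / ell \<tau> ^ 4) has_real_derivative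
          (0 * ell \<tau> ^ 4 - 1 * (4 * ell \<tau> ^ 3 * ?e)) / (ell \<tau> ^ 4 * ell \<tau> ^ 4)) (at \<tau>)"
        by (rule DERIV_divide) (use pos in \<open>auto intro!: derivative_eq_intros ell_deriv\<close>)
      also have "(0 * ell \<tau> ^ 4 - 1 * (4 * ell \<tau> ^ 3 * ?e)) / (ell \<tau> ^ 4 * ell \<tau> ^ 4) = - 4 * ?e / ell \<tau> ^ 5"
        using pos l2_pos[of \<tau>] by (simp add: divide_simps power_numeral_reduce)
      finally show ?thesis by (intro DERIV_diff DERIV_cmult_Id)
    qed
    moreover have "?e \<le> - (ell \<tau> ^ 5) / K"
      unfolding K_def using ell_decay_rate[of \<tau>] big(1)[of \<tau>] tau by auto
    hence "?e / ell \<tau> ^ 5 \<le> - (ell \<tau> ^ 5) / K / ell \<tau> ^ 5"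
      using pos by (intro divide_right_mono) auto
    hence "?e / ell \<tau> ^ 5 \<le> - 1 / K" using pos by simp
    hence "- 4 * (- 1 / K) \<le> - 4 * (?e / ell \<tau> ^ 5)" by linarith
    hence "0 \<le> - 4 * ?e / ell \<tau> ^ 5 - 4 / K" by simp
    ultimately show "\<exists>y. ((\<lambda>\<tau>. 1 / ell \<tau> ^ 4 - 4 / K * \<tau>) has_real_derivative y) (at \<tau>) \<and> 0 \<le> y"
      by blast
  qed (use t in auto)
  moreover have "0 \<le> 1 / ell 0 ^ 4" using big(2)[of 0] t by simp
  ultimately have "4 / K * t \<le> 1 / ell t ^ 4" by linarith
  hence "ell t ^ 4 \<le> K / (4 * t)"
    using t K big(2)[of t] by (simp add: field_simps)
  hence "sqrt (sqrt (ell t ^ 4)) \<le> sqrt (sqrt (K / (4 * t)))" by (intro real_sqrt_le_mono)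
  moreover have "sqrt (sqrt (ell t ^ 4)) = ell t"
  proof -
    have "ell t ^ 4 = (ell t ^ 2) ^ 2" by simp
    thus ?thesis using big(2)[of t] by (metis abs_of_nonneg order.refl order_trans real_sqrt_abs zero_le_one zero_le_power2)
  qed
  moreover have "K / (4 * t) = (K / 4) / t" by simp
  ultimately have "ell t \<le> sqrt (sqrt (K / 4)) / sqrt (sqrt t)" by (simp only: real_sqrt_divide)
  thus ?thesis using entropy_threshold(1)[of d \<alpha> A] unfolding K_def by linarith
qed

definition entropy where "entropy t = - (\<Sum>x\<in>D. heat t f x * ln (heat t f x) * m x)"

lemma entropy_deriv:
  assumes "0 \<le> t"
  shows "(entropy has_real_derivative energy (heat t f) (\<lambda>x. ln (heat t f x))) (at t)"
proof -
  have "((\<lambda>t. - (\<Sum>x\<in>D. heat t f x * ln (heat t f x) * m x)) has_real_derivative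
      - (\<Sum>x\<in>D. gen (heat t f) x * ln (heat t f x) * m x + gen (heat t f) x * 1 * m x)) (at t)"
    using p_pos[OF _ assms]
    by (auto intro!: derivative_eq_intros DERIV_sum heat_deriv simp: field_simps)
       (auto simp: sum.distrib algebra_simps dest!: p_pos[OF _ assms] intro!: sum.cong)
  moreover have "- (\<Sum>x\<in>D. gen (heat t f) x * ln (heat t f x) * m x + gen (heat t f) x * 1 * m x)
     = energy (heat t f) (\<lambda>x. ln (heat t f x))"
    by (simp only: sum.distrib sum_gen_by_parts) (simp add: energy_def)
  ultimately show ?thesis unfolding entropy_def by (simp only:)
qed

lemma entropy_le: "0 \<le> t \<Longrightarrow> entropy t \<le> ln total"
proof -
  assume t: "0 \<le> t"
  have "- (heat t f x * ln (heat t f x) * m x) \<le> ln total * (heat t f x * m x) + m x / total - heat t f x * m x"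
    if x: "x \<in> D" for x
  proof -
    define a where "a = heat t f x"
    have a: "0 < a" using p_pos x t by (simp add: a_def)
    have "ln (1 / (total * a)) \<le> 1 / (total * a) - 1" using a total_pos by (intro ln_le_minus_one) auto
    hence "- ln a \<le> ln total + 1 / (total * a) - 1" using a total_pos by (simp add: ln_div ln_mult)
    hence "a * m x * (- ln a) \<le> a * m x * (ln total + 1 / (total * a) - 1)"
      using a m_pos[OF x] by (intro mult_left_mono) auto
    also have "a * m x * (ln total + 1 / (total * a) - 1) = ln total * (a * m x) + m x / total - a * m x"
      using a total_pos by (simp add: field_simps)
    finally show ?thesis by (simp add: a_def[symmetric] mult_ac)
  qed
  hence "entropy t \<le> (\<Sum>x\<in>D. ln total * (heat t f x * m x) + m x / total - heat t f x * m x)"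
    unfolding entropy_def sum_negf[symmetric] by (intro sum_mono)
  also have "\<dots> = ln total"
    using total_pos by (simp add: sum.distrib sum_subtractf sum_distrib_left[symmetric] p_mass
      sum_divide_distrib[symmetric] total_def[symmetric])
  finally show ?thesis .
qed

lemma entropy_ge: "0 \<le> t \<Longrightarrow> - ln (l2 t) \<le> entropy t"
proof -
  assume t: "0 \<le> t"
  define Y where "Y = l2 t"
  have Y: "0 < Y" using l2_pos by (simp add: Y_def)
  have "heat t f x * ln (heat t f x) * m x
      \<le> ln Y * (heat t f x * m x) + (heat t f x)\<^sup>2 * m x / Y - heat t f x * m x"
    if x: "x \<in> D" for x
  proof -
    define a where "a = heat t f x"
    have a: "0 < a" using p_pos x t by (simp add: a_def)
    have "ln (a / Y) \<le> a / Y - 1" using a Y by (intro ln_le_minus_one) auto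
    hence "ln a \<le> ln Y + a / Y - 1" using a Y by (simp add: ln_div)
    hence "a * m x * ln a \<le> a * m x * (ln Y + a / Y - 1)"
      using a m_pos[OF x] by (intro mult_left_mono) auto
    thus ?thesis using a Y by (simp add: a_def[symmetric] field_simps power2_eq_square)
  qed
  hence "- entropy t \<le> (\<Sum>x\<in>D. ln Y * (heat t f x * m x) + (heat t f x)\<^sup>2 * m x / Y - heat t f x * m x)"
    unfolding entropy_def minus_minus by (intro sum_mono)
  also have "\<dots> = ln Y + l2 t / Y - 1"
    by (simp add: sum.distrib sum_subtractf sum_distrib_left[symmetric] p_mass
      sum_divide_distrib[symmetric] l2_def[symmetric])
  finally show ?thesis using Y by (simp add: Y_def)
qed

text \<open>
  Nash's displacement bound. With the weight $\nu=\kappa\sqrt t$ in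
  \<open>energy_entropy_bound\<close>, the entropy production is integrated by parts against
  $\kappa\sqrt t$: the boundary term at $0$ vanishes, at time $t$ it has the good sign because
  the entropy is at most $\ln$ of the total mass, and what remains is the entropy deficit
  against $t^{-1/2}$, which \<open>ell_le\<close> makes integrable. In the proof this is the
  monotonicity of $\Phi$, and $H$ is the antiderivative of the remaining terms.
\<close>

lemma moment_growth:
  fixes \<zeta> :: "'a \<Rightarrow> real"
  assumes jump: "\<And>x. x \<in> D \<Longrightarrow> (\<Sum>y\<in>D. k x y * m y * (\<zeta> x - \<zeta> y)\<^sup>2) \<le> A * \<rho> powr (2 - \<alpha>)"
    and t: "0 < t" "t \<le> \<rho> powr \<alpha>"
  shows "(\<Sum>x\<in>D. \<zeta> x * heat t f x * m x)
    \<le> (\<Sum>x\<in>D. \<zeta> x * f x * m x) + (2 * A + entropy_threshold d \<alpha> A) * \<rho> * sqrt (sqrt (t / \<rho> powr \<alpha>))"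
proof -
  define L where "L = entropy_threshold d \<alpha> A"
  have L1: "1 \<le> L" unfolding L_def by (rule entropy_threshold)
  define \<kappa> where "\<kappa> = \<rho> powr (1 - \<alpha> / 2)"
  have kap: "0 < \<kappa>" using \<rho>_ge by (simp add: \<kappa>_def)
  have kap2: "\<rho> powr (2 - \<alpha>) = \<kappa>\<^sup>2"
    using \<rho>_ge by (simp add: \<kappa>_def power2_eq_square powr_add[symmetric])
  define a4 where "a4 = sqrt (sqrt (A * \<rho> powr \<alpha> / 4))"
  define M where "M = (\<lambda>t. \<Sum>x\<in>D. \<zeta> x * heat t f x * m x)"
  define H where "H = (\<lambda>t. \<kappa> * ((A + L / 2) * sqrt t + a4 * sqrt (sqrt t)))"
  define \<Phi> where "\<Phi> = (\<lambda>t. M t - \<kappa> * sqrt t / 2 * (entropy t - ln total) - H t)"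
  have Md: "(M has_real_derivative - energy \<zeta> (heat \<tau> f)) (at \<tau>)" for \<tau>
  proof -
    have "(M has_real_derivative (\<Sum>x\<in>D. gen (heat \<tau> f) x * \<zeta> x * m x)) (at \<tau>)"
      unfolding M_def by (auto intro!: derivative_eq_intros DERIV_sum heat_deriv simp: mult_ac)
    thus ?thesis by (simp only: sum_gen_by_parts energy_commute[of \<zeta>])
  qed
  have cont: "continuous_on {0..t} \<Phi>"
  proof -
    have "continuous_on {0..t} M"
      by (rule DERIV_continuous_on[OF has_field_derivative_at_within[OF Md]])
    moreover have "continuous_on {0..t} entropy"
      by (rule DERIV_continuous_on) (auto intro: has_field_derivative_at_within entropy_deriv)
    ultimately show ?thesis unfolding \<Phi>_def H_def by (intro continuous_intros) auto
  qed
  have "\<Phi> t \<le> \<Phi> 0"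
  proof (rule DERIV_nonpos_imp_decreasing_open[OF _ _ cont])
    fix \<tau> assume tau: "0 < \<tau>" "\<tau> < t"
    define q where "q = sqrt (sqrt \<tau>)"
    have q: "0 < q" using tau by (simp add: q_def)
    have st: "sqrt \<tau> = q\<^sup>2" using tau by (simp add: q_def)
    define E where "E = energy (heat \<tau> f) (\<lambda>x. ln (heat \<tau> f x))"
    define D' where "D' = - energy \<zeta> (heat \<tau> f) - (\<kappa> / (4 * q\<^sup>2) * (entropy \<tau> - ln total) + \<kappa> * q\<^sup>2 / 2 * E)
        - \<kappa> * ((A + L / 2) / (2 * q\<^sup>2) + a4 / (4 * q ^ 3))"
    have q3: "q ^ 3 = sqrt (sqrt \<tau>) * sqrt \<tau>"
      using q by (simp add: st q_def[symmetric] power3_eq_cube power2_eq_square)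
    have "(\<Phi> has_real_derivative D') (at \<tau>)"
      unfolding \<Phi>_def H_def
      by (rule DERIV_cong, (rule derivative_eq_intros Md entropy_deriv refl | use tau in force)+)
         (use tau in \<open>simp add: D'_def E_def[symmetric] st[symmetric] q3 field_simps\<close>)
    moreover have "D' \<le> 0"
    proof -
      have "- energy \<zeta> (heat \<tau> f) \<le> (A * \<kappa>\<^sup>2) * (\<Sum>x\<in>D. heat \<tau> f x * m x) / (2 * (\<kappa> * q\<^sup>2)) + \<kappa> * q\<^sup>2 / 2 * E"
        unfolding E_def by (rule energy_entropy_bound)
          (use jump kap q tau p_pos in \<open>auto simp: kap2[symmetric]\<close>)
      also have "(A * \<kappa>\<^sup>2) * (\<Sum>x\<in>D. heat \<tau> f x * m x) / (2 * (\<kappa> * q\<^sup>2)) = \<kappa> * A / (2 * q\<^sup>2)"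
        using kap q by (simp add: p_mass power2_eq_square)
      finally have 1: "- energy \<zeta> (heat \<tau> f) \<le> \<kappa> * A / (2 * q\<^sup>2) + \<kappa> * q\<^sup>2 / 2 * E" .
      have "ln total - entropy \<tau> \<le> ell \<tau>"
        using entropy_ge[of \<tau>] tau total_pos l2_pos[of \<tau>] by (simp add: ell_def ln_mult)
      also have "\<dots> \<le> L + a4 / q" using ell_le[OF tau(1)] by (simp add: L_def a4_def q_def)
      finally have "\<kappa> / (4 * q\<^sup>2) * (ln total - entropy \<tau>) \<le> \<kappa> / (4 * q\<^sup>2) * (L + a4 / q)"
        using kap q by (intro mult_left_mono) auto
      hence 2: "- (\<kappa> / (4 * q\<^sup>2) * (entropy \<tau> - ln total)) \<le> \<kappa> / (4 * q\<^sup>2) * (L + a4 / q)"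
        by (simp only: mult_minus_right[symmetric] minus_diff_eq)
      have 3: "\<kappa> * A / (2 * q\<^sup>2) + \<kappa> / (4 * q\<^sup>2) * (L + a4 / q)
          = \<kappa> * ((A + L / 2) / (2 * q\<^sup>2) + a4 / (4 * q ^ 3))"
        using q by (simp add: field_simps power2_eq_square power3_eq_cube)
      show ?thesis unfolding D'_def using 1 2 3 by linarith
    qed
    ultimately show "\<exists>y. (\<Phi> has_real_derivative y) (at \<tau>) \<and> y \<le> 0" by blast
  qed (use t in auto)
  moreover have "\<Phi> 0 = M 0" by (simp add: \<Phi>_def H_def)
  moreover have "\<kappa> * sqrt t / 2 * (entropy t - ln total) \<le> 0"
    using entropy_le[of t] kap t by (intro mult_nonneg_nonpos) auto
  ultimately have 1: "M t \<le> M 0 + H t" by (simp add: \<Phi>_def)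
  define \<tau> where "\<tau> = sqrt (sqrt (t / \<rho> powr \<alpha>))"
  have tau: "0 < \<tau>" "\<tau> \<le> 1" using t \<rho>_ge by (auto simp: \<tau>_def)
  define r where "r = sqrt (sqrt (\<rho> powr \<alpha>))"
  have r2: "sqrt (\<rho> powr \<alpha>) = r\<^sup>2" by (simp add: r_def)
  have kr: "\<kappa> * r\<^sup>2 = \<rho>"
    unfolding r2[symmetric] using \<rho>_ge
    by (simp add: \<kappa>_def powr_half_sqrt[symmetric] powr_powr powr_add[symmetric])
  have r_pos: "0 < r" using \<rho>_ge by (simp add: r_def)
  have q4: "sqrt (sqrt t) = r * \<tau>" unfolding r_def \<tau>_def real_sqrt_mult[symmetric] using \<rho>_ge by simp
  have q2: "sqrt t = r\<^sup>2 * \<tau>\<^sup>2"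
  proof -
    have "sqrt t = (sqrt (sqrt t))\<^sup>2" using t by simp
    thus ?thesis unfolding q4 by (simp add: power_mult_distrib)
  qed
  have a4: "a4 \<le> A * r"
  proof -
    have "A \<le> A ^ 4" using A_ge self_le_power[of A 4] by simp
    hence "A / 4 \<le> A ^ 4" using A_ge by linarith
    hence "sqrt (sqrt (A / 4)) \<le> sqrt (sqrt (A ^ 4))" by (intro real_sqrt_le_mono)
    also have "A ^ 4 = (A\<^sup>2)\<^sup>2" by simp
    also have "sqrt (sqrt ((A\<^sup>2)\<^sup>2)) = A" using A_ge by (simp only: real_sqrt_abs) simp
    finally have "sqrt (sqrt (A / 4)) \<le> A" .
    moreover have "a4 = sqrt (sqrt (A / 4)) * r" by (simp add: a4_def r_def real_sqrt_mult[symmetric])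
    ultimately show ?thesis using r_pos by simp
  qed
  have "H t = (A + L / 2) * (\<kappa> * r\<^sup>2) * \<tau>\<^sup>2 + \<kappa> * a4 * r * \<tau>"
    unfolding H_def q4 unfolding q2 by (simp add: algebra_simps)
  also have "\<dots> \<le> (A + L / 2) * (\<kappa> * r\<^sup>2) * \<tau> + \<kappa> * (A * r) * r * \<tau>"
  proof (intro add_mono mult_left_mono mult_right_mono a4)
    show "\<tau>\<^sup>2 \<le> \<tau>" using tau by (simp add: power2_eq_square)
  qed (use A_ge L1 kap tau r_pos in auto)
  also have "\<dots> = (2 * A + L / 2) * \<rho> * \<tau>" by (simp add: kr[symmetric] power2_eq_square algebra_simps)
  also have "\<dots> \<le> (2 * A + L) * \<rho> * \<tau>" using L1 \<rho>_ge tau by (intro mult_right_mono) auto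
  finally show ?thesis using 1 by (simp add: M_def L_def \<tau>_def)
qed

end

end

context finite_symmetric_chain
begin

lemma heat_affine:
  assumes "x \<in> D"
  shows "heat t (\<lambda>y. a + c * f y) x = a + c * heat t f x"
proof -
  have st: "step (\<lambda>y. a + c * g y) = (\<lambda>y. a + c * step g y)" for g
  proof
    fix z
    have "(\<Sum>y\<in>D. k z y * m y * (a + c * g y - (a + c * g z))) = c * (\<Sum>y\<in>D. k z y * m y * (g y - g z))"
      by (simp add: sum_distrib_left algebra_simps)
    thus "step (\<lambda>y. a + c * g y) z = a + c * step g z"
      by (simp add: step_def gen_def distrib_left)
  qed
  have steps: "(step ^^ n) (\<lambda>y. a + c * f y) = (\<lambda>y. a + c * (step ^^ n) f y)" for n
    by (induction n) (simp_all add: st)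
  have sc: "summable (\<lambda>n. clock ^ n / fact n * a * t ^ n)"
    using heat_summable[OF assms, of "\<lambda>_. a" t] by (simp add: steps_const)
  have "(\<Sum>n. clock ^ n / fact n * (a + c * (step ^^ n) f x) * t ^ n)
     = (\<Sum>n. clock ^ n / fact n * a * t ^ n) + (\<Sum>n. c * (clock ^ n / fact n * (step ^^ n) f x * t ^ n))"
    by (subst suminf_add[OF sc summable_mult[OF heat_summable[OF assms]]])
       (simp add: algebra_simps)
  also have "(\<Sum>n. c * (clock ^ n / fact n * (step ^^ n) f x * t ^ n))
     = c * (\<Sum>n. clock ^ n / fact n * (step ^^ n) f x * t ^ n)"
    by (rule suminf_mult[OF heat_summable[OF assms]])
  finally show ?thesis
    unfolding heat_def steps using exp_clock_sums[of t a] by (simp add: distrib_left)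
qed

end

section \<open>Constants\<close>

lemma weighted_Cauchy_Schwarz:
  fixes w g :: "'a \<Rightarrow> real"
  assumes "\<And>x. x \<in> A \<Longrightarrow> 0 < w x"
  shows "(\<Sum>x\<in>A. g x)\<^sup>2 \<le> (\<Sum>x\<in>A. w x * (g x)\<^sup>2) * (\<Sum>x\<in>A. 1 / w x)"
proof -
  have "(\<Sum>x\<in>A. g x)\<^sup>2 = (\<Sum>x\<in>A. (sqrt (w x) * g x) * (1 / sqrt (w x)))\<^sup>2"
    by (intro arg_cong[where f="\<lambda>x. x\<^sup>2"] sum.cong refl) (auto dest!: assms)
  also have "\<dots> \<le> (\<Sum>x\<in>A. (sqrt (w x) * g x)\<^sup>2) * (\<Sum>x\<in>A. (1 / sqrt (w x))\<^sup>2)"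
    by (rule Cauchy_Schwarz_ineq_sum)
  also have "\<dots> = (\<Sum>x\<in>A. w x * (g x)\<^sup>2) * (\<Sum>x\<in>A. 1 / w x)"
    using assms by (intro arg_cong2[where f="(*)"] sum.cong refl)
      (auto simp: power_mult_distrib power_divide less_imp_le)
  finally show ?thesis .
qed

text \<open>
  The constants are functions of these six numbers alone, which is what makes the exponents and
  constants of the theorem the same for all graphs.
\<close>

locale model_constants =
  fixes d \<alpha> c\<^sub>M c\<^sub>G c\<^sub>0 C :: real
  assumes d_pos: "0 < d" and \<alpha>_pos: "0 < \<alpha>"
    and cM_ge: "1 \<le> c\<^sub>M" and cG_ge: "1 \<le> c\<^sub>G"
    and c0_gt: "1 / 2 < c\<^sub>0" and c0_less: "c\<^sub>0 < 1" and C_pos: "0 < C"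
begin

lemma cstar_ge: "8 \<le> cstar c\<^sub>G d"
  unfolding cstar_def using cG_ge d_pos ge_one_powr_ge_zero[of c\<^sub>G "2 / d"] by simp

definition density_const :: real where "density_const = c\<^sub>0 / (4 powr d * c\<^sub>G)"

text \<open>
  One constant large enough for every inequality that the auxiliary chain has to satisfy: the
  Nash inequality, the volume bound, the second moment of short jumps and the initial density.
\<close>

definition chain_const :: real where
  "chain_const = 1 + 2 * c\<^sub>G / density_const\<^sup>2 + 4 * c\<^sub>M * C / density_const\<^sup>2
     + c\<^sub>G * 2 powr d + c\<^sub>M * C + c\<^sub>M"

lemma density_const_pos: "0 < density_const"
  using c0_gt cG_ge by (simp add: density_const_def)

lemma chain_const_ge:
  "1 \<le> chain_const" "2 * c\<^sub>G / density_const\<^sup>2 \<le> chain_const"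
  "4 * c\<^sub>M * C / density_const\<^sup>2 \<le> chain_const" "c\<^sub>G * 2 powr d \<le> chain_const"
  "c\<^sub>M * C \<le> chain_const" "c\<^sub>M \<le> chain_const"
proof -
  have "0 \<le> 2 * c\<^sub>G / density_const\<^sup>2" "0 \<le> 4 * c\<^sub>M * C / density_const\<^sup>2"
    "0 \<le> c\<^sub>G * 2 powr d" "0 \<le> c\<^sub>M * C" "0 \<le> c\<^sub>M"
    using cG_ge cM_ge C_pos by auto
  thus "1 \<le> chain_const" "2 * c\<^sub>G / density_const\<^sup>2 \<le> chain_const"
  "4 * c\<^sub>M * C / density_const\<^sup>2 \<le> chain_const" "c\<^sub>G * 2 powr d \<le> chain_const"
  "c\<^sub>M * C \<le> chain_const" "c\<^sub>M \<le> chain_const"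
    unfolding chain_const_def by linarith+
qed

definition diffusion_const :: real where
  "diffusion_const = 2 * chain_const + entropy_threshold d \<alpha> chain_const"

text \<open>
  Chosen so that the displacement bound \<open>moment_growth\<close> is at most $\rho/64$ up to
  time \<open>time_const\<close> times $\rho^\alpha$; the fourth power undoes the double square
  root there.
\<close>

definition time_const :: real where
  "time_const = (1 / (64 * diffusion_const)) ^ 4"

lemma diffusion_const_ge: "1 \<le> diffusion_const"
  using chain_const_ge(1) entropy_threshold(1)[of d \<alpha> chain_const] by (simp add: diffusion_const_def)

lemma time_const_bounds: "0 < time_const" "time_const \<le> 1"
  unfolding time_const_def using diffusion_const_ge by (auto intro!: zero_less_power power_le_one)

definition barrier_const :: real where
  "barrier_const = exp (- (c\<^sub>M * C)) * (3 / 8)"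

definition tail_const :: real where
  "tail_const = c\<^sub>M * C * 2 powr (\<alpha> / 2) / (1 - 2 powr (- \<alpha> / 2))"

lemma tail_const_pos: "0 < tail_const"
  using cM_ge C_pos \<alpha>_pos powr_less_mono[of "-\<alpha>/2" 0 2] by (simp add: tail_const_def)

definition jump_in_const :: real where
  "jump_in_const = 2 powr (- (d + \<alpha>)) / (c\<^sub>M * C * c\<^sub>G\<^sup>2)"

definition gain :: real where
  "gain = min jump_in_const 1"

definition growth_const :: real where
  "growth_const = gain * time_const * (c\<^sub>0 - 1 / 2)\<^sup>2 / 8 * barrier_const"

lemma gain_bounds: "0 < gain" "gain \<le> 1" "gain \<le> jump_in_const"
  using cM_ge C_pos cG_ge by (auto simp: gain_def jump_in_const_def)

lemma growth_const_bounds: "0 < growth_const" "growth_const < 1"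
proof -
  have b: "0 < barrier_const" "barrier_const \<le> 1"
  proof -
    have "exp (- (c\<^sub>M * C)) \<le> 1" using cM_ge C_pos by simp
    thus "barrier_const \<le> 1" unfolding barrier_const_def by linarith
  qed (simp add: barrier_const_def)
  have sq: "0 < (c\<^sub>0 - 1 / 2)\<^sup>2" "(c\<^sub>0 - 1 / 2)\<^sup>2 \<le> 1"
    using c0_gt c0_less by (auto intro!: power_le_one)
  show "0 < growth_const" unfolding growth_const_def using b sq gain_bounds time_const_bounds by simp
  have "gain * time_const * (c\<^sub>0 - 1 / 2)\<^sup>2 * barrier_const \<le> 1"
    using b sq gain_bounds time_const_bounds by (intro mult_le_one mult_nonneg_nonneg) auto
  thus "growth_const < 1" unfolding growth_const_def by simp
qed

end

section \<open>Graph distance, volume and jump rates\<close>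

locale stable_graph = model_constants +
  fixes G :: "('a, 'b) wgraph_scheme" and r\<^sub>G :: ereal
  assumes graph: "stable_like_graph G d \<alpha> c\<^sub>M c\<^sub>G r\<^sub>G"
begin

abbreviation "V \<equiv> verts G"
abbreviation "m \<equiv> \<lambda>x. vmass G x"
abbreviation "\<delta> \<equiv> gdist G"
abbreviation "J \<equiv> \<lambda>x y. conductance G d \<alpha> x y * vmass G y"

lemma edges_verts: "(x, y) \<in> edges G \<Longrightarrow> x \<in> V \<and> y \<in> V"
  using graph by (auto simp: stable_like_graph_def connected_locally_finite_graph_def)

lemma relpow_flip: "(x, y) \<in> edges G ^^ n \<Longrightarrow> (y, x) \<in> edges G ^^ n"
proof (induction n arbitrary: y)
  case (Suc n)
  then obtain z where z: "(x, z) \<in> edges G ^^ n" "(z, y) \<in> edges G" by auto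
  have "(y, z) \<in> edges G" using z graph
    by (auto simp: stable_like_graph_def connected_locally_finite_graph_def dest: symD)
  thus ?case using Suc.IH[OF z(1)] by (rule relpow_Suc_I2)
qed auto

lemma relpow_verts: "(x, y) \<in> edges G ^^ n \<Longrightarrow> x \<in> V \<Longrightarrow> y \<in> V"
  by (cases n) (auto dest: edges_verts)

lemma gdist_relpow: "x \<in> V \<Longrightarrow> y \<in> V \<Longrightarrow> (x, y) \<in> edges G ^^ \<delta> x y"
proof -
  assume "x \<in> V" "y \<in> V"
  hence "\<exists>n. (x, y) \<in> edges G ^^ n" using graph
    by (auto simp: stable_like_graph_def connected_locally_finite_graph_def rtrancl_power)
  thus ?thesis unfolding gdist_def by (rule LeastI_ex)
qed

lemma gdist_le: "(x, y) \<in> edges G ^^ n \<Longrightarrow> \<delta> x y \<le> n"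
  unfolding gdist_def by (rule Least_le)

lemma gdist_sym: "\<delta> x y = \<delta> y x"
  unfolding gdist_def using relpow_flip by metis

lemma gdist_self [simp]: "\<delta> x x = 0"
  using gdist_le[of x x 0] by simp

lemma gdist_triangle: "x \<in> V \<Longrightarrow> y \<in> V \<Longrightarrow> z \<in> V \<Longrightarrow> \<delta> x z \<le> \<delta> x y + \<delta> y z"
  by (rule gdist_le) (auto simp: relpow_add intro: gdist_relpow)

lemma gdist_triangle_real:
  "x \<in> V \<Longrightarrow> y \<in> V \<Longrightarrow> z \<in> V \<Longrightarrow> real (\<delta> x z) \<le> real (\<delta> x y) + real (\<delta> y z)"
  using gdist_triangle[of x y z] by linarith

lemma gdist_eq_0: "x \<in> V \<Longrightarrow> y \<in> V \<Longrightarrow> \<delta> x y = 0 \<longleftrightarrow> x = y"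
  using gdist_relpow[of x y] by auto

lemma geodesic_point:
  assumes "x \<in> V" "y \<in> V" "n \<le> \<delta> x y"
  obtains z where "z \<in> V" "\<delta> x z = n" "\<delta> z y = \<delta> x y - n"
proof -
  have "(x, y) \<in> edges G ^^ (n + (\<delta> x y - n))" using assms gdist_relpow by simp
  then obtain z where z: "(x, z) \<in> edges G ^^ n" "(z, y) \<in> edges G ^^ (\<delta> x y - n)"
    unfolding relpow_add by auto
  have "z \<in> V" using z assms relpow_verts by blast
  thus thesis using that[of z] gdist_le[OF z(1)] gdist_le[OF z(2)] gdist_triangle[of x z y] assms
    by auto
qed

lemma finite_sphere: "x \<in> V \<Longrightarrow> finite {y. (x, y) \<in> edges G ^^ n}"
proof (induction n)
  case (Suc n)
  have "{y. (x, y) \<in> edges G ^^ Suc n} = (\<Union>z\<in>{z. (x, z) \<in> edges G ^^ n}. {y. (z, y) \<in> edges G})"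
    by auto
  moreover have "finite {y. (z, y) \<in> edges G}" if "(x, z) \<in> edges G ^^ n" for z
    using that relpow_verts[OF that Suc.prems] graph
    by (auto simp: stable_like_graph_def connected_locally_finite_graph_def)
  ultimately show ?case using Suc by auto
qed auto

lemma gball_verts: "y \<in> gball G x r \<Longrightarrow> y \<in> V"
  by (simp add: gball_def)

lemma gball_subset_verts: "gball G x r \<subseteq> V"
  by (auto simp: gball_def)

lemma finite_gball: "x \<in> V \<Longrightarrow> finite (gball G x r)"
proof -
  assume x: "x \<in> V"
  have "gball G x r \<subseteq> (\<Union>n\<le>nat \<lfloor>r\<rfloor>. {y. (x, y) \<in> edges G ^^ n})"
  proof
    fix y assume "y \<in> gball G x r"
    hence "y \<in> V" "real (\<delta> x y) \<le> r" by (auto simp: gball_def)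
    moreover have "\<delta> x y \<le> nat \<lfloor>r\<rfloor>" using \<open>real (\<delta> x y) \<le> r\<close> by (simp add: le_nat_floor)
    ultimately show "y \<in> (\<Union>n\<le>nat \<lfloor>r\<rfloor>. {y. (x, y) \<in> edges G ^^ n})"
      using gdist_relpow[OF x] by auto
  qed
  thus ?thesis using finite_sphere[OF x] by (auto intro: finite_subset)
qed

lemma gball_mono: "x \<in> V \<Longrightarrow> y \<in> V \<Longrightarrow> real (\<delta> x y) + r \<le> s \<Longrightarrow> gball G y r \<subseteq> gball G x s"
  using gdist_triangle_real[of x y] by (fastforce simp: gball_def)

lemma gball_center: "x \<in> V \<Longrightarrow> 0 \<le> r \<Longrightarrow> x \<in> gball G x r"
  by (simp add: gball_def)

lemma mass_bounds: "x \<in> V \<Longrightarrow> 1 / c\<^sub>M \<le> m x" "x \<in> V \<Longrightarrow> m x \<le> c\<^sub>M"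
  using graph by (auto simp: stable_like_graph_def)

lemma mass_pos: "x \<in> V \<Longrightarrow> 0 < m x"
  using mass_bounds(1)[of x] cM_ge by (smt (verit) zero_less_divide_1_iff)

lemma measure_eq_sum: "finite A \<Longrightarrow> A \<subseteq> V \<Longrightarrow> measure (vmeas G) A = (\<Sum>x\<in>A. m x)"
proof (rule measure_eq_sum_singleton)
  assume A: "finite A" "A \<subseteq> V"
  fix x assume "x \<in> A"
  show "{x} \<in> sets (vmeas G)" using A \<open>x \<in> A\<close> graph by (auto simp: stable_like_graph_def)
  show "emeasure (vmeas G) {x} \<noteq> \<infinity>"
    using mass_pos[of x] A \<open>x \<in> A\<close> by (auto simp: measure_def)
qed

lemma volume_bounds:
  assumes "x \<in> V" "1 \<le> r" "ereal r < r\<^sub>G"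
  shows "r powr d / c\<^sub>G \<le> (\<Sum>y\<in>gball G x r. m y)" "(\<Sum>y\<in>gball G x r. m y) \<le> c\<^sub>G * r powr d"
  using graph assms measure_eq_sum[OF finite_gball[OF assms(1)] gball_subset_verts]
  by (auto simp: stable_like_graph_def)

lemma weight_props:
  assumes "x \<in> V" "y \<in> V"
  shows "weight G x x = 0" "weight G x y = weight G y x" "0 \<le> weight G x y"
  using graph assms by (auto simp: stable_like_graph_def)

lemma conductance_props:
  assumes "x \<in> V" "y \<in> V"
  shows "conductance G d \<alpha> x x = 0" "conductance G d \<alpha> x y = conductance G d \<alpha> y x"
    "0 \<le> conductance G d \<alpha> x y"
  using weight_props[OF assms] by (auto simp: conductance_def gdist_sym)

lemma J_nonneg: "x \<in> V \<Longrightarrow> y \<in> V \<Longrightarrow> 0 \<le> J x y"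
  using conductance_props(3) mass_pos by (simp add: less_imp_le)

lemma J_summable: "x \<in> V \<Longrightarrow> (\<lambda>y. J x y) summable_on V"
  using graph by (simp add: stable_like_graph_def)

lemma conductance_summable:
  assumes "x \<in> V" "A \<subseteq> V"
  shows "(\<lambda>y. conductance G d \<alpha> x y) summable_on A"
proof (rule summable_on_subset_banach[OF _ assms(2)])
  show "(\<lambda>y. conductance G d \<alpha> x y) summable_on V"
  proof (rule summable_on_comparison_test[OF summable_on_cmult_right[OF J_summable[OF assms(1)]]])
    fix y assume y: "y \<in> V"
    have "conductance G d \<alpha> x y * 1 \<le> conductance G d \<alpha> x y * (c\<^sub>M * m y)"
      using mass_bounds(1)[OF y] cM_ge conductance_props(3)[OF assms(1) y]
      by (intro mult_left_mono) (auto simp: field_simps)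
    thus "conductance G d \<alpha> x y \<le> c\<^sub>M * J x y" by (simp add: mult_ac)
  qed (use conductance_props(3) assms in auto)
qed

end

text \<open>
  The hypotheses at one fixed \<open>R\<close>, with \<open>\<sigma>\<close> for the smallest
  radius $R^\theta/2$ at which the weights are controlled.
\<close>

locale scale_window = stable_graph +
  fixes v\<^sub>0 :: 'a and \<sigma> R :: real
  assumes v0: "v\<^sub>0 \<in> V" and \<sigma>_ge: "1 \<le> \<sigma>"
    and R_less: "ereal (2 * R) < r\<^sub>G"
    and moment: "\<sigma> \<le> r \<Longrightarrow> r \<le> 2 * R \<Longrightarrow> x \<in> gball G v\<^sub>0 (6 * R) \<Longrightarrow>
      (\<Sum>y\<in>gball G x r. weight G x y / real (gdist G x y) powr (d + \<alpha> - 2)) \<le> C * r powr (2 - \<alpha>)"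
    and wball_mass: "\<sigma> \<le> r \<Longrightarrow> r \<le> 2 * R \<Longrightarrow> x \<in> gball G v\<^sub>0 (6 * R) \<Longrightarrow> z \<in> gball G v\<^sub>0 (6 * R) \<Longrightarrow>
      c\<^sub>0 * measure (vmeas G) (gball G x r) \<le> measure (vmeas G) (wball G z x r)"
    and inverse_weights: "\<sigma> \<le> r \<Longrightarrow> r \<le> 2 * R \<Longrightarrow> x \<in> gball G v\<^sub>0 (6 * R) \<Longrightarrow>
      (\<Sum>y\<in>wball G x x (cstar c\<^sub>G d * r). 1 / weight G x y) \<le> C * r powr d"
    and tail: "\<sigma> \<le> r \<Longrightarrow> x \<in> gball G v\<^sub>0 (6 * R) \<Longrightarrow>
      (\<Sum>\<^sub>\<infinity>y\<in>{y \<in> V. r < real (gdist G x y)}. weight G x y / real (gdist G x y) powr (d + \<alpha>))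
        \<le> C * r powr (- \<alpha>)"
begin

lemma radius_less: "r \<le> 2 * R \<Longrightarrow> ereal r < r\<^sub>G"
  using R_less by (meson ereal_less_eq(3) le_less_trans)

lemma tail_rate:
  assumes "\<sigma> \<le> r" "x \<in> gball G v\<^sub>0 (6 * R)"
  shows "(\<lambda>y. J x y) summable_on {y \<in> V. r < real (\<delta> x y)}"
    and "(\<Sum>\<^sub>\<infinity>y\<in>{y \<in> V. r < real (\<delta> x y)}. J x y) \<le> c\<^sub>M * C * r powr (- \<alpha>)"
proof -
  let ?F = "{y \<in> V. r < real (\<delta> x y)}"
  have x: "x \<in> V" using assms gball_verts by auto
  show sm: "(\<lambda>y. J x y) summable_on ?F"
    by (rule summable_on_subset_banach[OF J_summable[OF x]]) auto
  have "(\<Sum>\<^sub>\<infinity>y\<in>?F. J x y) \<le> (\<Sum>\<^sub>\<infinity>y\<in>?F. c\<^sub>M * conductance G d \<alpha> x y)"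
  proof (rule infsum_mono[OF sm])
    show "(\<lambda>y. c\<^sub>M * conductance G d \<alpha> x y) summable_on ?F"
      by (intro summable_on_cmult_right conductance_summable x) auto
    fix y assume "y \<in> ?F"
    thus "J x y \<le> c\<^sub>M * conductance G d \<alpha> x y"
      using mass_bounds(2)[of y] conductance_props(3)[OF x, of y]
      by (subst mult.commute) (auto intro: mult_right_mono)
  qed
  also have "\<dots> = c\<^sub>M * (\<Sum>\<^sub>\<infinity>y\<in>?F. conductance G d \<alpha> x y)" by (rule infsum_cmult_right')
  also have "\<dots> \<le> c\<^sub>M * (C * r powr (- \<alpha>))"
    using tail[OF assms] cM_ge by (intro mult_left_mono) (auto simp: conductance_def)
  finally show "(\<Sum>\<^sub>\<infinity>y\<in>?F. J x y) \<le> c\<^sub>M * C * r powr (- \<alpha>)" by simp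
qed

definition short_jumps :: "real \<Rightarrow> 'a \<Rightarrow> 'a \<Rightarrow> real" where
  "short_jumps \<rho> y z = (if real (\<delta> y z) \<le> \<rho> then conductance G d \<alpha> y z else 0)"

section \<open>The Nash inequality on a ball\<close>

lemma chain_on_ball:
  assumes "x \<in> V" shows "finite_symmetric_chain (gball G x r) m (short_jumps \<rho>)"
  by standard (use finite_gball[OF assms] mass_pos gball_verts conductance_props gdist_sym
     in \<open>auto simp: short_jumps_def\<close>)

text \<open>
  Walk from \<open>y\<close> along a geodesic towards the centre until a ball of radius $s/4$
  fits. Because of such inner balls the Nash inequality holds up to the boundary of the ball,
  where the auxiliary chain is reflected.
\<close>

lemma inner_ball:
  assumes x: "x \<in> V" and y: "y \<in> gball G x r" and s: "8 \<le> s" "s \<le> r"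
  obtains z where "z \<in> V" "gball G z (s / 4) \<subseteq> gball G x r" "gball G z (s / 4) \<subseteq> gball G y s"
proof (cases "real (\<delta> y x) \<le> s / 2")
  case True
  show ?thesis
  proof (rule that[OF x])
    show "gball G x (s / 4) \<subseteq> gball G x r" using x s by (intro gball_mono) auto
    show "gball G x (s / 4) \<subseteq> gball G y s" using x y s True gball_verts by (intro gball_mono) auto
  qed
next
  case False
  define n where "n = nat \<lceil>s / 4\<rceil>"
  have n: "s / 4 \<le> real n" "real n \<le> s / 2"
    using s by (auto simp: n_def) linarith
  have yV: "y \<in> V" using y gball_verts by auto
  have "n \<le> \<delta> y x" using n False by linarith
  then obtain z where z: "z \<in> V" "\<delta> y z = n" "\<delta> z x = \<delta> y x - n"
    using geodesic_point[OF yV x] by metis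
  have "real (\<delta> x z) + s / 4 \<le> real (\<delta> y x)"
    using z n \<open>n \<le> \<delta> y x\<close> by (simp add: gdist_sym[of x z])
  also have "\<dots> \<le> r" using y by (simp add: gball_def gdist_sym)
  finally show ?thesis using z n x yV by (intro that[of z] gball_mono) auto
qed

text \<open>
  Compare $f(y)$ with its average over those vertices of a small inner ball that
  \<open>y\<close> can jump to. They carry a fixed part of the mass of that ball, although the
  ball is centred elsewhere; this is why the density hypothesis is needed for two different
  vertices. The error of the comparison is bounded by Cauchy-Schwarz with the weights, using the
  bound on $\sum 1/w$.
\<close>

lemma pointwise_nash:
  assumes x: "x \<in> gball G v\<^sub>0 (2 * R)" and \<rho>: "2 * \<rho> \<le> R" and y: "y \<in> gball G x (2 * \<rho>)"
    and s: "cstar c\<^sub>G d * \<sigma> \<le> s" "s \<le> \<rho>"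
  shows "(f y)\<^sup>2 * (density_const * s powr d)\<^sup>2
    \<le> 2 * (\<Sum>z\<in>{z\<in>gball G x (2 * \<rho>). real (\<delta> y z) \<le> s}. m z * \<bar>f z\<bar>)\<^sup>2
      + 2 * (c\<^sub>M * s powr (d + \<alpha>) * (\<Sum>z\<in>gball G x (2 * \<rho>). short_jumps \<rho> y z * m z * (f y - f z)\<^sup>2))
          * (C * s powr d)"
proof -
  let ?D = "gball G x (2 * \<rho>)"
  have xV: "x \<in> V" and yV: "y \<in> V" using x y gball_verts by auto
  have fin: "finite ?D" using xV by (rule finite_gball)
  have "8 * 1 \<le> cstar c\<^sub>G d * \<sigma>" using cstar_ge \<sigma>_ge by (intro mult_mono) auto
  hence s8: "8 \<le> s" using s by linarith
  have sc: "\<sigma> \<le> s / cstar c\<^sub>G d" using s cstar_ge by (simp add: field_simps)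
  have s4: "\<sigma> \<le> s / 4"
  proof -
    have "4 * \<sigma> \<le> cstar c\<^sub>G d * \<sigma>" using cstar_ge \<sigma>_ge by (intro mult_right_mono) auto
    thus ?thesis using s by linarith
  qed
  have D6: "?D \<subseteq> gball G v\<^sub>0 (6 * R)"
    using x \<rho> s s8 v0 xV by (intro gball_mono) (auto simp: gball_def)
  obtain z where z: "z \<in> V" "gball G z (s / 4) \<subseteq> ?D" "gball G z (s / 4) \<subseteq> gball G y s"
    using inner_ball[OF xV y s8] s s8 by auto
  have z6: "z \<in> gball G v\<^sub>0 (6 * R)" using z(2) D6 gball_center[OF z(1), of "s / 4"] s8 by auto
  have y6: "y \<in> gball G v\<^sub>0 (6 * R)" using y D6 by auto
  define W where "W = wball G y z (s / 4)"
  have W: "W \<subseteq> ?D" "W \<subseteq> gball G y s" "W \<subseteq> V"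
    using z gball_subset_verts[of z "s / 4"] by (auto simp: W_def wball_def)
  have finW: "finite W" using W(1) fin finite_subset by auto
  have w_pos: "0 < weight G y u" if "u \<in> W" for u
    using that W(3) weight_props(2)[OF yV, of u] by (auto simp: W_def wball_def)
  have \<mu>W: "density_const * s powr d \<le> (\<Sum>u\<in>W. m u)"
  proof -
    have "ereal (s / 4) < r\<^sub>G" using s \<rho> s8
      by (intro radius_less) auto
    hence "(s / 4) powr d / c\<^sub>G \<le> measure (vmeas G) (gball G z (s / 4))"
      using volume_bounds(1)[OF z(1), of "s / 4"] measure_eq_sum[OF finite_gball[OF z(1)] gball_subset_verts] s8
      by simp
    hence "c\<^sub>0 * ((s / 4) powr d / c\<^sub>G) \<le> c\<^sub>0 * measure (vmeas G) (gball G z (s / 4))"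
      using c0_gt by (intro mult_left_mono) auto
    also have "\<dots> \<le> measure (vmeas G) W"
      unfolding W_def using s4 s \<rho> s8 z6 y6 by (intro wball_mass) auto
    also have "\<dots> = (\<Sum>u\<in>W. m u)" using finW W(3) by (rule measure_eq_sum)
    finally show ?thesis using s8 by (simp add: density_const_def powr_divide mult_ac)
  qed
  define S1 where "S1 = (\<Sum>u\<in>W. m u * \<bar>f u\<bar>)"
  define S2 where "S2 = (\<Sum>u\<in>W. m u * \<bar>f y - f u\<bar>)"
  have "\<bar>f y\<bar> * (density_const * s powr d) \<le> \<bar>f y\<bar> * (\<Sum>u\<in>W. m u)"
    using \<mu>W by (intro mult_left_mono) auto
  also have "\<dots> \<le> S1 + S2"
    unfolding S1_def S2_def sum_distrib_left sum.distrib[symmetric]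
  proof (rule sum_mono)
    fix u assume "u \<in> W"
    hence "m u * \<bar>f y\<bar> \<le> m u * (\<bar>f u\<bar> + \<bar>f y - f u\<bar>)"
      using W mass_pos by (intro mult_left_mono) (auto simp: less_imp_le)
    thus "\<bar>f y\<bar> * m u \<le> m u * \<bar>f u\<bar> + m u * \<bar>f y - f u\<bar>" by (simp add: algebra_simps)
  qed
  finally have "(\<bar>f y\<bar> * (density_const * s powr d))\<^sup>2 \<le> (S1 + S2)\<^sup>2"
    using density_const_pos by (intro power_mono) auto
  also have "\<dots> \<le> 2 * S1\<^sup>2 + 2 * S2\<^sup>2" using sum_squares_bound[of S1 S2] by (simp add: power2_sum)
  finally have main: "(f y)\<^sup>2 * (density_const * s powr d)\<^sup>2 \<le> 2 * S1\<^sup>2 + 2 * S2\<^sup>2"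
    by (simp add: power_mult_distrib)
  have S1: "S1\<^sup>2 \<le> (\<Sum>z\<in>{z\<in>?D. real (\<delta> y z) \<le> s}. m z * \<bar>f z\<bar>)\<^sup>2"
  proof (rule power_mono)
    show "S1 \<le> (\<Sum>z\<in>{z\<in>?D. real (\<delta> y z) \<le> s}. m z * \<bar>f z\<bar>)"
      unfolding S1_def
    proof (rule sum_mono2)
      show "W \<subseteq> {z\<in>?D. real (\<delta> y z) \<le> s}" using W by (auto simp: gball_def)
    qed (use fin gball_verts in \<open>auto intro!: mult_nonneg_nonneg less_imp_le[OF mass_pos]\<close>)
    show "0 \<le> S1" unfolding S1_def using W mass_pos by (intro sum_nonneg) (auto simp: less_imp_le)
  qed
  have "S2\<^sup>2 \<le> (\<Sum>u\<in>W. weight G y u * (m u)\<^sup>2 * (f y - f u)\<^sup>2) * (\<Sum>u\<in>W. 1 / weight G y u)"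
    using weighted_Cauchy_Schwarz[of W "\<lambda>u. weight G y u" "\<lambda>u. m u * \<bar>f y - f u\<bar>", OF w_pos]
    by (simp add: S2_def power_mult_distrib mult.assoc)
  also have "\<dots> \<le> (c\<^sub>M * s powr (d + \<alpha>) * (\<Sum>z\<in>?D. short_jumps \<rho> y z * m z * (f y - f z)\<^sup>2)) * (C * s powr d)"
  proof (rule mult_mono)
    have "(\<Sum>u\<in>W. 1 / weight G y u) \<le> (\<Sum>u\<in>wball G y y (cstar c\<^sub>G d * (s / cstar c\<^sub>G d)). 1 / weight G y u)"
    proof (rule sum_mono2)
      show "finite (wball G y y (cstar c\<^sub>G d * (s / cstar c\<^sub>G d)))"
        using finite_gball[OF yV] by (auto simp: wball_def)
      show "W \<subseteq> wball G y y (cstar c\<^sub>G d * (s / cstar c\<^sub>G d))"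
        using W(2) cstar_ge by (auto simp: W_def wball_def)
    qed (use weight_props(3)[OF yV] gball_verts in \<open>auto simp: wball_def\<close>)
    also have "\<dots> \<le> C * (s / cstar c\<^sub>G d) powr d"
    proof (rule inverse_weights[OF sc _ y6])
      have "s / cstar c\<^sub>G d \<le> s / 1" using cstar_ge s8 by (intro divide_left_mono) auto
      thus "s / cstar c\<^sub>G d \<le> 2 * R" using s \<rho> s8 by simp
    qed
    also have "\<dots> \<le> C * s powr d"
    proof -
      have "s / cstar c\<^sub>G d \<le> s / 1" using cstar_ge s8 by (intro divide_left_mono) auto
      thus ?thesis using C_pos cstar_ge s8 d_pos by (intro mult_left_mono powr_mono2) auto
    qed
    finally show "(\<Sum>u\<in>W. 1 / weight G y u) \<le> C * s powr d" .
    have "weight G y u * (m u)\<^sup>2 * (f y - f u)\<^sup>2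
        \<le> c\<^sub>M * s powr (d + \<alpha>) * (short_jumps \<rho> y u * m u * (f y - f u)\<^sup>2)" if u: "u \<in> W" for u
    proof -
      have uV: "u \<in> V" and us: "real (\<delta> y u) \<le> s" using u W by (auto simp: gball_def)
      have "y \<noteq> u" using w_pos[OF u] weight_props(1)[OF uV uV] by auto
      hence pos: "0 < \<delta> y u" using gdist_eq_0[OF yV uV] by auto
      have "weight G y u = short_jumps \<rho> y u * real (\<delta> y u) powr (d + \<alpha>)"
        using pos us s by (simp add: short_jumps_def conductance_def)
      also have "\<dots> \<le> short_jumps \<rho> y u * s powr (d + \<alpha>)"
        using pos us d_pos \<alpha>_pos conductance_props(3)[OF yV uV]
        by (intro mult_left_mono powr_mono2) (auto simp: short_jumps_def)
      finally have 1: "weight G y u \<le> short_jumps \<rho> y u * s powr (d + \<alpha>)" .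
      have "weight G y u * m u * (m u * (f y - f u)\<^sup>2)
          \<le> (short_jumps \<rho> y u * s powr (d + \<alpha>)) * c\<^sub>M * (m u * (f y - f u)\<^sup>2)"
        using 1 mass_bounds(2)[OF uV] mass_pos[OF uV] w_pos[OF u] by (intro mult_right_mono mult_mono) auto
      thus ?thesis by (simp add: power2_eq_square mult_ac)
    qed
    hence "(\<Sum>u\<in>W. weight G y u * (m u)\<^sup>2 * (f y - f u)\<^sup>2)
        \<le> (\<Sum>u\<in>W. c\<^sub>M * s powr (d + \<alpha>) * (short_jumps \<rho> y u * m u * (f y - f u)\<^sup>2))"
      by (rule sum_mono)
    also have "\<dots> \<le> (\<Sum>u\<in>?D. c\<^sub>M * s powr (d + \<alpha>) * (short_jumps \<rho> y u * m u * (f y - f u)\<^sup>2))"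
      using W fin cM_ge conductance_props(3)[OF yV] mass_pos gball_verts
      by (intro sum_mono2) (auto simp: short_jumps_def intro!: mult_nonneg_nonneg less_imp_le[OF mass_pos])
    finally show "(\<Sum>u\<in>W. weight G y u * (m u)\<^sup>2 * (f y - f u)\<^sup>2)
      \<le> c\<^sub>M * s powr (d + \<alpha>) * (\<Sum>z\<in>?D. short_jumps \<rho> y z * m z * (f y - f z)\<^sup>2)"
      by (simp add: sum_distrib_left)
  next
    show "0 \<le> c\<^sub>M * s powr (d + \<alpha>) * (\<Sum>z\<in>?D. short_jumps \<rho> y z * m z * (f y - f z)\<^sup>2)"
      using cM_ge conductance_props(3)[OF yV] gball_verts
      by (auto simp: short_jumps_def intro!: mult_nonneg_nonneg sum_nonneg less_imp_le[OF mass_pos])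
    show "0 \<le> (\<Sum>u\<in>W. 1 / weight G y u)" using w_pos by (auto intro!: sum_nonneg simp: less_imp_le)
  qed
  finally show ?thesis using main S1 by linarith
qed

end

context scale_window
begin

text \<open>
  Sum \<open>pointwise_nash\<close> over the ball. The averages contribute at most $\|f\|_1$
  times their sum, and exchanging the order of summation bounds that by the volume of a ball of
  radius $s$.
\<close>

lemma ball_nash:
  assumes x: "x \<in> gball G v\<^sub>0 (2 * R)" and \<rho>: "2 * \<rho> \<le> R"
    and s: "cstar c\<^sub>G d * \<sigma> \<le> s" "s \<le> \<rho>"
  shows "(\<Sum>y\<in>gball G x (2 * \<rho>). (f y)\<^sup>2 * m y)
    \<le> chain_const * (s powr (- d) * (\<Sum>y\<in>gball G x (2 * \<rho>). \<bar>f y\<bar> * m y)\<^sup>2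
        + s powr \<alpha> * finite_symmetric_chain.energy (gball G x (2 * \<rho>)) m (short_jumps \<rho>) f f)"
proof -
  let ?D = "gball G x (2 * \<rho>)"
  define b where "b = density_const"
  define N where "N = (\<lambda>y. \<Sum>z\<in>{z\<in>?D. real (\<delta> y z) \<le> s}. m z * \<bar>f z\<bar>)"
  define \<Gamma> where "\<Gamma> = (\<lambda>y. \<Sum>z\<in>?D. short_jumps \<rho> y z * m z * (f y - f z)\<^sup>2)"
  define L1 where "L1 = (\<Sum>y\<in>?D. \<bar>f y\<bar> * m y)"
  have xV: "x \<in> V" using x gball_verts by auto
  have fin: "finite ?D" using xV by (rule finite_gball)
  interpret finite_symmetric_chain ?D m "short_jumps \<rho>" by (rule chain_on_ball[OF xV])
  have m_nn: "0 \<le> m y" if "y \<in> ?D" for y using that gball_verts mass_pos by (auto simp: less_imp_le)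
  have "8 * 1 \<le> cstar c\<^sub>G d * \<sigma>" using cstar_ge \<sigma>_ge by (intro mult_mono) auto
  hence s8: "8 \<le> s" using s by linarith
  have N_nn: "0 \<le> N y" for y unfolding N_def using m_nn by (auto intro!: sum_nonneg)
  have N_le: "N y \<le> L1" for y
    unfolding N_def L1_def using fin m_nn
    by (subst mult.commute, intro sum_mono2) auto
  have swap: "(\<Sum>y\<in>?D. m y * N y) \<le> c\<^sub>G * s powr d * L1"
  proof -
    have "(\<Sum>y\<in>?D. m y * N y) = (\<Sum>y\<in>?D. \<Sum>z\<in>?D. if real (\<delta> y z) \<le> s then m y * (m z * \<bar>f z\<bar>) else 0)"
      unfolding N_def sum_distrib_left using fin
      by (intro sum.cong[OF refl, of ?D]) (simp only: sum.inter_filter)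
    also have "\<dots> = (\<Sum>z\<in>?D. \<Sum>y\<in>?D. if real (\<delta> y z) \<le> s then m y * (m z * \<bar>f z\<bar>) else 0)"
      by (rule sum.swap)
    also have "\<dots> = (\<Sum>z\<in>?D. (\<Sum>y\<in>{y\<in>?D. real (\<delta> z y) \<le> s}. m y) * (m z * \<bar>f z\<bar>))"
      unfolding sum_distrib_right using fin
      by (intro sum.cong[OF refl, of ?D]) (simp add: sum.inter_filter gdist_sym)
    also have "\<dots> \<le> (\<Sum>z\<in>?D. (c\<^sub>G * s powr d) * (m z * \<bar>f z\<bar>))"
    proof (intro sum_mono mult_right_mono)
      fix z assume z: "z \<in> ?D"
      hence zV: "z \<in> V" using gball_verts by auto
      have "(\<Sum>y\<in>{y\<in>?D. real (\<delta> z y) \<le> s}. m y) \<le> (\<Sum>y\<in>gball G z s. m y)"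
        using finite_gball[OF zV] mass_pos
        by (intro sum_mono2) (auto simp: gball_def less_imp_le)
      also have "\<dots> \<le> c\<^sub>G * s powr d"
        using volume_bounds(2)[OF zV, of s] radius_less[of s] s \<rho> s8 by auto
      finally show "(\<Sum>y\<in>{y\<in>?D. real (\<delta> z y) \<le> s}. m y) \<le> c\<^sub>G * s powr d" .
    qed (use m_nn in auto)
    also have "\<dots> = c\<^sub>G * s powr d * L1" by (simp add: L1_def sum_distrib_left mult_ac)
    finally show ?thesis .
  qed
  have E: "(\<Sum>y\<in>?D. m y * \<Gamma> y) = 2 * energy f f"
    unfolding \<Gamma>_def energy_def sum_distrib_left by (simp add: power2_eq_square mult_ac)
  have "(\<Sum>y\<in>?D. m y * ((f y)\<^sup>2 * (b * s powr d)\<^sup>2))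
      \<le> (\<Sum>y\<in>?D. m y * (2 * (N y)\<^sup>2 + 2 * (c\<^sub>M * s powr (d + \<alpha>) * \<Gamma> y) * (C * s powr d)))"
    unfolding N_def \<Gamma>_def b_def using m_nn pointwise_nash[OF x \<rho> _ s] by (intro sum_mono mult_left_mono) auto
  also have "\<dots> = 2 * (\<Sum>y\<in>?D. m y * (N y)\<^sup>2) + 2 * c\<^sub>M * s powr (d + \<alpha>) * C * s powr d * (\<Sum>y\<in>?D. m y * \<Gamma> y)"
    by (simp add: sum.distrib sum_distrib_left algebra_simps)
  also have "(\<Sum>y\<in>?D. m y * (N y)\<^sup>2) \<le> (\<Sum>y\<in>?D. L1 * (m y * N y))"
  proof (rule sum_mono)
    fix y assume y: "y \<in> ?D"
    have "(N y)\<^sup>2 \<le> L1 * N y" unfolding power2_eq_square using N_nn N_le by (intro mult_right_mono) auto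
    hence "m y * (N y)\<^sup>2 \<le> m y * (L1 * N y)" using m_nn[OF y] by (intro mult_left_mono)
    thus "m y * (N y)\<^sup>2 \<le> L1 * (m y * N y)" by (simp add: mult_ac)
  qed
  also have "\<dots> \<le> L1 * (c\<^sub>G * s powr d * L1)"
    unfolding sum_distrib_left[symmetric] using swap N_nn[of x] N_le[of x] by (intro mult_left_mono) auto
  finally have 1: "(b * s powr d)\<^sup>2 * (\<Sum>y\<in>?D. (f y)\<^sup>2 * m y)
      \<le> 2 * c\<^sub>G * s powr d * L1\<^sup>2 + 4 * c\<^sub>M * C * (s powr d)\<^sup>2 * s powr \<alpha> * energy f f"
    unfolding E by (simp add: sum_distrib_left power2_eq_square powr_add mult_ac)
  have b: "0 < b" using density_const_pos by (simp add: b_def)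
  have sd: "0 < s powr d" using s8 by simp
  have "(\<Sum>y\<in>?D. (f y)\<^sup>2 * m y)
      \<le> (2 * c\<^sub>G * s powr d * L1\<^sup>2 + 4 * c\<^sub>M * C * (s powr d)\<^sup>2 * s powr \<alpha> * energy f f) / (b * s powr d)\<^sup>2"
    using 1 b sd by (simp add: pos_le_divide_eq mult.commute)
  also have "\<dots> = 2 * c\<^sub>G / b\<^sup>2 * (s powr (- d) * L1\<^sup>2) + 4 * c\<^sub>M * C / b\<^sup>2 * (s powr \<alpha> * energy f f)"
    using b sd by (simp add: powr_minus field_simps power2_eq_square)
  also have "\<dots> \<le> chain_const * (s powr (- d) * L1\<^sup>2) + chain_const * (s powr \<alpha> * energy f f)"
    using chain_const_ge energy_nonneg[of f] by (intro add_mono mult_right_mono) (auto simp: b_def)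
  finally show ?thesis by (simp add: L1_def distrib_left)
qed

lemma second_moment:
  assumes y: "y \<in> gball G v\<^sub>0 (6 * R)" and \<rho>: "\<sigma> \<le> \<rho>" "\<rho> \<le> 2 * R" and F: "finite F" "F \<subseteq> V"
    and lip: "\<And>z. z \<in> F \<Longrightarrow> \<bar>\<zeta> y - \<zeta> z\<bar> \<le> real (\<delta> y z)"
  shows "(\<Sum>z\<in>F. short_jumps \<rho> y z * m z * (\<zeta> y - \<zeta> z)\<^sup>2) \<le> c\<^sub>M * C * \<rho> powr (2 - \<alpha>)"
proof -
  have yV: "y \<in> V" using y gball_verts by auto
  have nn: "0 \<le> weight G y z / real (\<delta> y z) powr (d + \<alpha> - 2)" if "z \<in> V" for z
    using weight_props(3)[OF yV that] by simp
  have "(\<Sum>z\<in>F. short_jumps \<rho> y z * m z * (\<zeta> y - \<zeta> z)\<^sup>2)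
      \<le> (\<Sum>z\<in>F. if z \<in> gball G y \<rho> then c\<^sub>M * (weight G y z / real (\<delta> y z) powr (d + \<alpha> - 2)) else 0)"
  proof (rule sum_mono)
    fix z assume z: "z \<in> F"
    hence zV: "z \<in> V" using F by auto
    show "short_jumps \<rho> y z * m z * (\<zeta> y - \<zeta> z)\<^sup>2
        \<le> (if z \<in> gball G y \<rho> then c\<^sub>M * (weight G y z / real (\<delta> y z) powr (d + \<alpha> - 2)) else 0)"
    proof (cases "real (\<delta> y z) \<le> \<rho>")
      case True
      have "(\<zeta> y - \<zeta> z)\<^sup>2 \<le> (real (\<delta> y z))\<^sup>2"
        using power_mono[OF lip[OF z], of 2] by simp
      hence "conductance G d \<alpha> y z * m z * (\<zeta> y - \<zeta> z)\<^sup>2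
          \<le> conductance G d \<alpha> y z * c\<^sub>M * (real (\<delta> y z))\<^sup>2"
        using conductance_props(3)[OF yV zV] mass_pos[OF zV] mass_bounds(2)[OF zV]
        by (intro mult_mono mult_left_mono) (auto simp: less_imp_le)
      also have "conductance G d \<alpha> y z * (real (\<delta> y z))\<^sup>2 = weight G y z / real (\<delta> y z) powr (d + \<alpha> - 2)"
      proof (cases "y = z")
        case True thus ?thesis using weight_props(1)[OF yV yV] by (simp add: conductance_def)
      next
        case False
        hence "0 < real (\<delta> y z)" using gdist_eq_0[OF yV zV] by simp
        thus ?thesis by (simp add: conductance_def powr_diff powr_numeral)
      qed
      hence "conductance G d \<alpha> y z * c\<^sub>M * (real (\<delta> y z))\<^sup>2
          = c\<^sub>M * (weight G y z / real (\<delta> y z) powr (d + \<alpha> - 2))" by (simp add: mult_ac)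
      finally show ?thesis using True zV by (simp add: short_jumps_def gball_def)
    next
      case False
      have "0 \<le> c\<^sub>M * (weight G y z / real (\<delta> y z) powr (d + \<alpha> - 2))"
        using cM_ge by (intro mult_nonneg_nonneg nn[OF zV]) auto
      thus ?thesis using False by (simp only: short_jumps_def) simp
    qed
  qed
  also have "\<dots> = (\<Sum>z\<in>{z\<in>F. z \<in> gball G y \<rho>}. c\<^sub>M * (weight G y z / real (\<delta> y z) powr (d + \<alpha> - 2)))"
    by (rule sum.inter_filter[OF F(1), symmetric])
  also have "\<dots> \<le> (\<Sum>z\<in>gball G y \<rho>. c\<^sub>M * (weight G y z / real (\<delta> y z) powr (d + \<alpha> - 2)))"
    using finite_gball[OF yV] nn cM_ge gball_verts
    by (intro sum_mono2) (auto intro!: mult_nonneg_nonneg simp del: times_divide_eq_right)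
  also have "\<dots> = c\<^sub>M * (\<Sum>z\<in>gball G y \<rho>. weight G y z / real (\<delta> y z) powr (d + \<alpha> - 2))"
    by (simp only: sum_distrib_left)
  also have "\<dots> \<le> c\<^sub>M * (C * \<rho> powr (2 - \<alpha>))"
    using moment[OF \<rho> y] cM_ge by (intro mult_left_mono) auto
  finally show ?thesis by simp
qed

section \<open>A barrier from the displacement bound\<close>

lemma nash_chain_on_ball:
  assumes x: "x \<in> gball G v\<^sub>0 (2 * R)" and \<rho>: "2 * \<rho> \<le> R" "1 \<le> \<rho>"
    and bottom: "cstar c\<^sub>G d * \<sigma> * ln (chain_const\<^sup>2 * \<rho> powr d) powr (5 / \<alpha>) \<le> \<rho>"
  shows "nash_chain (gball G x (2 * \<rho>)) m (short_jumps \<rho>) d \<alpha> chain_const \<rho> (cstar c\<^sub>G d * \<sigma>)"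
proof -
  have xV: "x \<in> V" using x gball_verts by auto
  interpret finite_symmetric_chain "gball G x (2 * \<rho>)" m "short_jumps \<rho>" by (rule chain_on_ball[OF xV])
  have "ereal (2 * \<rho>) < r\<^sub>G" using \<rho> by (intro radius_less) auto
  hence vol: "(\<Sum>y\<in>gball G x (2 * \<rho>). m y) \<le> c\<^sub>G * (2 * \<rho>) powr d"
    using volume_bounds(2)[OF xV, of "2 * \<rho>"] \<rho> by auto
  show ?thesis
  proof
    show "(\<Sum>y\<in>gball G x (2 * \<rho>). m y) \<le> chain_const * \<rho> powr d"
    proof -
      have "c\<^sub>G * (2 * \<rho>) powr d = c\<^sub>G * 2 powr d * \<rho> powr d" using \<rho> by (simp add: powr_mult)
      also have "\<dots> \<le> chain_const * \<rho> powr d" using chain_const_ge(4) by (intro mult_right_mono) auto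
      finally show ?thesis using vol by linarith
    qed
  qed (use d_pos \<alpha>_pos chain_const_ge(1) \<rho> ball_nash[OF x \<rho>(1)] bottom cstar_ge \<sigma>_ge in auto)
qed

text \<open>
  The chain starts at \<open>z\<close>. The displacement bound needs a strictly positive initial
  density, so the point mass is mixed with a small multiple $\epsilon$ of the uniform density
  and its share is recovered by reversibility.
\<close>

lemma mean_displacement:
  assumes x: "x \<in> gball G v\<^sub>0 (2 * R)" and \<rho>: "2 * \<rho> \<le> R" "\<sigma> \<le> \<rho>"
    and bottom: "cstar c\<^sub>G d * \<sigma> * ln (chain_const\<^sup>2 * \<rho> powr d) powr (5 / \<alpha>) \<le> \<rho>"
    and z: "z \<in> gball G x (2 * \<rho>)" and t: "0 \<le> t" "t \<le> time_const * \<rho> powr \<alpha>"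
  shows "finite_symmetric_chain.heat (gball G x (2 * \<rho>)) m (short_jumps \<rho>) t (\<lambda>y. real (\<delta> z y)) z \<le> \<rho> / 16"
proof (cases "t = 0")
  case True
  have xV: "x \<in> V" using x gball_verts by auto
  interpret finite_symmetric_chain "gball G x (2 * \<rho>)" m "short_jumps \<rho>" by (rule chain_on_ball[OF xV])
  show ?thesis using True \<rho> \<sigma>_ge by simp
next
  case False
  let ?D = "gball G x (2 * \<rho>)"
  have xV: "x \<in> V" and zV: "z \<in> V" using x z gball_verts by auto
  have \<rho>1: "1 \<le> \<rho>" using \<rho> \<sigma>_ge by simp
  interpret nash_chain ?D m "short_jumps \<rho>" d \<alpha> chain_const \<rho> "cstar c\<^sub>G d * \<sigma>"
    by (rule nash_chain_on_ball[OF x \<rho>(1) \<rho>1 bottom])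
  define V where "V = (\<Sum>y\<in>?D. m y)"
  have m_nn: "0 \<le> m y" if "y \<in> ?D" for y using that gball_verts mass_pos by (auto simp: less_imp_le)
  have V_ge: "m z \<le> V" unfolding V_def using z finite_D m_nn by (intro member_le_sum) auto
  have mz: "0 < m z" "1 / c\<^sub>M \<le> m z" using mass_pos[OF zV] mass_bounds(1)[OF zV] by auto
  (* The mixture adds at most 4 \<rho> \<epsilon> = \<rho> / 32 to the initial displacement.
     The flow adds \<rho> / 64, and 128 / 127 * (\<rho> / 32 + \<rho> / 64) is below \<rho> / 16. *)
  define \<epsilon> :: real where "\<epsilon> = 1 / 128"
  define f where "f = (\<lambda>y. (1 - \<epsilon>) * (if y = z then 1 / m z else 0) + \<epsilon> / V)"
  have f_mass: "(\<Sum>y\<in>?D. f y * m y) = 1"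
  proof -
    have "(\<Sum>y\<in>?D. f y * m y) = (1 - \<epsilon>) * (\<Sum>y\<in>?D. if y = z then 1 else 0) + \<epsilon> / V * V"
      unfolding f_def V_def sum_distrib_left distrib_right sum.distrib[symmetric] using mz
      by (intro sum.cong) auto
    also have "\<dots> = 1" using z finite_D mz V_ge by simp
    finally show ?thesis .
  qed
  have f_ge: "\<epsilon> / V \<le> f y" if "y \<in> ?D" for y using mz by (simp add: f_def \<epsilon>_def)
  have f_le: "f y \<le> chain_const" if "y \<in> ?D" for y
  proof -
    have "1 / m z \<le> c\<^sub>M" using mz cM_ge by (simp add: field_simps)
    moreover have "1 / V \<le> 1 / m z" using V_ge mz by (intro divide_left_mono) auto
    ultimately have "f y \<le> (1 - \<epsilon>) * c\<^sub>M + \<epsilon> * c\<^sub>M"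
      unfolding f_def using mz cM_ge by (intro add_mono) (auto simp: \<epsilon>_def)
    thus ?thesis using chain_const_ge(6) by (simp add: algebra_simps)
  qed
  let ?\<zeta> = "\<lambda>y. real (\<delta> z y)"
  have D6: "?D \<subseteq> gball G v\<^sub>0 (6 * R)"
    using x \<rho> \<rho>1 v0 xV by (intro gball_mono) (auto simp: gball_def)
  have jump: "(\<Sum>y\<in>?D. short_jumps \<rho> u y * m y * (?\<zeta> u - ?\<zeta> y)\<^sup>2) \<le> chain_const * \<rho> powr (2 - \<alpha>)"
    if u: "u \<in> ?D" for u
  proof -
    have "(\<Sum>y\<in>?D. short_jumps \<rho> u y * m y * (?\<zeta> u - ?\<zeta> y)\<^sup>2) \<le> c\<^sub>M * C * \<rho> powr (2 - \<alpha>)"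
    proof (rule second_moment)
      fix y assume y: "y \<in> ?D"
      have uV: "u \<in> verts G" and yV: "y \<in> verts G" using u y gball_verts by auto
      show "\<bar>?\<zeta> u - ?\<zeta> y\<bar> \<le> real (\<delta> u y)"
        using gdist_triangle_real[OF zV uV yV] gdist_triangle_real[OF zV yV uV] gdist_sym[of u y] by simp
    qed (use u D6 \<rho> \<rho>1 finite_D gball_subset_verts in auto)
    also have "\<dots> \<le> chain_const * \<rho> powr (2 - \<alpha>)" using chain_const_ge(5) by (intro mult_right_mono) auto
    finally show ?thesis .
  qed
  have t_le: "t \<le> \<rho> powr \<alpha>" using t time_const_bounds mult_right_mono[OF time_const_bounds(2), of "\<rho> powr \<alpha>"] by simp
  have init: "(\<Sum>y\<in>?D. ?\<zeta> y * f y * m y) \<le> \<rho> / 32"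
  proof -
    have "(\<Sum>y\<in>?D. ?\<zeta> y * f y * m y) \<le> (\<Sum>y\<in>?D. (4 * \<rho>) * (\<epsilon> / V * m y))"
    proof (rule sum_mono)
      fix y assume y: "y \<in> ?D"
      hence yV: "y \<in> verts G" using gball_verts by auto
      show "?\<zeta> y * f y * m y \<le> (4 * \<rho>) * (\<epsilon> / V * m y)"
      proof (cases "y = z")
        case False
        have "?\<zeta> y \<le> 4 * \<rho>"
          using gdist_triangle_real[OF zV xV yV] y z by (auto simp: gball_def gdist_sym[of z x])
        hence "?\<zeta> y * (\<epsilon> / V * m y) \<le> 4 * \<rho> * (\<epsilon> / V * m y)"
          using m_nn[OF y] mz V_ge by (intro mult_right_mono) (auto simp: \<epsilon>_def)
        thus ?thesis using False by (simp add: f_def mult_ac)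
      qed (use m_nn[OF y] mz V_ge \<rho>1 in \<open>auto simp: \<epsilon>_def\<close>)
    qed
    also have "\<dots> = 4 * \<rho> * \<epsilon>"
      unfolding sum_distrib_left[symmetric] V_def[symmetric] using mz V_ge by simp
    finally show ?thesis by (simp add: \<epsilon>_def)
  qed
  have "(\<Sum>y\<in>?D. ?\<zeta> y * heat t f y * m y) \<le> (\<Sum>y\<in>?D. ?\<zeta> y * f y * m y)
      + diffusion_const * \<rho> * sqrt (sqrt (t / \<rho> powr \<alpha>))"
    unfolding diffusion_const_def
    by (rule moment_growth[of "\<epsilon> / V" f ?\<zeta> t])
       (use mz V_ge f_ge f_le f_mass jump t t_le False in \<open>auto simp: \<epsilon>_def\<close>)
  moreover have "diffusion_const * \<rho> * sqrt (sqrt (t / \<rho> powr \<alpha>)) \<le> diffusion_const * \<rho> * sqrt (sqrt time_const)"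
    using t \<rho>1 diffusion_const_ge by (intro mult_left_mono real_sqrt_le_mono) (auto simp: field_simps)
  moreover have "sqrt (sqrt time_const) = 1 / (64 * diffusion_const)"
  proof -
    have "time_const = ((1 / (64 * diffusion_const))\<^sup>2)\<^sup>2" by (simp add: time_const_def)
    thus ?thesis using diffusion_const_ge by (simp only: real_sqrt_abs) simp
  qed
  hence "diffusion_const * \<rho> * sqrt (sqrt time_const) = \<rho> / 64"
    using diffusion_const_ge by simp
  ultimately have upper: "(\<Sum>y\<in>?D. ?\<zeta> y * heat t f y * m y) \<le> \<rho> / 32 + \<rho> / 64"
    using init by linarith
  have heat_nn: "0 \<le> heat t ?\<zeta> y" if "y \<in> ?D" for y
    using heat_mono[of "\<lambda>_. 0" ?\<zeta> y t] that t by (simp add: heat_const)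
  have "(1 - \<epsilon>) * heat t ?\<zeta> z = (\<Sum>y\<in>?D. if y = z then (1 - \<epsilon>) * heat t ?\<zeta> z else 0)"
    using z finite_D by simp
  also have "\<dots> \<le> (\<Sum>y\<in>?D. heat t ?\<zeta> y * f y * m y)"
  proof (rule sum_mono)
    fix y assume y: "y \<in> ?D"
    have "0 \<le> heat t ?\<zeta> z * (\<epsilon> / V) * m z" "0 \<le> heat t ?\<zeta> y * (\<epsilon> / V) * m y"
      using heat_nn[OF z] heat_nn[OF y] mz V_ge m_nn[OF y] by (auto simp: \<epsilon>_def)
    thus "(if y = z then (1 - \<epsilon>) * heat t ?\<zeta> z else 0) \<le> heat t ?\<zeta> y * f y * m y"
      using mz by (auto simp: f_def algebra_simps)
  qed
  also have "\<dots> = (\<Sum>y\<in>?D. ?\<zeta> y * heat t f y * m y)" by (rule heat_sym)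
  finally have "(1 - \<epsilon>) * heat t ?\<zeta> z \<le> \<rho> / 32 + \<rho> / 64" using upper by simp
  thus ?thesis using \<rho>1 by (simp add: \<epsilon>_def)
qed

text \<open>
  The jumps that the auxiliary chain omits have total rate of order $\rho^{-\alpha}$.
\<close>

lemma jump_rate_split:
  assumes y: "y \<in> gball G v\<^sub>0 (6 * R)" and \<rho>: "\<sigma> \<le> \<rho>"
  shows "jump_rate G d \<alpha> y \<le> (\<Sum>z\<in>gball G y \<rho>. J y z) + c\<^sub>M * C * \<rho> powr (- \<alpha>)"
proof -
  have yV: "y \<in> V" using y gball_verts by auto
  have "V = gball G y \<rho> \<union> {z \<in> V. \<rho> < real (\<delta> y z)}" by (auto simp: gball_def)
  hence "jump_rate G d \<alpha> y = (\<Sum>\<^sub>\<infinity>z\<in>gball G y \<rho> \<union> {z \<in> V. \<rho> < real (\<delta> y z)}. J y z)"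
    by (simp add: jump_rate_def)
  also have "\<dots> = (\<Sum>\<^sub>\<infinity>z\<in>gball G y \<rho>. J y z) + (\<Sum>\<^sub>\<infinity>z\<in>{z \<in> V. \<rho> < real (\<delta> y z)}. J y z)"
    using tail_rate(1)[OF \<rho> y] finite_gball[OF yV]
    by (intro infsum_Un_disjoint) (auto simp: gball_def)
  finally show ?thesis using tail_rate(2)[OF \<rho> y] finite_gball[OF yV] by simp
qed

text \<open>
  A subsolution that is positive only inside the ball. Take the heat flow of a bump of radius
  $\rho/4$. Outside $B(x,\rho)$ mass has to travel $3\rho/4$ to reach the bump, so the flow is
  below $1/8$ there, while near the centre it stays above $1/2$. Subtract $1/8$, and pay for the
  omitted long jumps with an exponential factor in time. The positive part on the right side is
  what the comparison uses; \<open>h\<close> itself stays differentiable.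
\<close>

lemma staying_barrier:
  assumes x: "x \<in> gball G v\<^sub>0 (2 * R)" and \<rho>: "2 * \<rho> \<le> R" "\<sigma> \<le> \<rho>"
    and bottom: "cstar c\<^sub>G d * \<sigma> * ln (chain_const\<^sup>2 * \<rho> powr d) powr (5 / \<alpha>) \<le> \<rho>"
  obtains h where
    "\<And>y \<tau>. y \<in> gball G x \<rho> \<Longrightarrow> 0 \<le> \<tau> \<Longrightarrow> \<tau> \<le> time_const * \<rho> powr \<alpha> \<Longrightarrow>
      \<exists>h'. ((\<lambda>\<tau>. h \<tau> y) has_real_derivative h') (at \<tau>) \<and>
        (0 < h \<tau> y \<longrightarrow> h' + jump_rate G d \<alpha> y * h \<tau> y \<le> (\<Sum>z\<in>gball G x \<rho>. J y z * max 0 (h \<tau> z)))"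
    "\<And>y \<tau>. y \<in> gball G x \<rho> \<Longrightarrow> 0 \<le> \<tau> \<Longrightarrow> h \<tau> y \<le> 1"
    "\<And>y \<tau>. y \<in> gball G x (\<rho> / 16) \<Longrightarrow> 0 \<le> \<tau> \<Longrightarrow> \<tau> \<le> time_const * \<rho> powr \<alpha> \<Longrightarrow> barrier_const \<le> h \<tau> y"
proof -
  let ?D = "gball G x (2 * \<rho>)" and ?B = "gball G x \<rho>"
  have xV: "x \<in> V" using x gball_verts by auto
  have \<rho>1: "1 \<le> \<rho>" using \<rho> \<sigma>_ge by simp
  interpret finite_symmetric_chain ?D m "short_jumps \<rho>" by (rule chain_on_ball[OF xV])
  have D6: "?D \<subseteq> gball G v\<^sub>0 (6 * R)"
    using x \<rho> \<rho>1 v0 xV by (intro gball_mono) (auto simp: gball_def)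
  have BD: "?B \<subseteq> ?D" and finB: "finite ?B" using \<rho>1 finite_gball[OF xV] by (auto simp: gball_def)
  define T where "T = time_const * \<rho> powr \<alpha>"
  define \<psi> where "\<psi> = (\<lambda>y. max 0 (1 - 4 / \<rho> * real (\<delta> x y)))"
  define v where "v = (\<lambda>t y. heat t \<psi> y)"
  define \<nu> where "\<nu> = c\<^sub>M * C * \<rho> powr (- \<alpha>)"
  define h where "h = (\<lambda>\<tau> y. exp (- (\<nu> * \<tau>)) * (v \<tau> y - 1 / 8))"
  have nu: "0 \<le> \<nu>" using cM_ge C_pos by (simp add: \<nu>_def)
  have disp: "heat t (\<lambda>z. real (\<delta> y z)) y \<le> \<rho> / 16" if "y \<in> ?D" "0 \<le> t" "t \<le> T" for y t
    using that unfolding T_def by (intro mean_displacement x \<rho> bottom) auto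
  have v_le: "v t y \<le> 1" if "y \<in> ?D" "0 \<le> t" for t y
    unfolding v_def using heat_mono[of \<psi> "\<lambda>_. 1" y t] that \<rho>1 by (simp add: heat_const \<psi>_def)
  have v_far: "v t y \<le> 1 / 8" if y: "y \<in> ?D" "y \<notin> ?B" and t: "0 \<le> t" "t \<le> T" for t y
  proof -
    have yV: "y \<in> V" using y gball_verts by auto
    have "\<psi> z \<le> 0 + 4 / (3 * \<rho>) * real (\<delta> y z)" if z: "z \<in> ?D" for z
    proof (cases "real (\<delta> x z) \<le> \<rho> / 4")
      case True
      have zV: "z \<in> V" using z gball_verts by auto
      have "\<rho> < real (\<delta> x y)" using y by (auto simp: gball_def)
      hence "3 / 4 * \<rho> \<le> real (\<delta> y z)"
        using gdist_triangle_real[OF xV zV yV] True gdist_sym[of z y] by simp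
      hence "1 \<le> 4 / (3 * \<rho>) * real (\<delta> y z)" using \<rho>1 by (simp add: field_simps)
      moreover have "\<psi> z \<le> 1" using \<rho>1 by (simp add: \<psi>_def)
      ultimately show ?thesis by linarith
    next
      case False
      hence "\<psi> z = 0" using \<rho>1 by (simp add: \<psi>_def field_simps max_def)
      thus ?thesis using \<rho>1 by simp
    qed
    hence "v t y \<le> heat t (\<lambda>z. 0 + 4 / (3 * \<rho>) * real (\<delta> y z)) y"
      unfolding v_def using y t by (intro heat_mono) auto
    also have "\<dots> = 4 / (3 * \<rho>) * heat t (\<lambda>z. real (\<delta> y z)) y"
      using heat_affine[OF y(1), of t 0 "4 / (3 * \<rho>)" "\<lambda>z. real (\<delta> y z)"] by simp
    also have "\<dots> \<le> 4 / (3 * \<rho>) * (\<rho> / 16)" using disp[OF y(1) t] \<rho>1 by (intro mult_left_mono) auto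
    finally show ?thesis using \<rho>1 by (simp add: field_simps)
  qed
  have v_near: "1 / 2 \<le> v t y" if y: "y \<in> gball G x (\<rho> / 16)" and t: "0 \<le> t" "t \<le> T" for t y
  proof -
    have yD: "y \<in> ?D" and yV: "y \<in> V" using y \<rho>1 by (auto simp: gball_def)
    have "3 / 4 + (- 4 / \<rho>) * real (\<delta> y z) \<le> \<psi> z" if z: "z \<in> ?D" for z
    proof -
      have "real (\<delta> x z) \<le> \<rho> / 16 + real (\<delta> y z)"
        using gdist_triangle_real[OF xV yV gball_verts[OF z]] y by (auto simp: gball_def)
      hence "4 / \<rho> * real (\<delta> x z) \<le> 4 / \<rho> * (\<rho> / 16 + real (\<delta> y z))"
        using \<rho>1 by (intro mult_left_mono) auto
      also have "\<dots> = 1 / 4 + 4 / \<rho> * real (\<delta> y z)" using \<rho>1 by (simp add: field_simps)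
      finally show ?thesis by (simp add: \<psi>_def)
    qed
    hence "heat t (\<lambda>z. 3 / 4 + (- 4 / \<rho>) * real (\<delta> y z)) y \<le> v t y"
      unfolding v_def using yD t by (intro heat_mono) auto
    moreover have "4 / \<rho> * heat t (\<lambda>z. real (\<delta> y z)) y \<le> 4 / \<rho> * (\<rho> / 16)"
      using disp[OF yD t] \<rho>1 by (intro mult_left_mono) auto
    moreover have "4 / \<rho> * (\<rho> / 16) = 1 / 4" using \<rho>1 by simp
    moreover have "heat t (\<lambda>z. 3 / 4 + (- 4 / \<rho>) * real (\<delta> y z)) y
        = 3 / 4 - 4 / \<rho> * heat t (\<lambda>z. real (\<delta> y z)) y"
      using heat_affine[OF yD, of t "3 / 4" "- 4 / \<rho>" "\<lambda>z. real (\<delta> y z)"] by simp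
    ultimately show ?thesis by linarith
  qed
  show ?thesis
  proof (rule that[of h])
    fix y and \<tau> :: real assume y: "y \<in> ?B" and tau: "0 \<le> \<tau>"
    have yD: "y \<in> ?D" using y BD by auto
    show "h \<tau> y \<le> 1"
    proof -
      have "exp (- (\<nu> * \<tau>)) * (v \<tau> y - 1 / 8) \<le> exp (- (\<nu> * \<tau>)) * 1"
        using v_le[OF yD tau] by (intro mult_left_mono) auto
      also have "\<dots> \<le> 1" using nu tau by simp
      finally show ?thesis by (simp add: h_def)
    qed
    assume "\<tau> \<le> time_const * \<rho> powr \<alpha>"
    hence tT: "\<tau> \<le> T" by (simp add: T_def)
    have yV: "y \<in> V" using y gball_verts by auto
    define h' where "h' = - \<nu> * h \<tau> y + exp (- (\<nu> * \<tau>)) * gen (v \<tau>) y"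
    have vd: "((\<lambda>\<tau>. v \<tau> y) has_real_derivative gen (v \<tau>) y) (at \<tau>)"
      unfolding v_def by (rule heat_deriv[OF yD])
    have deriv: "((\<lambda>\<tau>. h \<tau> y) has_real_derivative h') (at \<tau>)"
      unfolding h_def h'_def by (auto intro!: derivative_eq_intros vd simp: algebra_simps)
    have yb: "gball G y \<rho> \<subseteq> ?D" using y xV yV by (intro gball_mono) (auto simp: gball_def)
    have "exp (- (\<nu> * \<tau>)) * gen (v \<tau>) y = (\<Sum>z\<in>?D. short_jumps \<rho> y z * m z * (h \<tau> z - h \<tau> y))"
      unfolding gen_def h_def sum_distrib_left by (intro sum.cong refl) (simp add: algebra_simps)
    also have "\<dots> = (\<Sum>z\<in>gball G y \<rho>. J y z * (h \<tau> z - h \<tau> y))"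
      using yb finite_D by (intro sum.mono_neutral_cong_right) (auto simp: short_jumps_def gball_def)
    finally have gen: "exp (- (\<nu> * \<tau>)) * gen (v \<tau>) y
        = (\<Sum>z\<in>gball G y \<rho>. J y z * h \<tau> z) - (\<Sum>z\<in>gball G y \<rho>. J y z) * h \<tau> y"
      by (simp add: right_diff_distrib sum_subtractf sum_distrib_right)
    have "h' + jump_rate G d \<alpha> y * h \<tau> y \<le> (\<Sum>z\<in>?B. J y z * max 0 (h \<tau> z))" if pos: "0 < h \<tau> y"
    proof -
      have "(jump_rate G d \<alpha> y - (\<Sum>z\<in>gball G y \<rho>. J y z) - \<nu>) * h \<tau> y \<le> 0"
        using jump_rate_split[of y \<rho>] D6 yD \<rho> pos by (intro mult_nonpos_nonneg) (auto simp: \<nu>_def)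
      hence "h' + jump_rate G d \<alpha> y * h \<tau> y \<le> (\<Sum>z\<in>gball G y \<rho>. J y z * h \<tau> z)"
        unfolding h'_def gen by (simp add: algebra_simps)
      also have "\<dots> \<le> (\<Sum>z\<in>gball G y \<rho>. if z \<in> ?B then J y z * max 0 (h \<tau> z) else 0)"
      proof (rule sum_mono)
        fix z assume z: "z \<in> gball G y \<rho>"
        have Jz: "0 \<le> J y z" using J_nonneg[OF yV gball_verts[OF z]] .
        show "J y z * h \<tau> z \<le> (if z \<in> ?B then J y z * max 0 (h \<tau> z) else 0)"
        proof (cases "z \<in> ?B")
          case True thus ?thesis using mult_left_mono[OF max.cobounded2[of "h \<tau> z" 0] Jz] by simp
        next
          case False
          hence "h \<tau> z \<le> 0" using v_far[of z \<tau>] z yb tau tT by (auto simp: h_def mult_nonneg_nonpos)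
          thus ?thesis using False Jz by (simp add: mult_nonneg_nonpos)
        qed
      qed
      also have "\<dots> = (\<Sum>z\<in>{z\<in>gball G y \<rho>. z \<in> ?B}. J y z * max 0 (h \<tau> z))"
        by (rule sum.inter_filter[OF finite_gball[OF yV], symmetric])
      also have "\<dots> \<le> (\<Sum>z\<in>?B. J y z * max 0 (h \<tau> z))"
        using finB J_nonneg[OF yV gball_verts] by (intro sum_mono2) auto
      finally show ?thesis .
    qed
    with deriv show "\<exists>h'. ((\<lambda>\<tau>. h \<tau> y) has_real_derivative h') (at \<tau>) \<and>
        (0 < h \<tau> y \<longrightarrow> h' + jump_rate G d \<alpha> y * h \<tau> y \<le> (\<Sum>z\<in>?B. J y z * max 0 (h \<tau> z)))" by blast
  next
    fix y and \<tau> :: real assume y: "y \<in> gball G x (\<rho> / 16)" and tau: "0 \<le> \<tau>" "\<tau> \<le> time_const * \<rho> powr \<alpha>"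
    have "\<nu> * \<tau> \<le> \<nu> * (1 * \<rho> powr \<alpha>)"
      using tau time_const_bounds nu by (intro mult_left_mono order_trans[OF tau(2)] mult_right_mono) auto
    also have "\<dots> = c\<^sub>M * C" using \<rho>1 by (simp add: \<nu>_def powr_minus)
    finally have "exp (- (c\<^sub>M * C)) \<le> exp (- (\<nu> * \<tau>))" by simp
    moreover have "3 / 8 \<le> v \<tau> y - 1 / 8" using v_near[OF y tau(1)] tau(2) by (simp add: T_def)
    ultimately show "barrier_const \<le> h \<tau> y"
      unfolding barrier_const_def h_def by (intro mult_mono) auto
  qed
qed

end

section \<open>Mild solutions and the comparison principle\<close>

lemma nn_integral_count_space_infsum:
  fixes g :: "'a \<Rightarrow> real"
  assumes "g summable_on A" "\<And>x. x \<in> A \<Longrightarrow> 0 \<le> g x"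
  shows "(\<integral>\<^sup>+ x. ennreal (g x) \<partial>count_space A) = ennreal (infsum g A)"
proof -
  have "(\<lambda>x. norm (g x)) summable_on A" using assms(1) summable_on_iff_abs_summable_on_real by blast
  hence "Infinite_Set_Sum.abs_summable_on g A" using abs_summable_equivalent by blast
  thus ?thesis using assms(2) by (simp add: nn_integral_conv_infsetsum infsetsum_infsum)
qed

definition jump_mean :: "('a, 'b) wgraph_scheme \<Rightarrow> real \<Rightarrow> real \<Rightarrow> 'a \<Rightarrow> ('a \<Rightarrow> real) \<Rightarrow> real" where
  "jump_mean G d \<alpha> x f = jump_rate G d \<alpha> x * measure_pmf.expectation (jump_pmf G d \<alpha> x) f"

text \<open>
  The backward equation $-\partial_t u + c u = F$ at the vertices of \<open>B\<close>,
  integrated against its exponential kernel. Caloric functions are only measurable in time away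
  from \<open>B\<close>, so the source \<open>F\<close> need not be continuous and the
  differential form would fail.
\<close>

definition mild_solution :: "('a \<Rightarrow> real) \<Rightarrow> real \<Rightarrow> real \<Rightarrow> 'a set \<Rightarrow> (real \<Rightarrow> 'a \<Rightarrow> real) \<Rightarrow> (real \<Rightarrow> 'a \<Rightarrow> real) \<Rightarrow> bool" where
  "mild_solution c a b B F u \<longleftrightarrow> (\<forall>x\<in>B. \<forall>v w. a \<le> v \<and> v < w \<and> w \<le> b \<longrightarrow>
     ((\<lambda>\<tau>. exp (- c x * (\<tau> - v)) * F \<tau> x) has_integral (u v x - exp (- c x * (w - v)) * u w x)) {v..w})"

lemma mild_solution_continuous:
  assumes sol: "mild_solution c a b B F u" and x: "x \<in> B"
  shows "continuous_on {a..b} (\<lambda>v. u v x)"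
proof (cases "a < b")
  case True
  define I where "I = (\<lambda>\<tau>. exp (- c x * (\<tau> - a)) * F \<tau> x)"
  have int: "I integrable_on {a..b}"
    using sol True x by (auto simp: mild_solution_def I_def intro!: has_integral_integrable)
  have eq: "u v x = exp (- c x * (b - v)) * u b x + exp (c x * (v - a)) * integral {v..b} I"
    if v: "v \<in> {a..b}" for v
  proof (cases "v < b")
    case True
    have "((\<lambda>\<tau>. exp (c x * (v - a)) * I \<tau>) has_integral (exp (c x * (v - a)) * integral {v..b} I)) {v..b}"
      using int v by (intro has_integral_mult_right integrable_integral) (auto intro: integrable_on_subinterval)
    also have "(\<lambda>\<tau>. exp (c x * (v - a)) * I \<tau>) = (\<lambda>\<tau>. exp (- c x * (\<tau> - v)) * F \<tau> x)"
      by (auto simp: I_def exp_add[symmetric] algebra_simps mult_exp_exp)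
    finally have 1: "((\<lambda>\<tau>. exp (- c x * (\<tau> - v)) * F \<tau> x) has_integral
      (exp (c x * (v - a)) * integral {v..b} I)) {v..b}" .
    have "((\<lambda>\<tau>. exp (- c x * (\<tau> - v)) * F \<tau> x) has_integral
      (u v x - exp (- c x * (b - v)) * u b x)) {v..b}"
      using sol x v True unfolding mild_solution_def by auto
    from has_integral_unique[OF 1 this] show ?thesis by linarith
  qed (use v in auto)
  have "continuous_on {a..b} (\<lambda>v. exp (- c x * (b - v)) * u b x + exp (c x * (v - a)) * integral {v..b} I)"
    by (intro continuous_intros indefinite_integral_continuous_1' int)
  thus ?thesis by (rule continuous_on_eq) (rule eq[symmetric])
next
  case False
  hence "{a..b} \<subseteq> {a}" by auto
  thus ?thesis by (rule continuous_on_subset[rotated]) simp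
qed

lemma has_integral_exponential_kernel:
  fixes c M s t :: real
  assumes "s \<le> t"
  shows "((\<lambda>\<tau>. exp (- c * (\<tau> - s)) * (c * M)) has_integral (M - exp (- c * (t - s)) * M)) {s..t}"
proof -
  have "((\<lambda>\<tau>. exp (- c * (\<tau> - s)) * (c * M)) has_integral
    (- exp (- c * (t - s)) * M - (- exp (- c * (s - s)) * M))) {s..t}"
  proof (rule fundamental_theorem_of_calculus)
    fix \<tau> assume "\<tau> \<in> {s..t}"
    show "((\<lambda>\<tau>. - exp (- c * (\<tau> - s)) * M) has_vector_derivative
        exp (- c * (\<tau> - s)) * (c * M)) (at \<tau> within {s..t})"
      unfolding has_real_derivative_iff_has_vector_derivative[symmetric]
      by (auto intro!: derivative_eq_intros simp: algebra_simps)
  qed (rule assms)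
  thus ?thesis by simp
qed

text \<open>
  Maximum principle. At the last time \<open>s\<close> at which the maximum \<open>M\<close> of
  $\phi-u$ is attained, say at \<open>y\<close>, the integrated equation over $[s,t]$ bounds $M$
  by a convex combination of $(\phi-u)(t,y)<M$ and $M$. Only points with $\phi>u$ matter, and at
  these \<open>sub\<close> may use that $\phi\le u+M$ on all of \<open>B\<close>.
\<close>

lemma comparison_principle:
  fixes u \<phi> F :: "real \<Rightarrow> 'a \<Rightarrow> real"
  assumes finB: "finite B" and c: "\<And>y. y \<in> B \<Longrightarrow> 0 \<le> c y"
    and sol: "mild_solution c a b B F u"
    and deriv: "\<And>y \<tau>. y \<in> B \<Longrightarrow> \<tau> \<in> {a..b} \<Longrightarrow>
       ((\<lambda>\<tau>. \<phi> \<tau> y) has_real_derivative \<phi>' \<tau> y) (at \<tau> within {a..b})"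
    and sub: "\<And>y \<tau> M. y \<in> B \<Longrightarrow> \<tau> \<in> {a..b} \<Longrightarrow> 0 \<le> M \<Longrightarrow> (\<And>z. z \<in> B \<Longrightarrow> \<phi> \<tau> z \<le> u \<tau> z + M) \<Longrightarrow>
       u \<tau> y < \<phi> \<tau> y \<Longrightarrow> c y * \<phi> \<tau> y - \<phi>' \<tau> y \<le> F \<tau> y + c y * M"
    and final: "\<And>y. y \<in> B \<Longrightarrow> \<phi> b y \<le> u b y"
    and vx: "v \<in> {a..b}" "x \<in> B"
  shows "\<phi> v x \<le> u v x"
proof (rule ccontr)
  assume neg: "\<not> \<phi> v x \<le> u v x"
  define g where "g = (\<lambda>\<tau> y. \<phi> \<tau> y - u \<tau> y)"
  have cont_phi: "continuous_on {a..b} (\<lambda>\<tau>. \<phi> \<tau> y)" if "y \<in> B" for y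
    using deriv[OF that] by (rule DERIV_continuous_on)
  have cont: "continuous_on {a..b} (\<lambda>\<tau>. g \<tau> y)" if "y \<in> B" for y
    unfolding g_def using that by (intro continuous_on_diff cont_phi mild_solution_continuous[OF sol])
  have "\<exists>\<tau>\<in>{a..b}. \<forall>\<sigma>\<in>{a..b}. g \<sigma> y \<le> g \<tau> y" if "y \<in> B" for y
    using vx by (intro continuous_attains_sup cont that) auto
  then obtain top where top: "\<And>y. y \<in> B \<Longrightarrow> top y \<in> {a..b}"
    "\<And>y \<sigma>. y \<in> B \<Longrightarrow> \<sigma> \<in> {a..b} \<Longrightarrow> g \<sigma> y \<le> g (top y) y" by metis
  define M where "M = Max ((\<lambda>y. g (top y) y) ` B)"
  have M_ge: "g \<sigma> y \<le> M" if "y \<in> B" "\<sigma> \<in> {a..b}" for y \<sigma>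
  proof -
    have "g (top y) y \<le> M" unfolding M_def using finB that by (intro Max_ge) auto
    thus ?thesis using top(2)[OF that] by linarith
  qed
  have M_pos: "0 < M" using M_ge[OF vx(2,1)] neg by (simp add: g_def)
  have "M \<in> (\<lambda>y. g (top y) y) ` B" unfolding M_def using finB vx by (intro Max_in) auto
  then obtain y0 where y0: "y0 \<in> B" "g (top y0) y0 = M" by auto
  (* All times at which the maximum is attained: a compact set, so there is a last one. *)
  define S where "S = (\<Union>y\<in>B. {\<tau>\<in>{a..b}. g \<tau> y = M})"
  have "closed S" unfolding S_def
    by (intro closed_UN finB ballI continuous_closed_preimage_constant cont) auto
  moreover have "bounded S" by (rule bounded_subset[OF bounded_closed_interval[of a b]]) (auto simp: S_def)
  ultimately have "compact S" by (simp add: compact_eq_bounded_closed)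
  moreover have "S \<noteq> {}" using y0 top(1)[OF y0(1)] by (auto simp: S_def)
  ultimately obtain s where s: "s \<in> S" "\<And>\<tau>. \<tau> \<in> S \<Longrightarrow> \<tau> \<le> s"
    using compact_attains_sup by metis
  then obtain y where y: "y \<in> B" "s \<in> {a..b}" "g s y = M" by (auto simp: S_def)
  have "s \<noteq> b" using final[OF y(1)] y(3) M_pos by (auto simp: g_def)
  hence sb: "s < b" using y by auto
  have "eventually (\<lambda>\<tau>. 0 < g \<tau> y) (at s within {a..b})"
    using cont[OF y(1)] y M_pos by (intro order_tendstoD(1)[of _ "g s y"]) (auto simp: continuous_on_def)
  then obtain e where e: "0 < e" "\<And>\<tau>. \<tau> \<in> {a..b} \<Longrightarrow> \<tau> \<noteq> s \<Longrightarrow> dist \<tau> s < e \<Longrightarrow> 0 < g \<tau> y"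
    by (auto simp: eventually_at)
  define t where "t = min b (s + e / 2)"
  have t: "s < t" "t \<le> b" "t < s + e" using sb e(1) by (auto simp: t_def)
  have st: "{s..t} \<subseteq> {a..b}" using t y by auto
  have pos: "0 < g \<tau> y" if "\<tau> \<in> {s..t}" for \<tau>
    using e(2)[of \<tau>] that st y(3) M_pos t by (cases "\<tau> = s") (auto simp: dist_real_def)
  have gt: "g t y < M"
  proof -
    have "t \<notin> S" using s(2)[of t] t by auto
    hence "g t y \<noteq> M" using y st t by (auto simp: S_def)
    thus ?thesis using M_ge[OF y(1), of t] st t by auto
  qed
  let ?c = "c y"
  have I1: "((\<lambda>\<tau>. exp (- ?c * (\<tau> - s)) * (?c * \<phi> \<tau> y - \<phi>' \<tau> y)) has_integral
      (\<phi> s y - exp (- ?c * (t - s)) * \<phi> t y)) {s..t}"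
  proof -
    have "((\<lambda>\<tau>. exp (- ?c * (\<tau> - s)) * (?c * \<phi> \<tau> y - \<phi>' \<tau> y)) has_integral
      (- exp (- ?c * (t - s)) * \<phi> t y - (- exp (- ?c * (s - s)) * \<phi> s y))) {s..t}"
    proof (rule fundamental_theorem_of_calculus)
      fix \<tau> assume tau: "\<tau> \<in> {s..t}"
      have "((\<lambda>\<tau>. \<phi> \<tau> y) has_real_derivative \<phi>' \<tau> y) (at \<tau> within {s..t})"
        using deriv[OF y(1), of \<tau>] tau st by (auto intro: DERIV_subset)
      thus "((\<lambda>\<tau>. - exp (- ?c * (\<tau> - s)) * \<phi> \<tau> y) has_vector_derivative
          exp (- ?c * (\<tau> - s)) * (?c * \<phi> \<tau> y - \<phi>' \<tau> y)) (at \<tau> within {s..t})"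
        unfolding has_real_derivative_iff_has_vector_derivative[symmetric]
        by (auto intro!: derivative_eq_intros simp: algebra_simps)
    qed (use t in auto)
    thus ?thesis by simp
  qed
  have I2: "((\<lambda>\<tau>. exp (- ?c * (\<tau> - s)) * F \<tau> y) has_integral (u s y - exp (- ?c * (t - s)) * u t y)) {s..t}"
    using sol y t by (auto simp: mild_solution_def)
  have I3: "((\<lambda>\<tau>. exp (- ?c * (\<tau> - s)) * (?c * M)) has_integral (M - exp (- ?c * (t - s)) * M)) {s..t}"
    using t by (intro has_integral_exponential_kernel) auto
  have "\<phi> s y - exp (- ?c * (t - s)) * \<phi> t y
      \<le> (u s y - exp (- ?c * (t - s)) * u t y) + (M - exp (- ?c * (t - s)) * M)"
  proof (rule has_integral_le[OF I1 has_integral_add[OF I2 I3]])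
    fix \<tau> assume tau: "\<tau> \<in> {s..t}"
    hence tab: "\<tau> \<in> {a..b}" using st by auto
    have "?c * \<phi> \<tau> y - \<phi>' \<tau> y \<le> F \<tau> y + ?c * M"
      using y(1) tab M_pos M_ge[OF _ tab] pos[OF tau] by (intro sub) (auto simp: g_def algebra_simps)
    hence "exp (- ?c * (\<tau> - s)) * (?c * \<phi> \<tau> y - \<phi>' \<tau> y) \<le> exp (- ?c * (\<tau> - s)) * (F \<tau> y + ?c * M)"
      by (intro mult_left_mono) auto
    thus "exp (- ?c * (\<tau> - s)) * (?c * \<phi> \<tau> y - \<phi>' \<tau> y)
        \<le> exp (- ?c * (\<tau> - s)) * F \<tau> y + exp (- ?c * (\<tau> - s)) * (?c * M)"
      by (simp only: distrib_left)
  qed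
  hence "exp (- ?c * (t - s)) * M \<le> exp (- ?c * (t - s)) * g t y"
    using y(3) by (simp add: g_def right_diff_distrib)
  thus False using gt by simp
qed

context stable_graph
begin

lemma jump_rate_nonneg: "x \<in> V \<Longrightarrow> 0 \<le> jump_rate G d \<alpha> x"
  unfolding jump_rate_def using J_nonneg by (intro infsum_nonneg) auto

lemma pmf_jump_pmf:
  assumes x: "x \<in> V" and r: "jump_rate G d \<alpha> x \<noteq> 0"
  shows "pmf (jump_pmf G d \<alpha> x) y = (if y \<in> V then J x y / jump_rate G d \<alpha> x else 0)"
proof -
  let ?r = "jump_rate G d \<alpha> x"
  let ?f = "\<lambda>y. if y \<in> V then J x y / ?r else 0"
  have r_pos: "0 < ?r" using r jump_rate_nonneg[OF x] by simp
  have nn: "0 \<le> ?f y" for y using J_nonneg[OF x] r_pos by auto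
  have "(\<integral>\<^sup>+ y. ennreal (?f y) \<partial>count_space UNIV) = (\<integral>\<^sup>+ y. ennreal (J x y / ?r) \<partial>count_space V)"
    by (subst nn_integral_count_space_indicator) (auto intro!: nn_integral_cong split: split_indicator)
  also have "\<dots> = ennreal (\<Sum>\<^sub>\<infinity>y\<in>V. J x y / ?r)"
    unfolding divide_inverse using J_nonneg[OF x] r_pos
    by (intro nn_integral_count_space_infsum summable_on_cmult_left J_summable x) auto
  also have "(\<Sum>\<^sub>\<infinity>y\<in>V. J x y / ?r) = 1"
    using r by (simp add: divide_inverse infsum_cmult_left' jump_rate_def[symmetric])
  finally have "(\<integral>\<^sup>+ y. ennreal (?f y) \<partial>count_space UNIV) = 1" by simp
  thus ?thesis unfolding jump_pmf_def using r nn by (simp add: pmf_embed_pmf)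
qed

lemma rate_times_pmf:
  assumes x: "x \<in> V" and y: "y \<in> V"
  shows "jump_rate G d \<alpha> x * pmf (jump_pmf G d \<alpha> x) y = J x y"
proof (cases "jump_rate G d \<alpha> x = 0")
  case True
  have "J x y \<le> jump_rate G d \<alpha> x"
    unfolding jump_rate_def using finite_sum_le_infsum[OF J_summable[OF x], of "{y}"] y J_nonneg[OF x] by auto
  thus ?thesis using True J_nonneg[OF x y] by simp
qed (use pmf_jump_pmf[OF x] y in auto)

lemma set_jump_pmf: "x \<in> V \<Longrightarrow> set_pmf (jump_pmf G d \<alpha> x) \<subseteq> V"
  using pmf_jump_pmf[of x] by (cases "jump_rate G d \<alpha> x = 0") (auto simp: jump_pmf_def set_pmf_iff split: if_splits)

lemma not_in_set_jump_pmf: "x \<in> V \<Longrightarrow> jump_rate G d \<alpha> x \<noteq> 0 \<Longrightarrow> x \<notin> set_pmf (jump_pmf G d \<alpha> x)"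
  using pmf_jump_pmf[of x x] conductance_props(1)[of x x] by (auto simp: set_pmf_iff)

lemma sum_J_le_rate: "x \<in> V \<Longrightarrow> finite F \<Longrightarrow> F \<subseteq> V \<Longrightarrow> (\<Sum>y\<in>F. J x y) \<le> jump_rate G d \<alpha> x"
  unfolding jump_rate_def using J_nonneg by (intro finite_sum_le_infsum J_summable) auto

text \<open>
  Splits the mean over the jump target into a finite sum over \<open>F\<close>, which keeps the
  exact values, and the rest, where only a lower bound \<open>- g\<close> is used.
\<close>

lemma jump_mean_lower_bound:
  assumes x: "x \<in> V" and F: "finite F" "F \<subseteq> V" and bdd: "\<And>z. z \<in> V \<Longrightarrow> \<bar>f z\<bar> \<le> K"
    and g: "\<And>z. z \<in> V - F \<Longrightarrow> - g z \<le> f z" "\<And>z. 0 \<le> g z"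
    and E: "ennreal (jump_rate G d \<alpha> x) * (\<integral>\<^sup>+ z. ennreal (g z) * indicator (V - F) z \<partial>measure_pmf (jump_pmf G d \<alpha> x)) \<le> ennreal \<epsilon>"
    and eps: "0 \<le> \<epsilon>"
  shows "(\<Sum>z\<in>F. J x z * f z) - \<epsilon> \<le> jump_mean G d \<alpha> x f"
proof -
  let ?p = "jump_pmf G d \<alpha> x" and ?r = "jump_rate G d \<alpha> x"
  have r: "0 \<le> ?r" by (rule jump_rate_nonneg[OF x])
  have AE: "AE z in measure_pmf ?p. z \<in> V" using set_jump_pmf[OF x] by (auto simp: AE_measure_pmf_iff)
  define h where "h = (\<lambda>z. max 0 (- f z) * indicator (V - F) z)"
  have int: "integrable (measure_pmf ?p) (\<lambda>z. k z)" if "\<And>z. z \<in> V \<Longrightarrow> \<bar>k z\<bar> \<le> K" for k :: "'a \<Rightarrow> real"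
    using AE that by (intro measure_pmf.integrable_const_bound[of _ K]) (auto elim!: eventually_mono)
  have ih: "integrable (measure_pmf ?p) h"
    using bdd by (intro int) (fastforce simp: h_def abs_le_iff split: split_indicator)
  have i1: "integrable (measure_pmf ?p) (\<lambda>z. f z * indicator F z)"
    using bdd by (intro int) (fastforce simp: abs_le_iff split: split_indicator)
  have "measure_pmf.expectation ?p (\<lambda>z. f z * indicator F z - h z) \<le> measure_pmf.expectation ?p f"
    using AE bdd by (intro integral_mono_AE Bochner_Integration.integrable_diff i1 ih int)
      (auto simp: h_def elim!: eventually_mono split: split_indicator)
  hence "measure_pmf.expectation ?p (\<lambda>z. f z * indicator F z) - measure_pmf.expectation ?p h
      \<le> measure_pmf.expectation ?p f"
    using i1 ih by simp
  hence "?r * (measure_pmf.expectation ?p (\<lambda>z. f z * indicator F z) - measure_pmf.expectation ?p h)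
      \<le> jump_mean G d \<alpha> x f"
    unfolding jump_mean_def using r by (rule mult_left_mono)
  moreover have "?r * measure_pmf.expectation ?p (\<lambda>z. f z * indicator F z) = (\<Sum>z\<in>F. J x z * f z)"
  proof -
    have "measure_pmf.expectation ?p (\<lambda>z. f z * indicator F z) = (\<Sum>z\<in>F. f z * indicator F z * pmf ?p z)"
      using F by (intro integral_measure_pmf_real) (auto split: split_indicator_asm)
    also have "?r * \<dots> = (\<Sum>z\<in>F. (?r * pmf ?p z) * f z)"
      unfolding sum_distrib_left by (intro sum.cong) auto
    also have "\<dots> = (\<Sum>z\<in>F. J x z * f z)"
      using F rate_times_pmf[OF x] by (intro sum.cong) auto
    finally show ?thesis .
  qed
  moreover have "?r * measure_pmf.expectation ?p h \<le> \<epsilon>"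
  proof -
    have "ennreal (?r * measure_pmf.expectation ?p h) = ennreal ?r * (\<integral>\<^sup>+ z. ennreal (h z) \<partial>measure_pmf ?p)"
      using r ih by (subst nn_integral_eq_integral) (auto simp: ennreal_mult' h_def)
    also have "\<dots> \<le> ennreal ?r * (\<integral>\<^sup>+ z. ennreal (g z) * indicator (V - F) z \<partial>measure_pmf ?p)"
      using g by (intro mult_left_mono nn_integral_mono)
        (auto simp: h_def intro!: ennreal_leI split: split_indicator, force simp: max_def)
    also note E
    finally show ?thesis using eps by simp
  qed
  ultimately show ?thesis by (simp add: right_diff_distrib)
qed

end

text \<open>
  Growth like a small power $\beta$ exceeds $1$ by little: at most $\beta/b$ times a fixed
  power.
\<close>

lemma powr_minus_one_le:
  fixes a \<beta> b :: real
  assumes "0 < \<beta>" "\<beta> \<le> b" "0 < a"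
  shows "a powr \<beta> - 1 \<le> \<beta> / b * a powr b"
proof -
  define t where "t = \<beta> / b"
  have t: "0 \<le> t" "t \<le> 1" "b * t = \<beta>" using assms by (auto simp: t_def)
  have "(a powr b) powr t * 1 powr (1 - t) \<le> t * a powr b + (1 - t) * 1"
    by (rule Youngs_inequality_0) (use t assms in auto)
  hence "a powr \<beta> \<le> t * a powr b + (1 - t)" using t by (simp add: powr_powr)
  thus ?thesis using t unfolding t_def by linarith
qed

lemma real_dyadic_bracket:
  fixes a :: real
  assumes "1 < a"
  obtains j :: nat where "2 ^ j < a" "a \<le> 2 ^ Suc j"
proof -
  obtain n :: nat where "a < 2 ^ n" using real_arch_pow[of 2 a] by auto
  hence ex: "\<exists>n. a \<le> 2 ^ n" using less_imp_le by blast
  define n where "n = (LEAST n. a \<le> 2 ^ n)"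
  have n: "a \<le> 2 ^ n" unfolding n_def by (rule LeastI_ex[OF ex])
  have "n \<noteq> 0"
  proof
    assume "n = 0"
    thus False using n assms by simp
  qed
  then obtain j where j: "n = Suc j" by (cases n) auto
  have "\<not> a \<le> 2 ^ j" using not_less_Least[of j "\<lambda>n. a \<le> 2 ^ n"] j n_def by simp
  thus ?thesis using that[of j] n j by simp
qed

section \<open>Growth of positive solutions\<close>

text \<open>
  A continuous substitute for the indicator of values at least $1$; with it the amount of mass
  where a solution is large is continuous in time, and no measurability or time regularity of
  level sets is needed.
\<close>

definition soft_step :: "real \<Rightarrow> real" where
  "soft_step a = max 0 (min 1 (2 * a - 1))"

lemma soft_step_props:
  "0 \<le> soft_step a" "soft_step a \<le> 1" "a \<le> 1 / 2 \<Longrightarrow> soft_step a = 0" "1 \<le> a \<Longrightarrow> soft_step a = 1"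
  by (auto simp: soft_step_def)

context scale_window
begin

lemma tail_probability:
  assumes y: "y \<in> gball G v\<^sub>0 (6 * R)" and s: "\<sigma> \<le> s"
  shows "ennreal (jump_rate G d \<alpha> y) * emeasure (measure_pmf (jump_pmf G d \<alpha> y)) {z \<in> V. s < real (\<delta> y z)}
    \<le> ennreal (c\<^sub>M * C * s powr (- \<alpha>))"
proof -
  let ?A = "{z \<in> V. s < real (\<delta> y z)}"
  have yV: "y \<in> V" using y gball_verts by auto
  have "ennreal (jump_rate G d \<alpha> y) * emeasure (measure_pmf (jump_pmf G d \<alpha> y)) ?A
      = (\<integral>\<^sup>+ z. ennreal (jump_rate G d \<alpha> y) * ennreal (pmf (jump_pmf G d \<alpha> y) z) \<partial>count_space ?A)"
    by (simp add: nn_integral_cmult nn_integral_pmf)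
  also have "\<dots> = (\<integral>\<^sup>+ z. ennreal (J y z) \<partial>count_space ?A)"
    using rate_times_pmf[OF yV] jump_rate_nonneg[OF yV]
    by (intro nn_integral_cong) (simp add: ennreal_mult'[symmetric])
  also have "\<dots> = ennreal (\<Sum>\<^sub>\<infinity>z\<in>?A. J y z)"
    using tail_rate(1)[OF s y] J_nonneg[OF yV] by (intro nn_integral_count_space_infsum) auto
  also have "\<dots> \<le> ennreal (c\<^sub>M * C * s powr (- \<alpha>))" by (intro ennreal_leI tail_rate(2)[OF s y])
  finally show ?thesis .
qed

text \<open>
  The tail bound, summed over dyadic shells, gives moments of every order below $\alpha$; the
  order $\alpha/2$ is used.
\<close>

lemma tail_half_moment:
  assumes y: "y \<in> gball G v\<^sub>0 (6 * R)" and \<rho>: "\<sigma> \<le> \<rho>"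
  shows "ennreal (jump_rate G d \<alpha> y) * (\<integral>\<^sup>+ z. ennreal ((real (\<delta> y z) / \<rho>) powr (\<alpha> / 2))
      * indicator {z \<in> V. \<rho> < real (\<delta> y z)} z \<partial>measure_pmf (jump_pmf G d \<alpha> y))
    \<le> ennreal (tail_const * \<rho> powr (- \<alpha>))"
proof -
  let ?p = "jump_pmf G d \<alpha> y" and ?r = "jump_rate G d \<alpha> y"
  define A where "A = (\<lambda>j::nat. {z \<in> V. 2 ^ j * \<rho> < real (\<delta> y z)})"
  define w where "w = (\<lambda>j::nat. 2 powr (real (Suc j) * (\<alpha> / 2)))"
  have \<rho>1: "1 \<le> \<rho>" using \<rho> \<sigma>_ge by simp
  have pt: "ennreal ((real (\<delta> y z) / \<rho>) powr (\<alpha> / 2)) * indicator {z \<in> V. \<rho> < real (\<delta> y z)} z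
      \<le> (\<Sum>j. ennreal (w j) * indicator (A j) z)" for z
  proof (cases "z \<in> V \<and> \<rho> < real (\<delta> y z)")
    case True
    have "1 < real (\<delta> y z) / \<rho>" using True \<rho>1 by simp
    then obtain j where j: "2 ^ j < real (\<delta> y z) / \<rho>" "real (\<delta> y z) / \<rho> \<le> 2 ^ Suc j"
      by (rule real_dyadic_bracket)
    have "(real (\<delta> y z) / \<rho>) powr (\<alpha> / 2) \<le> (2 ^ Suc j) powr (\<alpha> / 2)"
      using j \<alpha>_pos \<rho>1 by (intro powr_mono2) auto
    also have "(2::real) ^ Suc j = 2 powr real (Suc j)" by (rule powr_realpow[symmetric]) simp
    also have "\<dots> powr (\<alpha> / 2) = w j" by (simp only: w_def powr_powr)
    finally have "ennreal ((real (\<delta> y z) / \<rho>) powr (\<alpha> / 2)) \<le> ennreal (w j) * indicator (A j) z"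
      using j True \<rho>1 by (simp add: A_def field_simps ennreal_leI)
    also have "\<dots> \<le> (\<Sum>j. ennreal (w j) * indicator (A j) z)"
    proof -
      have "sum F {j} \<le> suminf F" for F :: "nat \<Rightarrow> ennreal"
        by (intro sum_le_suminf summableI) auto
      hence "F j \<le> suminf F" for F :: "nat \<Rightarrow> ennreal" by simp
      thus ?thesis .
    qed
    finally show ?thesis using True by simp
  qed auto
  have "ennreal ?r * (\<integral>\<^sup>+ z. ennreal ((real (\<delta> y z) / \<rho>) powr (\<alpha> / 2))
      * indicator {z \<in> V. \<rho> < real (\<delta> y z)} z \<partial>measure_pmf ?p)
    \<le> ennreal ?r * (\<integral>\<^sup>+ z. (\<Sum>j. ennreal (w j) * indicator (A j) z) \<partial>measure_pmf ?p)"
    by (intro mult_left_mono nn_integral_mono pt) auto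
  also have "\<dots> = (\<Sum>j. ennreal (w j) * (ennreal ?r * emeasure (measure_pmf ?p) (A j)))"
    by (subst nn_integral_suminf) (auto simp: nn_integral_cmult ennreal_suminf_cmult[symmetric] mult_ac)
  also have "\<dots> \<le> (\<Sum>j. ennreal (c\<^sub>M * C * 2 powr (\<alpha> / 2) * \<rho> powr (- \<alpha>) * (2 powr (- \<alpha> / 2)) ^ j))"
  proof (intro suminf_le summableI)
    fix j :: nat
    have "1 * \<rho> \<le> 2 ^ j * \<rho>" using \<rho>1 by (intro mult_right_mono) auto
    hence "\<sigma> \<le> 2 ^ j * \<rho>" using \<rho> by simp
    hence "ennreal (w j) * (ennreal ?r * emeasure (measure_pmf ?p) (A j))
        \<le> ennreal (w j) * ennreal (c\<^sub>M * C * (2 ^ j * \<rho>) powr (- \<alpha>))"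
      unfolding A_def by (intro mult_left_mono tail_probability y) auto
    also have "\<dots> = ennreal (w j * (c\<^sub>M * C * (2 ^ j * \<rho>) powr (- \<alpha>)))"
      using cM_ge C_pos by (subst ennreal_mult') (auto simp: w_def)
    also have "w j * (c\<^sub>M * C * (2 ^ j * \<rho>) powr (- \<alpha>))
        = c\<^sub>M * C * \<rho> powr (- \<alpha>) * (w j * (2 ^ j) powr (- \<alpha>))"
      using \<rho>1 by (simp add: powr_mult)
    also have "w j * (2 ^ j) powr (- \<alpha>) = 2 powr (\<alpha> / 2) * (2 powr (- \<alpha> / 2)) ^ j"
    proof -
      have "(2 ^ j) powr (- \<alpha>) = (2::real) powr (real j * (- \<alpha>))"
        by (subst powr_realpow[symmetric]) (simp_all add: powr_powr)
      moreover have "(2 powr (- \<alpha> / 2)) ^ j = (2::real) powr ((- \<alpha> / 2) * real j)"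
        by (simp only: powr_powr[symmetric]) (simp add: powr_realpow)
      ultimately show ?thesis by (simp add: w_def powr_add[symmetric] algebra_simps add_divide_distrib)
    qed
    finally show "ennreal (w j) * (ennreal ?r * emeasure (measure_pmf ?p) (A j))
        \<le> ennreal (c\<^sub>M * C * 2 powr (\<alpha> / 2) * \<rho> powr (- \<alpha>) * (2 powr (- \<alpha> / 2)) ^ j)"
      by (simp add: mult_ac)
  qed
  also have "\<dots> = ennreal (c\<^sub>M * C * 2 powr (\<alpha> / 2) * \<rho> powr (- \<alpha>) * (1 / (1 - 2 powr (- \<alpha> / 2))))"
  proof (rule suminf_ennreal_eq)
    show "(\<lambda>j. c\<^sub>M * C * 2 powr (\<alpha> / 2) * \<rho> powr (- \<alpha>) * (2 powr (- \<alpha> / 2)) ^ j)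
      sums (c\<^sub>M * C * 2 powr (\<alpha> / 2) * \<rho> powr (- \<alpha>) * (1 / (1 - 2 powr (- \<alpha> / 2))))"
      using \<alpha>_pos powr_less_mono[of "-\<alpha>/2" 0 2] by (intro sums_mult geometric_sums) simp
  qed (use cM_ge C_pos in auto)
  also have "c\<^sub>M * C * 2 powr (\<alpha> / 2) * \<rho> powr (- \<alpha>) * (1 / (1 - 2 powr (- \<alpha> / 2))) = tail_const * \<rho> powr (- \<alpha>)"
    by (simp add: tail_const_def)
  finally show ?thesis .
qed

text \<open>
  Outside the ball the solution may be as negative as distance to the power $\beta$ minus one
  allows. The loss is of order $\beta$, so it can be made small by the choice of the Hoelder
  exponent.
\<close>

lemma jump_mean_hoelder_tail:
  assumes x: "x \<in> gball G v\<^sub>0 (2 * R)" and \<rho>: "\<sigma> \<le> \<rho>" "2 * \<rho> \<le> R" and y: "y \<in> gball G x \<rho>"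
    and bdd: "\<And>z. z \<in> V \<Longrightarrow> \<bar>f z\<bar> \<le> K" and \<beta>: "0 < \<beta>" "\<beta> \<le> \<alpha> / 2" and \<gamma>: "0 < \<gamma>"
    and lower: "\<And>z. z \<in> V \<Longrightarrow> 2 * \<rho> < real (\<delta> x z) \<Longrightarrow>
       - (2 * ((real (\<delta> x z) / (2 * \<rho> * \<gamma>)) powr \<beta> - 1)) \<le> f z"
  shows "(\<Sum>z\<in>gball G x (2 * \<rho>). J y z * f z) - 4 * \<beta> / \<alpha> * \<gamma> powr (- \<alpha> / 2) * tail_const * \<rho> powr (- \<alpha>)
    \<le> jump_mean G d \<alpha> y f"
proof -
  let ?D = "gball G x (2 * \<rho>)"
  have xV: "x \<in> V" and yV: "y \<in> V" using x y gball_verts by auto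
  have \<rho>1: "1 \<le> \<rho>" using \<rho> \<sigma>_ge by simp
  have y6: "y \<in> gball G v\<^sub>0 (6 * R)"
  proof -
    have "gball G x \<rho> \<subseteq> gball G v\<^sub>0 (6 * R)" using x \<rho> \<rho>1 v0 xV by (intro gball_mono) (auto simp: gball_def)
    thus ?thesis using y by auto
  qed
  define K1 where "K1 = 4 * \<beta> / \<alpha> * \<gamma> powr (- \<alpha> / 2)"
  have K1: "0 \<le> K1" using \<beta> \<alpha>_pos by (simp add: K1_def)
  let ?g = "\<lambda>z. K1 * (real (\<delta> y z) / \<rho>) powr (\<alpha> / 2)"
  have off: "\<rho> < real (\<delta> y z)" "real (\<delta> x z) \<le> 2 * real (\<delta> y z)" if "z \<in> V - ?D" for z
    using that gdist_triangle_real[OF xV yV, of z] y by (auto simp: gball_def)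
  show ?thesis unfolding K1_def[symmetric]
  proof (rule jump_mean_lower_bound[where g="?g" and F="?D", OF yV finite_gball[OF xV] gball_subset_verts bdd])
    fix z assume z: "z \<in> V - ?D"
    have far: "2 * \<rho> < real (\<delta> x z)" using z by (auto simp: gball_def)
    define a where "a = real (\<delta> x z) / (2 * \<rho>)"
    have a: "0 < a" "a \<le> real (\<delta> y z) / \<rho>" using far \<rho>1 off(2)[OF z] by (auto simp: a_def field_simps)
    have "real (\<delta> x z) / (2 * \<rho> * \<gamma>) = a / \<gamma>" by (simp add: a_def)
    hence "- f z \<le> 2 * ((a / \<gamma>) powr \<beta> - 1)" using lower[of z] z far by auto
    also have "\<dots> \<le> 2 * (\<beta> / (\<alpha> / 2) * (a / \<gamma>) powr (\<alpha> / 2))"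
      using a \<gamma> \<beta> by (intro mult_left_mono powr_minus_one_le) auto
    also have "\<dots> = K1 * a powr (\<alpha> / 2)"
      using a \<gamma> by (simp add: K1_def powr_divide powr_minus field_simps)
    also have "\<dots> \<le> ?g z" using a \<alpha>_pos K1 by (intro mult_left_mono powr_mono2) auto
    finally show "- ?g z \<le> f z" by simp
  next
    have "ennreal (jump_rate G d \<alpha> y) * (\<integral>\<^sup>+ z. ennreal (?g z) * indicator (V - ?D) z \<partial>measure_pmf (jump_pmf G d \<alpha> y))
      \<le> ennreal (jump_rate G d \<alpha> y) * (\<integral>\<^sup>+ z. ennreal K1 * (ennreal ((real (\<delta> y z) / \<rho>) powr (\<alpha> / 2))
          * indicator {z \<in> V. \<rho> < real (\<delta> y z)} z) \<partial>measure_pmf (jump_pmf G d \<alpha> y))"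
      using off(1) K1 by (intro mult_left_mono nn_integral_mono) (auto simp: ennreal_mult' split: split_indicator)
    also have "\<dots> = ennreal K1 * (ennreal (jump_rate G d \<alpha> y) * (\<integral>\<^sup>+ z. ennreal ((real (\<delta> y z) / \<rho>) powr (\<alpha> / 2))
          * indicator {z \<in> V. \<rho> < real (\<delta> y z)} z \<partial>measure_pmf (jump_pmf G d \<alpha> y)))"
      by (simp add: nn_integral_cmult mult_ac)
    also have "\<dots> \<le> ennreal K1 * ennreal (tail_const * \<rho> powr (- \<alpha>))"
      by (intro mult_left_mono tail_half_moment y6 \<rho>) auto
    also have "\<dots> = ennreal (K1 * tail_const * \<rho> powr (- \<alpha>))"
      using K1 tail_const_pos by (simp add: ennreal_mult'[symmetric] mult.assoc)
    finally show "ennreal (jump_rate G d \<alpha> y) * (\<integral>\<^sup>+ z. ennreal (?g z) * indicator (V - ?D) z \<partial>measure_pmf (jump_pmf G d \<alpha> y))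
      \<le> ennreal (K1 * tail_const * \<rho> powr (- \<alpha>))" .
  qed (use K1 tail_const_pos in auto)
qed

text \<open>
  From \<open>y\<close> a part \<open>c\<^sub>0\<close> of the ball can be reached, so at least
  the excess over $1-c_0$ of the weight function \<open>\<eta>\<close> lies on reachable
  vertices; Cauchy-Schwarz and the bound on $\sum 1/w$ convert that mass into jump rate.
\<close>

lemma jump_rate_into_dense_set:
  assumes x: "x \<in> gball G v\<^sub>0 (2 * R)" and \<rho>: "\<sigma> \<le> \<rho>" "2 * \<rho> \<le> R" and y: "y \<in> gball G x \<rho>"
    and \<eta>: "\<And>z. 0 \<le> \<eta> z" "\<And>z. \<eta> z \<le> 1"
  shows "jump_in_const * \<rho> powr (- \<alpha>)
      * (max 0 ((\<Sum>z\<in>gball G x \<rho>. \<eta> z * m z) / (\<Sum>z\<in>gball G x \<rho>. m z) - (1 - c\<^sub>0)))\<^sup>2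
    \<le> (\<Sum>z\<in>gball G x \<rho>. J y z * \<eta> z)"
proof -
  let ?B = "gball G x \<rho>"
  have xV: "x \<in> V" and yV: "y \<in> V" using x y gball_verts by auto
  have finB: "finite ?B" by (rule finite_gball[OF xV])
  have \<rho>1: "1 \<le> \<rho>" using \<rho> \<sigma>_ge by simp
  have B6: "?B \<subseteq> gball G v\<^sub>0 (6 * R)" using x \<rho> \<rho>1 v0 xV by (intro gball_mono) (auto simp: gball_def)
  have x6: "x \<in> gball G v\<^sub>0 (6 * R)" using B6 gball_center[OF xV, of \<rho>] \<rho>1 by auto
  have y6: "y \<in> gball G v\<^sub>0 (6 * R)" using B6 y by auto
  define \<mu> where "\<mu> = (\<Sum>z\<in>?B. m z)"
  define N where "N = (\<Sum>z\<in>?B. \<eta> z * m z)"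
  have \<mu>: "\<rho> powr d / c\<^sub>G \<le> \<mu>"
    unfolding \<mu>_def using \<rho> \<rho>1 by (intro volume_bounds(1) xV radius_less) auto
  have "0 < \<rho> powr d / c\<^sub>G" using \<rho>1 cG_ge by simp
  hence \<mu>_pos: "0 < \<mu>" using \<mu> by linarith
  define W where "W = wball G y x \<rho>"
  have W: "W \<subseteq> ?B" "finite W" using finB by (auto simp: W_def wball_def intro: finite_subset)
  have w_pos: "0 < weight G y z" if "z \<in> W" for z
    using that gball_verts weight_props(2)[OF yV, of z] by (auto simp: W_def wball_def)
  have m_nn: "0 \<le> m z" if "z \<in> ?B" for z using that gball_verts mass_pos by (auto simp: less_imp_le)
  have muW: "c\<^sub>0 * \<mu> \<le> (\<Sum>z\<in>W. m z)"
  proof -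
    have "c\<^sub>0 * measure (vmeas G) ?B \<le> measure (vmeas G) W"
      unfolding W_def using \<rho> \<rho>1 by (intro wball_mass x6 y6) auto
    thus ?thesis using measure_eq_sum[OF finB gball_subset_verts] measure_eq_sum[OF W(2)] W(1) gball_subset_verts
      unfolding \<mu>_def by (metis subset_trans)
  qed
  have NW: "N - (1 - c\<^sub>0) * \<mu> \<le> (\<Sum>z\<in>W. \<eta> z * m z)"
  proof -
    have "N = (\<Sum>z\<in>W. \<eta> z * m z) + (\<Sum>z\<in>?B - W. \<eta> z * m z)"
      unfolding N_def using finB W by (simp add: sum.subset_diff)
    also have "(\<Sum>z\<in>?B - W. \<eta> z * m z) \<le> (\<Sum>z\<in>?B - W. 1 * m z)"
      using \<eta> m_nn by (intro sum_mono mult_right_mono) auto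
    also have "\<dots> = \<mu> - (\<Sum>z\<in>W. m z)" unfolding \<mu>_def using finB W by (simp add: sum_diff)
    finally show ?thesis using muW by (simp add: algebra_simps)
  qed
  have cs: "(\<Sum>z\<in>W. \<eta> z * m z)\<^sup>2 \<le> (c\<^sub>M * (\<Sum>z\<in>W. weight G y z * m z * \<eta> z)) * (C * \<rho> powr d)"
  proof -
    have "(\<Sum>z\<in>W. \<eta> z * m z)\<^sup>2 \<le> (\<Sum>z\<in>W. weight G y z * (\<eta> z * m z)\<^sup>2) * (\<Sum>z\<in>W. 1 / weight G y z)"
      by (rule weighted_Cauchy_Schwarz) (rule w_pos)
    also have "(\<Sum>z\<in>W. weight G y z * (\<eta> z * m z)\<^sup>2) * (\<Sum>z\<in>W. 1 / weight G y z)
        \<le> (\<Sum>z\<in>W. c\<^sub>M * (weight G y z * m z * \<eta> z)) * (C * \<rho> powr d)"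
    proof (rule mult_mono)
      show "(\<Sum>z\<in>W. weight G y z * (\<eta> z * m z)\<^sup>2) \<le> (\<Sum>z\<in>W. c\<^sub>M * (weight G y z * m z * \<eta> z))"
      proof (rule sum_mono)
        fix z assume z: "z \<in> W"
        have zV: "z \<in> V" using z W gball_verts by auto
        have "(\<eta> z * m z) * (\<eta> z * m z) \<le> (1 * c\<^sub>M) * (\<eta> z * m z)"
          using \<eta> mass_bounds(2)[OF zV] mass_pos[OF zV] by (intro mult_right_mono mult_mono) auto
        hence "weight G y z * (\<eta> z * m z)\<^sup>2 \<le> weight G y z * (c\<^sub>M * (\<eta> z * m z))"
          unfolding power2_eq_square using w_pos[OF z] by (intro mult_left_mono) auto
        thus "weight G y z * (\<eta> z * m z)\<^sup>2 \<le> c\<^sub>M * (weight G y z * m z * \<eta> z)" by (simp add: mult_ac)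
      qed
      have "(\<Sum>z\<in>W. 1 / weight G y z) \<le> (\<Sum>z\<in>wball G y y (cstar c\<^sub>G d * \<rho>). 1 / weight G y z)"
      proof (rule sum_mono2)
        show "finite (wball G y y (cstar c\<^sub>G d * \<rho>))" using finite_gball[OF yV] by (auto simp: wball_def)
        have "2 * \<rho> \<le> cstar c\<^sub>G d * \<rho>" using cstar_ge \<rho>1 by (intro mult_right_mono) auto
        hence "?B \<subseteq> gball G y (cstar c\<^sub>G d * \<rho>)"
          using y xV yV by (intro gball_mono) (auto simp: gball_def gdist_sym)
        thus "W \<subseteq> wball G y y (cstar c\<^sub>G d * \<rho>)" by (auto simp: W_def wball_def)
      qed (use weight_props(3)[OF yV] gball_verts in \<open>auto simp: wball_def\<close>)
      also have "\<dots> \<le> C * \<rho> powr d" using \<rho> \<rho>1 by (intro inverse_weights y6) auto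
      finally show "(\<Sum>z\<in>W. 1 / weight G y z) \<le> C * \<rho> powr d" .
      show "0 \<le> (\<Sum>z\<in>W. c\<^sub>M * (weight G y z * m z * \<eta> z))"
        using w_pos m_nn W \<eta> cM_ge by (intro sum_nonneg mult_nonneg_nonneg) (auto simp: less_imp_le)
      show "0 \<le> (\<Sum>z\<in>W. 1 / weight G y z)" using w_pos by (auto intro!: sum_nonneg simp: less_imp_le)
    qed
    finally show ?thesis by (simp add: sum_distrib_left)
  qed
  have wJ: "(\<Sum>z\<in>W. weight G y z * m z * \<eta> z) \<le> (2 * \<rho>) powr (d + \<alpha>) * (\<Sum>z\<in>?B. J y z * \<eta> z)"
  proof -
    have "(\<Sum>z\<in>W. weight G y z * m z * \<eta> z) \<le> (\<Sum>z\<in>W. (2 * \<rho>) powr (d + \<alpha>) * (J y z * \<eta> z))"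
    proof (rule sum_mono)
      fix z assume z: "z \<in> W"
      have zV: "z \<in> V" and zB: "z \<in> ?B" using z W gball_verts by auto
      have "y \<noteq> z" using w_pos[OF z] weight_props(1)[OF zV zV] by auto
      hence pos: "0 < \<delta> y z" using gdist_eq_0[OF yV zV] by auto
      have "real (\<delta> y z) \<le> 2 * \<rho>"
        using gdist_triangle_real[OF yV xV zV] y zB gdist_sym[of y x] by (auto simp: gball_def)
      hence "weight G y z \<le> (2 * \<rho>) powr (d + \<alpha>) * conductance G d \<alpha> y z"
        using pos powr_mono2[of "d + \<alpha>" "real (\<delta> y z)" "2 * \<rho>"] d_pos \<alpha>_pos w_pos[OF z]
        by (simp add: conductance_def field_simps mult_left_mono)
      hence "weight G y z * (m z * \<eta> z) \<le> ((2 * \<rho>) powr (d + \<alpha>) * conductance G d \<alpha> y z) * (m z * \<eta> z)"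
        using \<eta> m_nn[OF zB] by (intro mult_right_mono) auto
      thus "weight G y z * m z * \<eta> z \<le> (2 * \<rho>) powr (d + \<alpha>) * (J y z * \<eta> z)" by (simp add: mult_ac)
    qed
    also have "\<dots> \<le> (\<Sum>z\<in>?B. (2 * \<rho>) powr (d + \<alpha>) * (J y z * \<eta> z))"
    proof (rule sum_mono2[OF finB W(1)])
      fix z assume "z \<in> ?B - W"
      hence "0 \<le> J y z * \<eta> z" using J_nonneg[OF yV gball_verts, of z x \<rho>] \<eta>(1)[of z]
        by (intro mult_nonneg_nonneg[of "J y z"]) auto
      thus "0 \<le> (2 * \<rho>) powr (d + \<alpha>) * (J y z * \<eta> z)" by (rule mult_nonneg_nonneg[OF powr_ge_zero])
    qed
    finally show ?thesis by (simp add: sum_distrib_left)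
  qed
  define P where "P = max 0 (N / \<mu> - (1 - c\<^sub>0))"
  have "\<mu> * P = max 0 (N - (1 - c\<^sub>0) * \<mu>)"
    using \<mu>_pos by (auto simp: P_def max_def field_simps)
  also have "\<dots> \<le> (\<Sum>z\<in>W. \<eta> z * m z)"
    using NW \<eta> m_nn W by (auto intro!: sum_nonneg)
  finally have "\<mu> * P \<le> (\<Sum>z\<in>W. \<eta> z * m z)" .
  moreover have "\<rho> powr d / c\<^sub>G * P \<le> \<mu> * P" using \<mu> by (intro mult_right_mono) (auto simp: P_def)
  ultimately have "(\<rho> powr d / c\<^sub>G * P)\<^sup>2 \<le> (\<Sum>z\<in>W. \<eta> z * m z)\<^sup>2"
    using cG_ge by (intro power_mono) (auto simp: P_def)
  also note cs
  also have "(c\<^sub>M * (\<Sum>z\<in>W. weight G y z * m z * \<eta> z)) * (C * \<rho> powr d)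
      \<le> (c\<^sub>M * ((2 * \<rho>) powr (d + \<alpha>) * (\<Sum>z\<in>?B. J y z * \<eta> z))) * (C * \<rho> powr d)"
    using wJ cM_ge C_pos by (intro mult_right_mono mult_left_mono) auto
  finally have "(\<rho> powr d / c\<^sub>G * P)\<^sup>2 \<le> (c\<^sub>M * C * c\<^sub>G\<^sup>2 * 2 powr (d + \<alpha>) * \<rho> powr \<alpha> * (\<Sum>z\<in>?B. J y z * \<eta> z)) * ((\<rho> powr d)\<^sup>2 / c\<^sub>G\<^sup>2)"
    using cG_ge \<rho>1 by (simp add: powr_mult powr_add power2_eq_square field_simps)
  moreover have "(\<rho> powr d / c\<^sub>G * P)\<^sup>2 = P\<^sup>2 * ((\<rho> powr d)\<^sup>2 / c\<^sub>G\<^sup>2)"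
    by (simp add: power_mult_distrib power_divide)
  ultimately have "P\<^sup>2 * ((\<rho> powr d)\<^sup>2 / c\<^sub>G\<^sup>2)
      \<le> (c\<^sub>M * C * c\<^sub>G\<^sup>2 * 2 powr (d + \<alpha>) * \<rho> powr \<alpha> * (\<Sum>z\<in>?B. J y z * \<eta> z)) * ((\<rho> powr d)\<^sup>2 / c\<^sub>G\<^sup>2)"
    by simp
  hence P2: "P\<^sup>2 \<le> c\<^sub>M * C * c\<^sub>G\<^sup>2 * 2 powr (d + \<alpha>) * \<rho> powr \<alpha> * (\<Sum>z\<in>?B. J y z * \<eta> z)"
    by (rule mult_right_le_imp_le) (use \<rho>1 cG_ge in auto)
  have "jump_in_const * \<rho> powr (- \<alpha>) * P\<^sup>2
      \<le> jump_in_const * \<rho> powr (- \<alpha>) * (c\<^sub>M * C * c\<^sub>G\<^sup>2 * 2 powr (d + \<alpha>) * \<rho> powr \<alpha> * (\<Sum>z\<in>?B. J y z * \<eta> z))"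
    using P2 cM_ge C_pos by (intro mult_left_mono) (auto simp: jump_in_const_def)
  also have "\<dots> = (\<Sum>z\<in>?B. J y z * \<eta> z)"
  proof -
    have "jump_in_const * (c\<^sub>M * C * c\<^sub>G\<^sup>2 * 2 powr (d + \<alpha>)) = 1"
      using cM_ge C_pos cG_ge by (simp add: jump_in_const_def powr_add[symmetric])
    moreover have "\<rho> powr (- \<alpha>) * \<rho> powr \<alpha> = 1" using \<rho>1 by (simp add: powr_minus)
    moreover have "a * r * (X * r' * S) = (a * X) * (r * r') * S" for a r X r' S :: real
      by (simp only: mult_ac)
    ultimately show ?thesis by (simp only: mult_1_left)
  qed
  finally show ?thesis by (simp add: P_def N_def \<mu>_def)
qed

text \<open>
  The function $\phi=\frac14 S h - e$ is a subsolution as long as $-S'$ is at most the rate of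
  jumping into the large values of $u$: where $u$ is large, $u$ exceeds $\phi$ by at least
  $1/4$, and this excess arrives at $y$ at that rate. The term $e$ pays for the tail. At the
  final time $S=e=0$, so $\phi\le u$ there; in the first half of the time window $S$ has a
  definite size, because $x_+^2 \ge 2bx-b^2$ turns the averaged hypothesis into a bound for the
  integral of $k$.
\<close>

lemma growth_of_positive_solutions:
  assumes x: "x \<in> gball G v\<^sub>0 (2 * R)" and \<rho>: "\<sigma> \<le> \<rho>" "2 * \<rho> \<le> R"
    and bottom: "cstar c\<^sub>G d * \<sigma> * ln (chain_const\<^sup>2 * \<rho> powr d) powr (5 / \<alpha>) \<le> \<rho>"
    and T: "T = time_const * \<rho> powr \<alpha>"
    and sol: "mild_solution (jump_rate G d \<alpha>) s (s + T) (gball G x \<rho>) (\<lambda>\<tau> y. jump_mean G d \<alpha> y (u \<tau>)) u"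
    and pos: "\<And>\<tau> z. \<tau> \<in> {s..s + T} \<Longrightarrow> z \<in> gball G x (2 * \<rho>) \<Longrightarrow> 0 \<le> u \<tau> z"
    and tail: "\<And>\<tau> y. \<tau> \<in> {s..s + T} \<Longrightarrow> y \<in> gball G x \<rho> \<Longrightarrow>
      (\<Sum>z\<in>gball G x (2 * \<rho>). J y z * u \<tau> z) - \<epsilon> * \<rho> powr (- \<alpha>) \<le> jump_mean G d \<alpha> y (u \<tau>)"
    and eps: "0 \<le> \<epsilon>"
    and half: "(T / 4) * (\<Sum>z\<in>gball G x \<rho>. m z)
      \<le> integral {s + T / 2..s + T} (\<lambda>\<tau>. \<Sum>z\<in>gball G x \<rho>. soft_step (u \<tau> z) * m z)"
    and v: "v \<in> {s..s + T / 2}" and y: "y \<in> gball G x (\<rho> / 16)"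
  shows "growth_const - \<epsilon> \<le> u v y"
proof -
  let ?B = "gball G x \<rho>" and ?D = "gball G x (2 * \<rho>)"
  have xV: "x \<in> V" using x gball_verts by auto
  have \<rho>1: "1 \<le> \<rho>" using \<rho> \<sigma>_ge by simp
  have BD: "?B \<subseteq> ?D" "gball G x (\<rho> / 16) \<subseteq> ?B" using \<rho>1 by (auto simp: gball_def)
  have finB: "finite ?B" "finite ?D" by (rule finite_gball[OF xV])+
  have T_pos: "0 < T" using T time_const_bounds \<rho>1 by simp
  obtain h where h:
    "\<And>y \<tau>. y \<in> ?B \<Longrightarrow> 0 \<le> \<tau> \<Longrightarrow> \<tau> \<le> T \<Longrightarrow>
      \<exists>h'. ((\<lambda>\<tau>. h \<tau> y) has_real_derivative h') (at \<tau>) \<and>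
        (0 < h \<tau> y \<longrightarrow> h' + jump_rate G d \<alpha> y * h \<tau> y \<le> (\<Sum>z\<in>?B. J y z * max 0 (h \<tau> z)))"
    "\<And>y \<tau>. y \<in> ?B \<Longrightarrow> 0 \<le> \<tau> \<Longrightarrow> h \<tau> y \<le> 1"
    "\<And>y \<tau>. y \<in> gball G x (\<rho> / 16) \<Longrightarrow> 0 \<le> \<tau> \<Longrightarrow> \<tau> \<le> T \<Longrightarrow> barrier_const \<le> h \<tau> y"
  proof (rule staying_barrier[OF x \<rho>(2,1) bottom, folded T], goal_cases)
    case (1 h)
    show ?case by (rule 1(1); fact)
  qed
  define hd where "hd = (\<lambda>y \<tau>. SOME h'. ((\<lambda>\<tau>. h \<tau> y) has_real_derivative h') (at \<tau>) \<and>
        (0 < h \<tau> y \<longrightarrow> h' + jump_rate G d \<alpha> y * h \<tau> y \<le> (\<Sum>z\<in>?B. J y z * max 0 (h \<tau> z))))"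
  have hd: "((\<lambda>\<tau>. h \<tau> y) has_real_derivative hd y \<tau>) (at \<tau>)"
    "0 < h \<tau> y \<Longrightarrow> hd y \<tau> + jump_rate G d \<alpha> y * h \<tau> y \<le> (\<Sum>z\<in>?B. J y z * max 0 (h \<tau> z))"
    if "y \<in> ?B" "0 \<le> \<tau>" "\<tau> \<le> T" for y \<tau>
    using someI_ex[OF h(1)[OF that]] unfolding hd_def by blast+
  define \<mu> where "\<mu> = (\<Sum>z\<in>?B. m z)"
  have m_nn: "0 \<le> m z" if "z \<in> ?B" for z using that gball_verts mass_pos by (auto simp: less_imp_le)
  have \<mu>_pos: "0 < \<mu>"
  proof -
    have "m x \<le> \<mu>" unfolding \<mu>_def using finB m_nn gball_center[OF xV] \<rho>1 by (intro member_le_sum) auto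
    thus ?thesis using mass_pos[OF xV] by simp
  qed
  define N where "N = (\<lambda>\<tau>. \<Sum>z\<in>?B. soft_step (u \<tau> z) * m z)"
  define P where "P = (\<lambda>\<tau>. max 0 (N \<tau> / \<mu> - (1 - c\<^sub>0)))"
  define k where "k = (\<lambda>\<tau>. (P \<tau>)\<^sup>2)"
  have cont_u: "continuous_on {s..s + T} (\<lambda>\<tau>. u \<tau> z)" if "z \<in> ?B" for z
    using mild_solution_continuous[OF sol that] .
  have cont_N: "continuous_on {s..s + T} N"
    unfolding N_def soft_step_def using cont_u by (intro continuous_intros) auto
  have cont_k: "continuous_on {s..s + T} k"
    unfolding k_def P_def using \<mu>_pos by (intro continuous_intros cont_N) auto
  have N_bounds: "0 \<le> N \<tau>" "N \<tau> \<le> \<mu>" for \<tau>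
    unfolding N_def \<mu>_def using soft_step_props m_nn
    by (auto intro!: sum_nonneg sum_mono mult_left_le_one_le)
  have k_bounds: "0 \<le> k \<tau>" "k \<tau> \<le> 1" for \<tau>
  proof -
    have "N \<tau> / \<mu> \<le> 1" using N_bounds \<mu>_pos by (simp add: field_simps)
    hence "P \<tau> \<le> 1" using c0_less c0_gt by (auto simp: P_def)
    thus "0 \<le> k \<tau>" "k \<tau> \<le> 1" unfolding k_def by (auto simp: P_def intro!: power_le_one)
  qed
  have k_int: "k integrable_on {a..b}" "N integrable_on {a..b}" if "s \<le> a" "b \<le> s + T" for a b
    using that by (auto intro!: integrable_continuous_real continuous_on_subset[OF cont_k] continuous_on_subset[OF cont_N])
  define \<kappa> where "\<kappa> = gain * \<rho> powr (- \<alpha>)"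
  have kap: "0 < \<kappa>" "\<kappa> * T \<le> 1" "\<kappa> * T = gain * time_const"
  proof -
    show "0 < \<kappa>" using gain_bounds \<rho>1 by (simp add: \<kappa>_def)
    show *: "\<kappa> * T = gain * time_const" using \<rho>1 by (simp add: \<kappa>_def T powr_minus)
    show "\<kappa> * T \<le> 1" unfolding * using gain_bounds time_const_bounds by (intro mult_le_one) auto
  qed
  define S where "S = (\<lambda>\<tau>. \<kappa> * integral {\<tau>..s + T} k)"
  have S_deriv: "(S has_real_derivative - (\<kappa> * k \<tau>)) (at \<tau> within {s..s + T})" if "\<tau> \<in> {s..s + T}" for \<tau>
    unfolding S_def using DERIV_cmult[OF integral_has_real_derivative'[OF cont_k that], of \<kappa>] by simp
  have S_nonneg: "0 \<le> S \<tau>" if "\<tau> \<in> {s..s + T}" for \<tau>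
    unfolding S_def using kap k_bounds by (intro mult_nonneg_nonneg Henstock_Kurzweil_Integration.integral_nonneg k_int) (use that in auto)
  have S_le: "S \<tau> \<le> 1" if tau: "\<tau> \<in> {s..s + T}" for \<tau>
  proof -
    have "integral {\<tau>..s + T} k \<le> integral {\<tau>..s + T} (\<lambda>_. 1)"
      using tau k_bounds by (intro integral_le k_int) auto
    also have "\<dots> \<le> T" using tau by simp
    finally have "S \<tau> \<le> \<kappa> * T" unfolding S_def using kap by (intro mult_left_mono) auto
    thus ?thesis using kap by simp
  qed
  define b where "b = c\<^sub>0 - 1 / 2"
  have b: "0 < b" using c0_gt by (simp add: b_def)
  have S_half: "gain * time_const * b\<^sup>2 / 2 \<le> S \<tau>" if tau: "\<tau> \<in> {s..s + T / 2}" for \<tau>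
  proof -
    let ?I = "{s + T / 2..s + T}"
    have "2 * b * (T / 4) - (2 * b * (1 - c\<^sub>0) + b\<^sup>2) * (T / 2)
        \<le> 2 * b / \<mu> * integral ?I N - (2 * b * (1 - c\<^sub>0) + b\<^sup>2) * (T / 2)"
      using half b \<mu>_pos T_pos by (simp add: N_def[symmetric] \<mu>_def[symmetric] field_simps)
    also have "\<dots> \<le> integral ?I k"
    proof (rule has_integral_le)
      have I: "s \<le> s + T / 2" "s + T / 2 \<le> s + T" using T_pos by auto
      show "(k has_integral integral ?I k) ?I" using I by (intro integrable_integral k_int) auto
      have hN: "(N has_integral integral ?I N) ?I" using I by (intro integrable_integral k_int) auto
      have "((\<lambda>_. 2 * b * (1 - c\<^sub>0) + b\<^sup>2) has_integral (2 * b * (1 - c\<^sub>0) + b\<^sup>2) * (T / 2)) ?I"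
        using has_integral_const_real[of "2 * b * (1 - c\<^sub>0) + b\<^sup>2" "s + T / 2" "s + T"] I
        by (simp add: mult.commute)
      thus "((\<lambda>\<tau>. 2 * b / \<mu> * N \<tau> - (2 * b * (1 - c\<^sub>0) + b\<^sup>2)) has_integral
          (2 * b / \<mu> * integral ?I N - (2 * b * (1 - c\<^sub>0) + b\<^sup>2) * (T / 2))) ?I"
        by (intro has_integral_diff has_integral_mult_right hN)
    next
      fix \<tau>
      (* The square is bounded below by its tangent at b, which is linear in N. *)
      have "0 \<le> (P \<tau> - b)\<^sup>2" by simp
      hence "2 * b * P \<tau> - b\<^sup>2 \<le> k \<tau>" by (simp add: k_def power2_eq_square algebra_simps)
      moreover have "2 * b * (N \<tau> / \<mu> - (1 - c\<^sub>0)) \<le> 2 * b * P \<tau>"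
        using b by (intro mult_left_mono) (auto simp: P_def)
      ultimately show "2 * b / \<mu> * N \<tau> - (2 * b * (1 - c\<^sub>0) + b\<^sup>2) \<le> k \<tau>"
        by (simp add: algebra_simps)
    qed
    also have "\<dots> \<le> integral {\<tau>..s + T} k"
      using tau T_pos k_bounds by (intro integral_subset_le k_int) auto
    finally have "2 * b * (T / 4) - (2 * b * (1 - c\<^sub>0) + b\<^sup>2) * (T / 2) \<le> integral {\<tau>..s + T} k" .
    moreover have "2 * b * (T / 4) - (2 * b * (1 - c\<^sub>0) + b\<^sup>2) * (T / 2) = b\<^sup>2 * T / 2"
      by (simp add: b_def power2_eq_square field_simps)
    ultimately have "\<kappa> * (b\<^sup>2 * T / 2) \<le> S \<tau>" unfolding S_def using kap by (intro mult_left_mono) auto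
    moreover have "\<kappa> * (b\<^sup>2 * T / 2) = (\<kappa> * T) * b\<^sup>2 / 2" by simp
    ultimately show ?thesis by (simp only: kap(3))
  qed
  define e where "e = (\<lambda>\<tau>. \<epsilon> * \<rho> powr (- \<alpha>) * (s + T - \<tau>))"
  define \<phi> where "\<phi> = (\<lambda>\<tau> y. S \<tau> * h (s + T - \<tau>) y / 4 - e \<tau>)"
  define \<phi>' where "\<phi>' = (\<lambda>\<tau> y. (- (\<kappa> * k \<tau>) * h (s + T - \<tau>) y - S \<tau> * hd y (s + T - \<tau>)) / 4 + \<epsilon> * \<rho> powr (- \<alpha>))"
  have e_nn: "0 \<le> e \<tau>" if "\<tau> \<in> {s..s + T}" for \<tau> using that eps by (simp add: e_def)
  have "\<phi> v y \<le> u v y"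
  proof (rule comparison_principle[OF finB(1) jump_rate_nonneg[OF gball_verts] sol, where \<phi>=\<phi> and \<phi>'=\<phi>'])
    fix y \<tau> assume y: "y \<in> ?B" and tau: "\<tau> \<in> {s..s + T}"
    have "((\<lambda>\<tau>. h (s + T - \<tau>) y) has_real_derivative hd y (s + T - \<tau>) * (0 - 1)) (at \<tau> within {s..s + T})"
      by (rule DERIV_chain2[OF hd(1)[OF y]]) (use tau in \<open>auto intro!: derivative_eq_intros\<close>)
    note dh = this
    show "((\<lambda>\<tau>. \<phi> \<tau> y) has_real_derivative \<phi>' \<tau> y) (at \<tau> within {s..s + T})"
    proof -
      have de: "(e has_real_derivative - (\<epsilon> * \<rho> powr (- \<alpha>))) (at \<tau> within {s..s + T})"
        unfolding e_def by (auto intro!: derivative_eq_intros)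
      show ?thesis unfolding \<phi>_def \<phi>'_def
        by (rule DERIV_cong[OF DERIV_diff[OF DERIV_cdivide[OF DERIV_mult[OF S_deriv[OF tau] dh]] de]]) simp
    qed
  next
    fix y \<tau> and M :: real
    assume y: "y \<in> ?B" and tau: "\<tau> \<in> {s..s + T}" and M: "0 \<le> M"
      and le: "\<And>z. z \<in> ?B \<Longrightarrow> \<phi> \<tau> z \<le> u \<tau> z + M" and less: "u \<tau> y < \<phi> \<tau> y"
    let ?c = "jump_rate G d \<alpha> y" and ?h = "h (s + T - \<tau>)" and ?S = "S \<tau>"
    have yV: "y \<in> V" using y gball_verts by auto
    have tt: "0 \<le> s + T - \<tau>" "s + T - \<tau> \<le> T" using tau by auto
    have c: "0 \<le> ?c" by (rule jump_rate_nonneg[OF yV])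
    have S: "0 \<le> ?S" "?S \<le> 1" using S_nonneg[OF tau] S_le[OF tau] by auto
    have h_pos: "0 < ?h y"
    proof (rule ccontr)
      assume "\<not> 0 < ?h y"
      hence "?S * ?h y \<le> 0" using S by (intro mult_nonneg_nonpos) auto
      hence "\<phi> \<tau> y \<le> 0" using e_nn[OF tau] by (simp add: \<phi>_def)
      thus False using less pos[OF tau, of y] y BD by auto
    qed
    have Jn: "0 \<le> J y z" if "z \<in> ?D" for z using J_nonneg[OF yV gball_verts[OF that]] .
    (* If u is at most 1/2 the soft step vanishes and this is the bound by the maximum M,
       otherwise both quarters together are at most 1/2. *)
    have pt: "?S * max 0 (?h z) / 4 - e \<tau> + soft_step (u \<tau> z) / 4 \<le> u \<tau> z + M" if z: "z \<in> ?B" for z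
    proof -
      have uz: "0 \<le> u \<tau> z" using pos[OF tau] z BD by auto
      have "?S * max 0 (?h z) \<le> 1" using S h(2)[OF z tt(1)] by (intro mult_le_one) auto
      show ?thesis
      proof (cases "u \<tau> z \<le> 1 / 2")
        case True
        show ?thesis
        proof (cases "0 < ?h z")
          case True
          thus ?thesis using le[OF z] soft_step_props(3)[OF \<open>u \<tau> z \<le> 1 / 2\<close>] by (simp add: \<phi>_def)
        next
          case False
          thus ?thesis using soft_step_props(3)[OF \<open>u \<tau> z \<le> 1 / 2\<close>] uz M e_nn[OF tau] by simp
        qed
      next
        case False
        thus ?thesis using \<open>?S * max 0 (?h z) \<le> 1\<close> soft_step_props(2)[of "u \<tau> z"] M e_nn[OF tau] by linarith
      qed
    qed
    have sumJ: "(\<Sum>z\<in>?B. J y z) \<le> ?c" by (rule sum_J_le_rate[OF yV finB(1) gball_subset_verts])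
    have "\<kappa> * k \<tau> / 4 \<le> (\<Sum>z\<in>?B. J y z * soft_step (u \<tau> z)) / 4"
    proof -
      have "\<kappa> * k \<tau> \<le> jump_in_const * \<rho> powr (- \<alpha>) * k \<tau>"
        unfolding \<kappa>_def using gain_bounds k_bounds by (intro mult_right_mono) auto
      also have "\<dots> \<le> (\<Sum>z\<in>?B. J y z * soft_step (u \<tau> z))"
        unfolding k_def P_def N_def \<mu>_def by (rule jump_rate_into_dense_set[OF x \<rho> y]) (auto simp: soft_step_props)
      finally show ?thesis by simp
    qed
    moreover have "?S / 4 * (hd y (s + T - \<tau>) + ?c * ?h y) \<le> ?S / 4 * (\<Sum>z\<in>?B. J y z * max 0 (?h z))"
      using S by (intro mult_left_mono hd(2)[OF y tt h_pos]) auto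
    moreover have "\<kappa> * k \<tau> * ?h y \<le> \<kappa> * k \<tau> * 1"
      using kap k_bounds h(2)[OF y tt(1)] by (intro mult_left_mono) auto
    moreover have "?S / 4 * (\<Sum>z\<in>?B. J y z * max 0 (?h z)) + (\<Sum>z\<in>?B. J y z * soft_step (u \<tau> z)) / 4
        \<le> (\<Sum>z\<in>?D. J y z * u \<tau> z) + ?c * M + ?c * e \<tau>"
    proof -
      have "?S / 4 * (\<Sum>z\<in>?B. J y z * max 0 (?h z)) + (\<Sum>z\<in>?B. J y z * soft_step (u \<tau> z)) / 4
          = (\<Sum>z\<in>?B. J y z * (?S * max 0 (?h z) / 4 + soft_step (u \<tau> z) / 4))"
        by (simp add: sum_distrib_left sum_divide_distrib sum.distrib distrib_left mult_ac)
      also have "\<dots> \<le> (\<Sum>z\<in>?B. J y z * (u \<tau> z + (M + e \<tau>)))"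
        using pt Jn BD by (intro sum_mono mult_left_mono) (auto simp: algebra_simps)
      also have "\<dots> = (\<Sum>z\<in>?B. J y z * u \<tau> z) + (\<Sum>z\<in>?B. J y z) * (M + e \<tau>)"
        by (simp add: distrib_left sum.distrib sum_distrib_right)
      also have "\<dots> \<le> (\<Sum>z\<in>?D. J y z * u \<tau> z) + ?c * (M + e \<tau>)"
      proof (intro add_mono mult_right_mono sum_mono2)
        fix z assume "z \<in> ?D - ?B"
        thus "0 \<le> J y z * u \<tau> z" using Jn[of z] pos[OF tau, of z] by (intro mult_nonneg_nonneg[of "J y z"]) auto
      qed (use sumJ M e_nn[OF tau] finB BD in auto)
      finally show ?thesis by (simp add: algebra_simps)
    qed
    moreover have "?c * \<phi> \<tau> y - \<phi>' \<tau> y = ?S / 4 * (hd y (s + T - \<tau>) + ?c * ?h y) + \<kappa> * k \<tau> * ?h y / 4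
        - ?c * e \<tau> - \<epsilon> * \<rho> powr (- \<alpha>)"
      unfolding \<phi>_def \<phi>'_def by (simp add: field_simps)
    ultimately show "?c * \<phi> \<tau> y - \<phi>' \<tau> y \<le> jump_mean G d \<alpha> y (u \<tau>) + ?c * M"
      using tail[OF tau y] by linarith
  next
    fix y assume "y \<in> ?B"
    thus "\<phi> (s + T) y \<le> u (s + T) y"
      using pos[of "s + T" y] BD T_pos by (auto simp: \<phi>_def S_def e_def)
  qed (use v y BD T_pos in auto)
  moreover have "growth_const - \<epsilon> \<le> \<phi> v y"
  proof -
    have vT: "v \<in> {s..s + T}" using v T_pos by auto
    have "gain * time_const * b\<^sup>2 / 2 * barrier_const \<le> S v * h (s + T - v) y"
      using S_half[OF v] h(3)[OF y, of "s + T - v"] vT S_nonneg[OF vT] by (intro mult_mono) (auto simp: barrier_const_def)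
    hence "growth_const \<le> S v * h (s + T - v) y / 4" by (simp add: growth_const_def b_def mult_ac)
    moreover have "e v \<le> \<epsilon>"
    proof -
      have "e v \<le> \<epsilon> * \<rho> powr (- \<alpha>) * T" unfolding e_def using vT eps by (intro mult_left_mono) auto
      also have "\<dots> = \<epsilon> * time_const" using \<rho>1 by (simp add: T powr_minus)
      also have "\<dots> \<le> \<epsilon> * 1" using eps time_const_bounds by (intro mult_left_mono) auto
      finally show ?thesis by simp
    qed
    ultimately show ?thesis by (simp add: \<phi>_def)
  qed
  ultimately show ?thesis by linarith
qed

end

section \<open>Caloric functions are mild solutions\<close>

lemma jump_time_mono: "n \<le> k \<Longrightarrow> jump_time G d \<alpha> x \<omega> n \<le> jump_time G d \<alpha> x \<omega> k"
  unfolding jump_time_def by (intro sum_mono2) auto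

lemma X_path_eq:
  assumes "jump_time G d \<alpha> x \<omega> n \<le> ennreal t" "ennreal t < jump_time G d \<alpha> x \<omega> (Suc n)"
  shows "X_path G d \<alpha> x t \<omega> = Some (visited x \<omega> n)"
proof -
  let ?in = "\<lambda>n. jump_time G d \<alpha> x \<omega> n \<le> ennreal t \<and> ennreal t < jump_time G d \<alpha> x \<omega> (Suc n)"
  have uniq: "k = n" if "?in k" for k
  proof (rule ccontr)
    assume "k \<noteq> n"
    then consider "Suc k \<le> n" | "Suc n \<le> k" by linarith
    thus False
    proof cases
      case 1 thus False using that assms(1) jump_time_mono[OF 1] by (meson leD le_less_trans order_trans)
    next
      case 2 thus False using that assms(2) jump_time_mono[OF 2] by (meson leD less_le_trans order_trans)
    qed
  qed
  have n: "?in n" using assms by (rule conjI)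
  have "(THE n. ?in n) = n" using n uniq by (rule the_equality)
  moreover have "\<exists>n. ?in n" using n by (rule exI)
  ultimately show ?thesis unfolding X_path_def Let_def by (simp only: if_True)
qed

text \<open>
  The exit point from a one-vertex box, for all outcomes with positive holding times. The second
  holding time matters because two simultaneous jumps would hide the first target; if the rate
  is \<open>0\<close> the vertex is absorbing and the box is left through its final time.
\<close>

lemma Z_exit_single_site:
  fixes s a b :: real
  assumes s: "a < s" "s < b"
    and e0: "0 < fst (\<omega> !! 0)" and e1: "0 < fst (\<omega> !! 1)"
    and y: "snd (\<omega> !! 0) x = y" "jump_rate G d \<alpha> x \<noteq> 0 \<Longrightarrow> y \<noteq> x"
    and c: "0 \<le> jump_rate G d \<alpha> x"
  defines "c \<equiv> jump_rate G d \<alpha> x"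
  shows "Z_path G d \<alpha> (s, x) (enn2real (Z_exit_time G d \<alpha> (s, x) ({a<..<b} \<times> {x}) \<omega>)) \<omega>
    = (if c \<noteq> 0 \<and> fst (\<omega> !! 0) / c \<le> b - s then (s + fst (\<omega> !! 0) / c, Some y) else (b, Some x))"
proof -
  let ?T = "jump_time G d \<alpha> x \<omega>"
  let ?A = "{a<..<b} \<times> {x}"
  define t1 where "t1 = fst (\<omega> !! 0) / c"
  have T0: "?T 0 = 0" by (simp add: jump_time_def)
  have T1: "?T (Suc 0) = (if c = 0 then \<infinity> else ennreal t1)"
    using e0 c unfolding jump_time_def c_def[symmetric] t1_def
    by (auto simp: divide_ennreal ennreal_divide_eq_top_iff c_def[symmetric] less_le)
  have T2: "?T (Suc 0) < ?T (Suc (Suc 0))" if "c \<noteq> 0"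
  proof -
    have "?T (Suc (Suc 0)) = ?T (Suc 0) + ennreal (fst (\<omega> !! 1)) / ennreal (jump_rate G d \<alpha> (visited x \<omega> 1))"
      by (simp add: jump_time_def)
    moreover have "0 < ennreal (fst (\<omega> !! 1)) / ennreal (jump_rate G d \<alpha> (visited x \<omega> 1))"
      using e1 by (simp add: ennreal_zero_less_divide)
    ultimately show ?thesis
      using T1 that ennreal_add_left_cancel_less[of "ennreal t1" 0] by simp
  qed
  have before: "X_path G d \<alpha> x t \<omega> = Some x" if "0 \<le> t" "ennreal t < ?T (Suc 0)" for t
    using X_path_eq[of G d \<alpha> x \<omega> 0 t] that T0 by simp
  have at1: "X_path G d \<alpha> x t1 \<omega> = Some y" if "c \<noteq> 0"
    using X_path_eq[of G d \<alpha> x \<omega> 1 t1] T1 T2[OF that] that y by (simp add: One_nat_def)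
  define L where "L = min (?T (Suc 0)) (ennreal (b - s))"
  have late: "ennreal (b - s) < ?T (Suc 0)" if "\<not> (c \<noteq> 0 \<and> t1 \<le> b - s)"
    using that T1 s by (auto simp: ennreal_less_iff)
  let ?E = "{ennreal t |t. 0 < t \<and> Z_path G d \<alpha> (s, x) t \<omega> \<notin> map_prod id Some ` ?A}"
  have lower: "L \<le> e" if mem: "e \<in> ?E" for e
  proof (rule ccontr)
    obtain t where t: "e = ennreal t" "0 < t" "Z_path G d \<alpha> (s, x) t \<omega> \<notin> map_prod id Some ` ?A" using mem by auto
    assume "\<not> L \<le> e"
    hence "ennreal t < ?T (Suc 0)" "t < b - s" using t s by (auto simp: L_def not_le ennreal_less_iff)
    hence "Z_path G d \<alpha> (s, x) t \<omega> = map_prod id Some (s + t, x)" "(s + t, x) \<in> ?A"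
      using before[of t] t s by (auto simp: Z_path_def)
    thus False using t by blast
  qed
  have Z: "Z_exit_time G d \<alpha> (s, x) ?A \<omega> = L"
    unfolding Z_exit_time_def
  proof (rule antisym)
    show "L \<le> Inf ?E" using lower by (rule Inf_greatest)
    show "Inf ?E \<le> L"
    proof (cases "c \<noteq> 0 \<and> t1 \<le> b - s")
      case True
      have "0 < t1" using True e0 c by (auto simp: t1_def c_def)
      moreover have "Z_path G d \<alpha> (s, x) t1 \<omega> \<notin> map_prod id Some ` ?A"
        using at1 True y(2) by (auto simp: Z_path_def c_def)
      ultimately have "ennreal t1 \<in> ?E" by blast
      moreover have "L = ennreal t1" using True T1 by (simp add: L_def min_def ennreal_leI)
      ultimately show ?thesis by (metis (no_types, lifting) Inf_lower)
    next
      case False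
      have "Z_path G d \<alpha> (s, x) (b - s) \<omega> \<notin> map_prod id Some ` ?A" by (auto simp: Z_path_def)
      hence "ennreal (b - s) \<in> ?E" using s by force
      moreover have "L = ennreal (b - s)" using late[OF False] by (simp add: L_def min_absorb2 less_imp_le)
      ultimately show ?thesis by (metis (no_types, lifting) Inf_lower)
    qed
  qed
  show ?thesis
  proof (cases "c \<noteq> 0 \<and> t1 \<le> b - s")
    case True
    have "0 < t1" using True e0 c by (auto simp: t1_def c_def)
    hence "enn2real L = t1" using True T1 by (simp add: L_def min_def ennreal_leI)
    thus ?thesis using Z True at1 by (simp add: Z_path_def t1_def)
  next
    case False
    have L: "L = ennreal (b - s)" using late[OF False] by (simp add: L_def min_absorb2 less_imp_le)
    have "X_path G d \<alpha> x (b - s) \<omega> = Some x" using before[of "b - s"] late[OF False] s by simp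
    thus ?thesis using Z L s False by (auto simp: Z_path_def t1_def)
  qed
qed

context stable_graph
begin

abbreviation "exp_law \<equiv> density lborel (exponential_density 1)"

lemma prob_exp_law: "prob_space exp_law"
  by (rule prob_space_exponential_density) simp

lemma prob_step_law: "prob_space (step_law G d \<alpha>)"
proof -
  interpret E: prob_space exp_law by (rule prob_exp_law)
  interpret Q: prob_space "\<Pi>\<^sub>M z\<in>V. measure_pmf (jump_pmf G d \<alpha> z)"
    by (rule prob_space_PiM) (rule prob_space_measure_pmf)
  interpret pair_prob_space exp_law "\<Pi>\<^sub>M z\<in>V. measure_pmf (jump_pmf G d \<alpha> z)" ..
  show ?thesis unfolding step_law_def by (rule prob_space_axioms)
qed

lemma first_step_law:
  assumes x: "x \<in> V"
  defines "N \<equiv> exp_law \<Otimes>\<^sub>M measure_pmf (jump_pmf G d \<alpha> x)"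
  shows "(\<lambda>\<omega>. (fst (\<omega> !! 0), snd (\<omega> !! 0) x)) \<in> measurable (path_law G d \<alpha>) N"
    and "distr (path_law G d \<alpha>) N (\<lambda>\<omega>. (fst (\<omega> !! 0), snd (\<omega> !! 0) x)) = N"
proof -
  let ?S = "step_law G d \<alpha>" and ?P = "path_law G d \<alpha>"
  let ?Q = "\<Pi>\<^sub>M z\<in>V. measure_pmf (jump_pmf G d \<alpha> z)"
  let ?p = "measure_pmf (jump_pmf G d \<alpha> x)"
  interpret S: prob_space ?S by (rule prob_step_law)
  interpret P: prob_space ?P unfolding path_law_def by (rule S.prob_space_stream_space)
  define g where "g = (\<lambda>(e :: real, f :: 'a \<Rightarrow> 'a). (e, f x))"
  have comp: "(\<lambda>f. f x) \<in> measurable ?Q ?p" by (rule measurable_component_singleton[OF x])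
  have g: "g \<in> measurable ?S N"
    unfolding g_def N_def step_law_def case_prod_beta
    by (intro measurable_Pair measurable_fst measurable_compose[OF measurable_snd comp])
  have snth: "(\<lambda>\<omega>. \<omega> !! 0) \<in> measurable ?P ?S" unfolding path_law_def by (rule measurable_snth)
  have eq: "(\<lambda>\<omega>. (fst (\<omega> !! 0), snd (\<omega> !! 0) x)) = (\<lambda>\<omega>. g (\<omega> !! 0))"
    by (auto simp: g_def case_prod_beta)
  show m: "(\<lambda>\<omega>. (fst (\<omega> !! 0), snd (\<omega> !! 0) x)) \<in> measurable ?P N"
    unfolding eq by (rule measurable_compose[OF snth g])
  have d1: "distr ?P ?S (\<lambda>\<omega>. \<omega> !! 0) = ?S"
  proof (rule measure_eqI)
    fix A assume "A \<in> sets (distr ?P ?S (\<lambda>\<omega>. \<omega> !! 0))"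
    hence A: "A \<in> sets ?S" by simp
    have pre: "(\<lambda>\<omega>. \<omega> !! 0) -` A \<inter> space ?P \<in> sets (stream_space ?S)"
      using measurable_sets[OF snth A] by (simp add: path_law_def)
    have "emeasure (distr ?P ?S (\<lambda>\<omega>. \<omega> !! 0)) A = emeasure (stream_space ?S) ((\<lambda>\<omega>. \<omega> !! 0) -` A \<inter> space ?P)"
      using emeasure_distr[OF snth A] by (simp add: path_law_def)
    also have "\<dots> = (\<integral>\<^sup>+ t. emeasure (stream_space ?S) {\<omega> \<in> space (stream_space ?S). t ## \<omega> \<in> (\<lambda>\<omega>. \<omega> !! 0) -` A \<inter> space ?P} \<partial>?S)"
      by (rule S.emeasure_stream_space[OF pre])
    also have "\<dots> = (\<integral>\<^sup>+ t. indicator A t \<partial>?S)"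
    proof (rule nn_integral_cong)
      fix t assume t: "t \<in> space ?S"
      have "{\<omega> \<in> space (stream_space ?S). t ## \<omega> \<in> (\<lambda>\<omega>. \<omega> !! 0) -` A \<inter> space ?P}
          = (if t \<in> A then space (stream_space ?S) else {})"
        using t by (auto simp: path_law_def space_stream_space)
      thus "emeasure (stream_space ?S) {\<omega> \<in> space (stream_space ?S). t ## \<omega> \<in> (\<lambda>\<omega>. \<omega> !! 0) -` A \<inter> space ?P}
          = indicator A t"
        using P.emeasure_space_1 by (simp add: path_law_def)
    qed
    also have "\<dots> = emeasure ?S A" using A by simp
    finally show "emeasure (distr ?P ?S (\<lambda>\<omega>. \<omega> !! 0)) A = emeasure ?S A" .
  qed simp
  have d2: "distr ?S N g = N"
  proof -
    have dp: "distr ?Q ?p (\<lambda>f. f x) = ?p" by (rule distr_PiM_component[OF _ x]) (rule prob_space_measure_pmf)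
    have "sigma_finite_measure (distr ?Q ?p (\<lambda>f. f x))"
      unfolding dp by (rule prob_space_imp_sigma_finite[OF prob_space_measure_pmf])
    from pair_measure_distr[OF measurable_ident comp this, of exp_law]
    show ?thesis unfolding dp by (simp add: N_def g_def step_law_def id_def)
  qed
  have "distr ?P N (\<lambda>\<omega>. g (\<omega> !! 0)) = distr (distr ?P ?S (\<lambda>\<omega>. \<omega> !! 0)) N g"
    by (subst distr_distr[OF g snth]) (simp only: o_def)
  thus "distr ?P N (\<lambda>\<omega>. (fst (\<omega> !! 0), snd (\<omega> !! 0) x)) = N" unfolding eq d1 d2 .
qed

lemma AE_exp_law_pos: "AE e in exp_law. 0 < e"
proof -
  have "AE e in lborel. e \<noteq> (0::real)" by (rule AE_lborel_singleton)
  thus ?thesis by (subst AE_density) (auto simp: exponential_density_def elim!: eventually_mono)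
qed

lemma AE_path_steps:
  assumes x: "x \<in> V"
  shows "AE \<omega> in path_law G d \<alpha>. 0 < fst (\<omega> !! 0) \<and> 0 < fst (\<omega> !! 1) \<and> snd (\<omega> !! 0) x \<in> set_pmf (jump_pmf G d \<alpha> x)"
proof -
  let ?S = "step_law G d \<alpha>"
  let ?Q = "\<Pi>\<^sub>M z\<in>V. measure_pmf (jump_pmf G d \<alpha> z)"
  interpret S: prob_space ?S by (rule prob_step_law)
  interpret E: prob_space exp_law by (rule prob_exp_law)
  interpret Q: prob_space ?Q by (rule prob_space_PiM) (rule prob_space_measure_pmf)
  interpret EQ: pair_prob_space exp_law ?Q ..
  have "measurable ?S exp_law = borel_measurable ?S" by (rule measurable_cong_sets) simp_all
  moreover have "fst \<in> measurable ?S exp_law" unfolding step_law_def by (rule measurable_fst)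
  ultimately have fst_m: "fst \<in> borel_measurable ?S" by (simp only:)
  have x_m: "(\<lambda>s. snd s x) \<in> measurable ?S (measure_pmf (jump_pmf G d \<alpha> x))"
    unfolding step_law_def by (rule measurable_compose[OF measurable_snd measurable_component_singleton[OF x]])
  have pred: "Measurable.pred ?S (\<lambda>s. 0 < fst s \<and> snd s x \<in> set_pmf (jump_pmf G d \<alpha> x))"
  proof (intro pred_intros_logic)
    show "Measurable.pred ?S (\<lambda>s. 0 < fst s)" using fst_m by measurable
    show "Measurable.pred ?S (\<lambda>s. snd s x \<in> set_pmf (jump_pmf G d \<alpha> x))" using x_m by (rule pred_sets2[rotated]) simp
  qed
  have "AE s in ?S. 0 < fst s \<and> snd s x \<in> set_pmf (jump_pmf G d \<alpha> x)"
    unfolding step_law_def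
  proof (rule EQ.AE_pair_measure)
    show "{s \<in> space (exp_law \<Otimes>\<^sub>M ?Q). 0 < fst s \<and> snd s x \<in> set_pmf (jump_pmf G d \<alpha> x)} \<in> sets (exp_law \<Otimes>\<^sub>M ?Q)"
      using pred unfolding step_law_def pred_def .
    have "AE f in ?Q. f x \<in> set_pmf (jump_pmf G d \<alpha> x)"
      by (rule AE_PiM_component[OF prob_space_measure_pmf x]) (simp add: AE_measure_pmf)
    thus "AE e in exp_law. AE f in ?Q. 0 < fst (e, f) \<and> snd (e, f) x \<in> set_pmf (jump_pmf G d \<alpha> x)"
      using AE_exp_law_pos by (auto elim!: eventually_mono)
  qed
  from S.AE_stream_all[OF pred this] show ?thesis
    unfolding path_law_def stream_all_def by (rule eventually_mono) blast
qed

lemma caloric_single_site_expectation: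
  assumes q: "caloric G d \<alpha> A q" and x: "x \<in> V" and s: "0 \<le> a" "a < s" "s < b"
    and sub: "{a..b} \<times> {x} \<subseteq> A"
  defines "c \<equiv> jump_rate G d \<alpha> x"
  defines "\<Psi> \<equiv> \<lambda>(e, y). if c \<noteq> 0 \<and> e / c \<le> b - s then q (max 0 (s + e / c), if y \<in> V then y else x) else q (b, x)"
  shows "integrable (exp_law \<Otimes>\<^sub>M measure_pmf (jump_pmf G d \<alpha> x)) \<Psi>"
    and "q (s, x) = integral\<^sup>L (exp_law \<Otimes>\<^sub>M measure_pmf (jump_pmf G d \<alpha> x)) \<Psi>"
proof -
  let ?P = "path_law G d \<alpha>" and ?p = "measure_pmf (jump_pmf G d \<alpha> x)"
  let ?N = "exp_law \<Otimes>\<^sub>M ?p"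
  let ?A = "{a<..<b} \<times> {x}" and ?X = "spacetime_topology G"
  have c: "0 \<le> c" unfolding c_def by (rule jump_rate_nonneg[OF x])
  have op: "openin ?X ?A"
  proof -
    have "{a<..<b} = {0..} \<inter> {a<..<b}" using s by auto
    hence "openin (top_of_set {0..}) {a<..<b}" by (metis openin_open_Int open_greaterThanLessThan)
    thus ?thesis unfolding spacetime_topology_def using x by (simp add: openin_prod_Times_iff)
  qed
  have cl: "?X closure_of ?A = {a..b} \<times> {x}"
  proof -
    have "{a<..<b} = {0..} \<inter> {a<..<b}" using s by auto
    hence "top_of_set {0..} closure_of {a<..<b} = {0..} \<inter> closure {a<..<b}"
      by (metis closure_of_subtopology_open closure_of_subtopology euclidean_closure_of inf.absorb_iff2 inf_le1)
    also have "\<dots> = {a..b}" using s by auto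
    finally have "top_of_set {0..} closure_of {a<..<b} = {a..b}" .
    moreover have "discrete_topology V closure_of {x} = {x}" using x by (simp add: discrete_topology_closure_of)
    ultimately show ?thesis unfolding spacetime_topology_def by (simp add: closure_of_Times)
  qed
  have cpt: "compactin ?X ({a..b} \<times> {x})"
  proof -
    have "compactin (top_of_set {0..}) {a..b}" using s by (auto simp: compactin_subtopology)
    moreover have "compactin (discrete_topology V) {x}" using x by (simp add: compactin_discrete_topology)
    ultimately show ?thesis unfolding spacetime_topology_def by (simp add: compactin_Times)
  qed
  define Zx where "Zx = (\<lambda>\<omega>. Z_path G d \<alpha> (s, x) (enn2real (Z_exit_time G d \<alpha> (s, x) ?A \<omega>)) \<omega>)"
  have "(s, x) \<in> ?A" using s by auto
  hence int: "integrable ?P (\<lambda>\<omega>. extend_cemetery q (Zx \<omega>))"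
    and val: "q (s, x) = (\<integral>\<omega>. extend_cemetery q (Zx \<omega>) \<partial>?P)"
    and qm: "q \<in> borel_measurable (spacetime_algebra G)"
    using q op cl cpt sub unfolding caloric_def Let_def Zx_def by auto
  define D where "D = (\<lambda>\<omega> :: 'a outcome. (fst (\<omega> !! 0), snd (\<omega> !! 0) x))"
  have AE: "AE \<omega> in ?P. extend_cemetery q (Zx \<omega>) = \<Psi> (D \<omega>)"
    using AE_path_steps[OF x]
  proof (rule eventually_mono)
    fix \<omega> :: "'a outcome"
    assume w: "0 < fst (\<omega> !! 0) \<and> 0 < fst (\<omega> !! 1) \<and> snd (\<omega> !! 0) x \<in> set_pmf (jump_pmf G d \<alpha> x)"
    define y where "y = snd (\<omega> !! 0) x"
    have yV: "y \<in> V" using w set_jump_pmf[OF x] by (auto simp: y_def)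
    have "Zx \<omega> = (if c \<noteq> 0 \<and> fst (\<omega> !! 0) / c \<le> b - s then (s + fst (\<omega> !! 0) / c, Some y) else (b, Some x))"
      unfolding Zx_def c_def using s w jump_rate_nonneg[OF x] not_in_set_jump_pmf[OF x]
      by (intro Z_exit_single_site) (auto simp: y_def)
    moreover have "0 \<le> s + fst (\<omega> !! 0) / c" using s w c by (intro add_nonneg_nonneg divide_nonneg_nonneg) auto
    ultimately show "extend_cemetery q (Zx \<omega>) = \<Psi> (D \<omega>)"
      using yV by (simp add: \<Psi>_def D_def y_def extend_cemetery_def)
  qed
  have Dm: "D \<in> measurable ?P ?N" unfolding D_def by (rule first_step_law(1)[OF x])
  have Dd: "distr ?P ?N D = ?N" unfolding D_def by (rule first_step_law(2)[OF x])
  have \<Psi>m: "\<Psi> \<in> borel_measurable ?N"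
  proof -
    have f: "fst \<in> borel_measurable ?N"
    proof -
      have "measurable ?N exp_law = borel_measurable ?N" by (rule measurable_cong_sets) simp_all
      thus ?thesis using measurable_fst[of exp_law ?p] by simp
    qed
    have "(\<lambda>s'. max 0 (s + fst s' / c)) \<in> measurable ?N (restrict_space borel {0..})"
      by (rule measurable_restrict_space2) (use f in \<open>auto intro!: borel_measurable_max borel_measurable_add borel_measurable_divide\<close>)
    moreover have "(\<lambda>s'. if snd s' \<in> V then snd s' else x) \<in> measurable ?N (count_space V)"
      by (rule measurable_compose[OF measurable_snd]) (use x in auto)
    ultimately have "(\<lambda>s'. (max 0 (s + fst s' / c), if snd s' \<in> V then snd s' else x)) \<in> measurable ?N (spacetime_algebra G)"
      unfolding spacetime_algebra_def by (rule measurable_Pair)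
    from measurable_compose[OF this qm]
    have "(\<lambda>s'. q (max 0 (s + fst s' / c), if snd s' \<in> V then snd s' else x)) \<in> borel_measurable ?N" .
    thus ?thesis unfolding \<Psi>_def case_prod_beta using f by measurable
  qed
  have int': "integrable ?P (\<lambda>\<omega>. \<Psi> (D \<omega>))"
  proof -
    have "(\<lambda>\<omega>. \<Psi> (D \<omega>)) \<in> borel_measurable ?P" by (rule measurable_compose[OF Dm \<Psi>m])
    from integrable_cong_AE[OF borel_measurable_integrable[OF int] this AE] int show ?thesis by blast
  qed
  have "integrable (distr ?P ?N D) \<Psi>" using int' by (subst integrable_distr_eq[OF Dm \<Psi>m])
  thus "integrable ?N \<Psi>" by (simp only: Dd)
  have "q (s, x) = (\<integral>\<omega>. \<Psi> (D \<omega>) \<partial>?P)"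
    unfolding val using int int' AE by (intro integral_cong_AE) (auto intro: borel_measurable_integrable)
  also have "\<dots> = integral\<^sup>L (distr ?P ?N D) \<Psi>" by (rule integral_distr[OF Dm \<Psi>m, symmetric])
  finally show "q (s, x) = integral\<^sup>L ?N \<Psi>" by (simp only: Dd)
qed

text \<open>
  Rescaling the standard exponential holding time by the jump rate turns the expectation over
  the first step into an integral over the time of the first jump.
\<close>

lemma caloric_mean_value:
  assumes q: "caloric G d \<alpha> A q" and x: "x \<in> V" and s: "0 \<le> a" "a < s" "s < b"
    and sub: "{a..b} \<times> {x} \<subseteq> A"
  defines "c \<equiv> jump_rate G d \<alpha> x"
  shows "((\<lambda>\<tau>. exp (- c * (\<tau> - s)) * jump_mean G d \<alpha> x (\<lambda>y. q (\<tau>, y))) has_integral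
      (q (s, x) - exp (- c * (b - s)) * q (b, x))) {s..b}"
proof -
  let ?p = "measure_pmf (jump_pmf G d \<alpha> x)"
  let ?\<kappa> = "\<lambda>y. if y \<in> V then y else x"
  define \<Psi> where "\<Psi> = (\<lambda>(e, y). if c \<noteq> 0 \<and> e / c \<le> b - s then q (max 0 (s + e / c), ?\<kappa> y) else q (b, x))"
  have int: "integrable (exp_law \<Otimes>\<^sub>M ?p) \<Psi>" and val: "q (s, x) = integral\<^sup>L (exp_law \<Otimes>\<^sub>M ?p) \<Psi>"
    unfolding \<Psi>_def c_def by (rule caloric_single_site_expectation[OF q x s sub])+
  interpret E: prob_space exp_law by (rule prob_exp_law)
  interpret p: prob_space ?p by (rule prob_space_measure_pmf)
  interpret pair_prob_space exp_law ?p ..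
  show ?thesis
  proof (cases "c = 0")
    case True
    have "\<Psi> = (\<lambda>_. q (b, x))" using True by (auto simp: \<Psi>_def)
    hence "q (s, x) = q (b, x)" using val by (simp add: prob_space)
    thus ?thesis using True by (simp add: jump_mean_def c_def[symmetric])
  next
    case False
    hence c: "0 < c" using jump_rate_nonneg[OF x] by (simp add: c_def)
    define L where "L = c * (b - s)"
    have L: "0 < L" using c s by (simp add: L_def)
    have eL: "e / c \<le> b - s \<longleftrightarrow> e \<le> L" for e using c by (simp add: L_def field_simps)
    define g where "g = (\<lambda>\<tau>. measure_pmf.expectation (jump_pmf G d \<alpha> x) (\<lambda>y. q (\<tau>, y)))"
    have g_eq: "measure_pmf.expectation (jump_pmf G d \<alpha> x) (\<lambda>y. q (\<tau>, ?\<kappa> y)) = g \<tau>" for \<tau>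
      unfolding g_def using set_jump_pmf[OF x]
      by (intro integral_cong_AE) (auto simp: AE_measure_pmf_iff)
    have inner: "(\<integral>y. \<Psi> (e, y) \<partial>?p) = indicator {..L} e * g (max 0 (s + e / c)) + q (b, x) * indicator {L<..} e" for e
      using False by (cases "e \<le> L") (simp_all add: \<Psi>_def eL g_eq)
    have i1: "integrable exp_law (\<lambda>e. indicator {..L} e * g (max 0 (s + e / c)) + q (b, x) * indicator {L<..} e)"
      using integrable_fst'[OF int] unfolding inner .
    have i2: "integrable exp_law (\<lambda>e. q (b, x) * indicator {L<..} e)"
      by (intro integrable_mult_right) (auto simp: E.emeasure_eq_measure)
    have i3: "integrable exp_law (\<lambda>e. indicator {..L} e * g (max 0 (s + e / c)))"
      using Bochner_Integration.integrable_diff[OF i1 i2] by simp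
    have tail: "(\<integral>e. q (b, x) * indicator {L<..} e \<partial>exp_law) = q (b, x) * exp (- L)"
    proof -
      have "distributed exp_law lborel (\<lambda>e. e) (exponential_density 1)"
        unfolding distributed_def by (auto simp: distr_id2 exponential_density_nonneg)
      from E.exponential_distributedD_gt[OF this, of L] L
      have "measure exp_law {L<..} = exp (- L)" by (simp add: greaterThan_def)
      thus ?thesis by simp
    qed
    have "q (s, x) = (\<integral>e. \<integral>y. \<Psi> (e, y) \<partial>?p \<partial>exp_law)" unfolding val by (rule integral_fst'[OF int, symmetric])
    also have "\<dots> = (\<integral>e. indicator {..L} e * g (max 0 (s + e / c)) \<partial>exp_law) + q (b, x) * exp (- L)"
      unfolding inner tail[symmetric] by (rule Bochner_Integration.integral_add[OF i3 i2])
    finally have 1: "(\<integral>e. indicator {..L} e * g (max 0 (s + e / c)) \<partial>exp_law) = q (s, x) - exp (- L) * q (b, x)" by simp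
    define f where "f = (\<lambda>e. exponential_density 1 e * (indicator {..L} e * g (max 0 (s + e / c))))"
    have gm: "(\<lambda>e. indicator {..L} e * g (max 0 (s + e / c))) \<in> borel_measurable lborel"
      using borel_measurable_integrable[OF i3] by simp
    have nn: "AE e in lborel. 0 \<le> exponential_density 1 (e :: real)" by (simp add: exponential_density_nonneg)
    have fi: "integrable lborel f"
      using i3 integrable_density[OF gm _ nn] by (simp add: f_def)
    have fv: "integral\<^sup>L lborel f = q (s, x) - exp (- L) * q (b, x)"
      using integral_density[OF gm _ nn] 1 by (simp add: f_def)
    have fa: "integrable lborel (\<lambda>\<tau>. f (- c * s + c * \<tau>))"
      by (rule lborel_integrable_real_affine[OF fi False])
    have fe: "c * f (- c * s + c * \<tau>) = (if \<tau> \<in> {s..b} then exp (- c * (\<tau> - s)) * (c * g \<tau>) else 0)" for \<tau>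
    proof -
      have "- c * s + c * \<tau> < 0 \<longleftrightarrow> \<tau> < s" "- c * s + c * \<tau> \<le> L \<longleftrightarrow> \<tau> \<le> b" "s + (- c * s + c * \<tau>) / c = \<tau>"
        using c by (auto simp: L_def field_simps)
      thus ?thesis using s by (auto simp: f_def exponential_density_def algebra_simps split: split_indicator)
    qed
    have "((\<lambda>\<tau>. c * f (- c * s + c * \<tau>)) has_integral c * (\<integral>\<tau>. f (- c * s + c * \<tau>) \<partial>lborel)) UNIV"
      by (intro has_integral_mult_right has_integral_integral_lborel fa)
    also have "c * (\<integral>\<tau>. f (- c * s + c * \<tau>) \<partial>lborel) = integral\<^sup>L lborel f"
      using lborel_integral_real_affine[OF False, of f "- c * s"] c by simp
    finally have "((\<lambda>\<tau>. exp (- c * (\<tau> - s)) * (c * g \<tau>)) has_integral integral\<^sup>L lborel f) {s..b}"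
      unfolding fe by (simp only: has_integral_restrict_UNIV)
    thus ?thesis unfolding fv L_def jump_mean_def g_def c_def by simp
  qed
qed

end

section \<open>Decay of oscillation\<close>

context model_constants
begin

text \<open>
  The growth lemma at radius $\rho$ takes time of order $\rho^\alpha$, with a constant that may
  exceed $C_0$. Applying it at $\rho$ equal to this fraction of the radius of the cylinder makes
  it fit into the cylinder.
\<close>

definition space_ratio :: "real \<Rightarrow> real" where
  "space_ratio C\<^sub>0 = min (1 / 2) (C\<^sub>0 powr (1 / \<alpha>))"

text \<open>
  The ratio $\gamma$ of consecutive radii. The next cylinder has to lie where the growth lemma
  gives a bound: in space within $\rho/16$, in time within the first half of the window.
\<close>

definition scale_ratio :: "real \<Rightarrow> real" where
  "scale_ratio C\<^sub>0 = min (space_ratio C\<^sub>0 / 16) ((time_const / (2 * C\<^sub>0)) powr (1 / \<alpha>) * space_ratio C\<^sub>0)"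

text \<open>
  The exponent $\beta$ is so small that the tail costs at most half of the growth constant, and
  that $\gamma^\beta$ is not below the contraction factor that the other half provides.
\<close>

definition hoelder_exponent :: "real \<Rightarrow> real" where
  "hoelder_exponent C\<^sub>0 = min (min (1 / 2) (\<alpha> / 2))
     (min (\<alpha> * growth_const * scale_ratio C\<^sub>0 powr (\<alpha> / 2) / (8 * tail_const))
          (ln (1 - growth_const / 4) / ln (scale_ratio C\<^sub>0)))"

lemma space_ratio_bounds:
  assumes "0 < C\<^sub>0"
  shows "0 < space_ratio C\<^sub>0" "space_ratio C\<^sub>0 \<le> 1 / 2" "time_const * space_ratio C\<^sub>0 powr \<alpha> \<le> C\<^sub>0"
proof -
  show p: "0 < space_ratio C\<^sub>0" and "space_ratio C\<^sub>0 \<le> 1 / 2" using assms by (auto simp: space_ratio_def)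
  have "space_ratio C\<^sub>0 powr \<alpha> \<le> (C\<^sub>0 powr (1 / \<alpha>)) powr \<alpha>"
    using p \<alpha>_pos by (intro powr_mono2) (auto simp: space_ratio_def)
  also have "\<dots> = C\<^sub>0" using assms \<alpha>_pos by (simp add: powr_powr)
  finally have "time_const * space_ratio C\<^sub>0 powr \<alpha> \<le> 1 * C\<^sub>0"
    using time_const_bounds by (intro mult_mono) auto
  thus "time_const * space_ratio C\<^sub>0 powr \<alpha> \<le> C\<^sub>0" by simp
qed

lemma scale_ratio_bounds:
  assumes "0 < C\<^sub>0"
  shows "0 < scale_ratio C\<^sub>0" "scale_ratio C\<^sub>0 < 1" "scale_ratio C\<^sub>0 \<le> space_ratio C\<^sub>0 / 16"
    "C\<^sub>0 * scale_ratio C\<^sub>0 powr \<alpha> \<le> time_const * space_ratio C\<^sub>0 powr \<alpha> / 2"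
proof -
  note sr = space_ratio_bounds[OF assms]
  show p: "0 < scale_ratio C\<^sub>0" using sr assms time_const_bounds by (simp add: scale_ratio_def)
  show l: "scale_ratio C\<^sub>0 \<le> space_ratio C\<^sub>0 / 16" by (simp add: scale_ratio_def)
  show "scale_ratio C\<^sub>0 < 1" using l sr by linarith
  have "scale_ratio C\<^sub>0 powr \<alpha> \<le> ((time_const / (2 * C\<^sub>0)) powr (1 / \<alpha>) * space_ratio C\<^sub>0) powr \<alpha>"
    using p \<alpha>_pos by (intro powr_mono2) (auto simp: scale_ratio_def)
  also have "\<dots> = time_const / (2 * C\<^sub>0) * space_ratio C\<^sub>0 powr \<alpha>"
    using assms time_const_bounds \<alpha>_pos sr by (simp add: powr_mult powr_powr)
  finally have "C\<^sub>0 * scale_ratio C\<^sub>0 powr \<alpha> \<le> C\<^sub>0 * (time_const / (2 * C\<^sub>0) * space_ratio C\<^sub>0 powr \<alpha>)"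
    using assms by (intro mult_left_mono) auto
  thus "C\<^sub>0 * scale_ratio C\<^sub>0 powr \<alpha> \<le> time_const * space_ratio C\<^sub>0 powr \<alpha> / 2" using assms by simp
qed

lemma hoelder_exponent_bounds:
  assumes "0 < C\<^sub>0"
  defines "\<beta> \<equiv> hoelder_exponent C\<^sub>0" and "\<gamma> \<equiv> scale_ratio C\<^sub>0"
  shows "0 < \<beta>" "\<beta> < 1" "\<beta> \<le> \<alpha> / 2" "4 * \<beta> / \<alpha> * \<gamma> powr (- \<alpha> / 2) * tail_const \<le> growth_const / 2"
    "1 - growth_const / 4 \<le> \<gamma> powr \<beta>"
proof -
  have g: "0 < \<gamma>" "\<gamma> < 1" using scale_ratio_bounds[OF assms(1)] by (auto simp: \<gamma>_def)
  have ln_neg: "ln \<gamma> < 0" "ln (1 - growth_const / 4) < 0" using g growth_const_bounds by auto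
  show "0 < \<beta>" unfolding \<beta>_def hoelder_exponent_def \<gamma>_def[symmetric]
    using \<alpha>_pos g growth_const_bounds tail_const_pos ln_neg by (simp add: divide_neg_neg)
  have "\<beta> \<le> min (1 / 2) (\<alpha> / 2)" unfolding \<beta>_def hoelder_exponent_def by (rule min.cobounded1)
  thus "\<beta> < 1" "\<beta> \<le> \<alpha> / 2" by auto
  have "\<beta> \<le> \<alpha> * growth_const * \<gamma> powr (\<alpha> / 2) / (8 * tail_const)"
    by (simp add: \<beta>_def \<gamma>_def hoelder_exponent_def)
  hence "4 * \<beta> / \<alpha> * \<gamma> powr (- \<alpha> / 2) * tail_const
      \<le> 4 * (\<alpha> * growth_const * \<gamma> powr (\<alpha> / 2) / (8 * tail_const)) / \<alpha> * \<gamma> powr (- \<alpha> / 2) * tail_const"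
    using \<alpha>_pos tail_const_pos by (intro mult_right_mono divide_right_mono mult_left_mono) auto
  also have "\<dots> = growth_const / 2 * (\<gamma> powr (\<alpha> / 2) * \<gamma> powr (- \<alpha> / 2))"
    using \<alpha>_pos tail_const_pos by (simp add: field_simps)
  also have "\<gamma> powr (\<alpha> / 2) * \<gamma> powr (- \<alpha> / 2) = 1" using g by (simp add: powr_add[symmetric])
  finally show "4 * \<beta> / \<alpha> * \<gamma> powr (- \<alpha> / 2) * tail_const \<le> growth_const / 2" by simp
  have "\<beta> \<le> ln (1 - growth_const / 4) / ln \<gamma>" by (simp add: \<beta>_def \<gamma>_def hoelder_exponent_def)
  hence "ln (1 - growth_const / 4) \<le> \<beta> * ln \<gamma>" using ln_neg by (simp add: neg_le_divide_eq)
  hence "exp (ln (1 - growth_const / 4)) \<le> exp (\<beta> * ln \<gamma>)" by simp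
  thus "1 - growth_const / 4 \<le> \<gamma> powr \<beta>" using g growth_const_bounds by (simp add: powr_def)
qed

text \<open>
  A positive power of $R$ absorbs the logarithm in the assumption on the smallest scale.
\<close>

lemma scale_threshold:
  assumes \<theta>: "0 < \<theta>" "\<theta> < \<delta>" and k: "0 < k"
  obtains R\<^sub>1 where "1 \<le> R\<^sub>1"
    "\<And>R \<rho>. R\<^sub>1 \<le> R \<Longrightarrow> k * R powr \<delta> \<le> \<rho> \<Longrightarrow> \<rho> \<le> R \<Longrightarrow>
       1 \<le> R powr \<theta> / 2 \<and> R powr \<theta> / 2 \<le> \<rho> \<and>
       cstar c\<^sub>G d * (R powr \<theta> / 2) * ln (chain_const\<^sup>2 * \<rho> powr d) powr (5 / \<alpha>) \<le> \<rho>"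
proof -
  define A where "A = chain_const"
  have A: "1 \<le> A" using chain_const_ge(1) by (simp add: A_def)
  define p where "p = 5 / \<alpha>"
  have p: "0 < p" using \<alpha>_pos by (simp add: p_def)
  have d0: "0 < d" by (rule d_pos)
  have "eventually (\<lambda>R::real. 2 \<le> R powr \<theta>) at_top" using \<theta> by real_asymp
  moreover have "eventually (\<lambda>R::real. R powr \<theta> / 2 \<le> k * R powr \<delta>) at_top" using \<theta> k by real_asymp
  moreover have "eventually (\<lambda>R::real. cstar c\<^sub>G d * (R powr \<theta> / 2) * (2 * ln A + d * ln R) powr p \<le> k * R powr \<delta>) at_top"
    using \<theta> k p d0 cstar_ge by real_asymp
  ultimately have "eventually (\<lambda>R::real. 1 \<le> R \<and> 2 \<le> R powr \<theta> \<and> R powr \<theta> / 2 \<le> k * R powr \<delta> \<and>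
      cstar c\<^sub>G d * (R powr \<theta> / 2) * (2 * ln A + d * ln R) powr p \<le> k * R powr \<delta>) at_top"
    by (intro eventually_conj eventually_ge_at_top)
  then obtain R0 where R0: "\<And>R. R0 \<le> R \<Longrightarrow> 1 \<le> R \<and> 2 \<le> R powr \<theta> \<and> R powr \<theta> / 2 \<le> k * R powr \<delta> \<and>
      cstar c\<^sub>G d * (R powr \<theta> / 2) * (2 * ln A + d * ln R) powr p \<le> k * R powr \<delta>"
    unfolding eventually_at_top_linorder by blast
  show ?thesis
  proof (rule that[of "max 1 R0"])
    fix R \<rho> assume R: "max 1 R0 \<le> R" and \<rho>: "k * R powr \<delta> \<le> \<rho>" "\<rho> \<le> R"
    from R have R': "1 \<le> R" "2 \<le> R powr \<theta>" "R powr \<theta> / 2 \<le> k * R powr \<delta>"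
      "cstar c\<^sub>G d * (R powr \<theta> / 2) * (2 * ln A + d * ln R) powr p \<le> k * R powr \<delta>" using R0[of R] by auto
    have \<rho>1: "1 \<le> \<rho>" using R' \<rho> by linarith
    have "0 \<le> ln (A\<^sup>2 * \<rho> powr d)" using A \<rho>1 d0 by (intro ln_ge_zero mult_ge1_I) (auto simp: ge_one_powr_ge_zero)
    moreover have "ln (A\<^sup>2 * \<rho> powr d) \<le> 2 * ln A + d * ln R"
      using A \<rho>1 \<rho> d0 by (simp add: ln_mult ln_powr ln_realpow mult_left_mono)
    ultimately have "ln (A\<^sup>2 * \<rho> powr d) powr p \<le> (2 * ln A + d * ln R) powr p"
      using p by (intro powr_mono2) auto
    hence "cstar c\<^sub>G d * (R powr \<theta> / 2) * ln (A\<^sup>2 * \<rho> powr d) powr p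
        \<le> cstar c\<^sub>G d * (R powr \<theta> / 2) * (2 * ln A + d * ln R) powr p"
      using cstar_ge by (intro mult_left_mono) auto
    also have "\<dots> \<le> \<rho>" using R' \<rho> by linarith
    finally show "1 \<le> R powr \<theta> / 2 \<and> R powr \<theta> / 2 \<le> \<rho> \<and>
       cstar c\<^sub>G d * (R powr \<theta> / 2) * ln (chain_const\<^sup>2 * \<rho> powr d) powr (5 / \<alpha>) \<le> \<rho>"
      using R' \<rho> by (auto simp: A_def p_def)
  qed simp
qed

end

lemma mild_solution_subinterval:
  assumes "mild_solution c a b B F u" "a \<le> a'" "b' \<le> b" "B' \<subseteq> B"
  shows "mild_solution c a' b' B' F u"
  using assms unfolding mild_solution_def by (meson order_trans subsetD)

context stable_graph
begin

lemma jump_mean_affine: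
  assumes x: "x \<in> V" and bdd: "\<And>z. z \<in> V \<Longrightarrow> \<bar>f z\<bar> \<le> K"
  shows "jump_mean G d \<alpha> x (\<lambda>z. a + b * f z) = jump_rate G d \<alpha> x * a + b * jump_mean G d \<alpha> x f"
proof -
  have "integrable (measure_pmf (jump_pmf G d \<alpha> x)) f"
    using set_jump_pmf[OF x] bdd
    by (intro measure_pmf.integrable_const_bound[of _ K]) (auto simp: AE_measure_pmf_iff)
  thus ?thesis by (simp add: jump_mean_def algebra_simps)
qed

lemma mild_solution_affine:
  assumes sol: "mild_solution (jump_rate G d \<alpha>) s t B (\<lambda>\<tau> y. jump_mean G d \<alpha> y (q \<tau>)) q"
    and B: "B \<subseteq> V" and bdd: "\<And>\<tau> z. \<tau> \<in> {s..t} \<Longrightarrow> z \<in> V \<Longrightarrow> \<bar>q \<tau> z\<bar> \<le> K"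
  shows "mild_solution (jump_rate G d \<alpha>) s t B (\<lambda>\<tau> y. jump_mean G d \<alpha> y (\<lambda>z. a + b * q \<tau> z)) (\<lambda>\<tau> z. a + b * q \<tau> z)"
  unfolding mild_solution_def
proof (intro ballI allI impI)
  fix x v w assume x: "x \<in> B" and vw: "s \<le> v \<and> v < w \<and> w \<le> t"
  let ?c = "jump_rate G d \<alpha> x"
  have xV: "x \<in> V" using x B by auto
  have I1: "((\<lambda>\<tau>. exp (- ?c * (\<tau> - v)) * jump_mean G d \<alpha> x (q \<tau>)) has_integral
      (q v x - exp (- ?c * (w - v)) * q w x)) {v..w}"
    using sol x vw unfolding mild_solution_def by blast
  have I2: "((\<lambda>\<tau>. exp (- ?c * (\<tau> - v)) * (?c * a)) has_integral (a - exp (- ?c * (w - v)) * a)) {v..w}"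
    using vw by (intro has_integral_exponential_kernel) auto
  have I3: "((\<lambda>\<tau>. exp (- ?c * (\<tau> - v)) * (?c * a) + b * (exp (- ?c * (\<tau> - v)) * jump_mean G d \<alpha> x (q \<tau>))) has_integral
      (a - exp (- ?c * (w - v)) * a + b * (q v x - exp (- ?c * (w - v)) * q w x))) {v..w}"
    by (intro has_integral_add has_integral_mult_right I1 I2)
  have "((\<lambda>\<tau>. exp (- ?c * (\<tau> - v)) * jump_mean G d \<alpha> x (\<lambda>z. a + b * q \<tau> z)) has_integral
      (a - exp (- ?c * (w - v)) * a + b * (q v x - exp (- ?c * (w - v)) * q w x))) {v..w}"
  proof (rule has_integral_eq[OF _ I3])
    fix \<tau> assume "\<tau> \<in> {v..w}"
    hence "\<tau> \<in> {s..t}" using vw by auto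
    from jump_mean_affine[OF xV bdd[OF this], where a=a and b=b]
    show "exp (- ?c * (\<tau> - v)) * (?c * a) + b * (exp (- ?c * (\<tau> - v)) * jump_mean G d \<alpha> x (q \<tau>))
        = exp (- ?c * (\<tau> - v)) * jump_mean G d \<alpha> x (\<lambda>z. a + b * q \<tau> z)"
      by (simp add: algebra_simps)
  qed
  moreover have "a - exp (- ?c * (w - v)) * a + b * (q v x - exp (- ?c * (w - v)) * q w x)
      = a + b * q v x - exp (- ?c * (w - v)) * (a + b * q w x)" by (simp add: algebra_simps)
  ultimately show "((\<lambda>\<tau>. exp (- ?c * (\<tau> - v)) * jump_mean G d \<alpha> x (\<lambda>z. a + b * q \<tau> z)) has_integral
      (a + b * q v x - exp (- ?c * (w - v)) * (a + b * q w x))) {v..w}" by (simp only:)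
qed

end

context scale_window
begin

text \<open>
  The invariant of the iteration at radius \<open>r\<close>: the values in the ball lie within
  \<open>H\<close> of \<open>c\<close>, and outside they may deviate by more, growing like
  distance to the power $\beta$. The normalisation by $r\gamma$, rather than $r$, and the $-1$
  make the invariant reproduce itself when the centre moves by $H(1-\eta)$.
\<close>

definition controlled :: "real \<Rightarrow> (real \<Rightarrow> 'a \<Rightarrow> real) \<Rightarrow> real \<Rightarrow> 'a \<Rightarrow> real \<Rightarrow> real \<Rightarrow> real \<Rightarrow> bool" where
  "controlled C\<^sub>0 q s x c r H \<longleftrightarrow>
     (\<forall>\<tau>\<in>{s..s + C\<^sub>0 * r powr \<alpha>}. \<forall>z\<in>V. \<bar>q \<tau> z - c\<bar> \<le>
        (if real (\<delta> x z) \<le> r then H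
         else H * (2 * (real (\<delta> x z) / (r * scale_ratio C\<^sub>0)) powr hoelder_exponent C\<^sub>0 - 1)))"

definition admissible :: "real \<Rightarrow> bool" where
  "admissible \<rho> \<longleftrightarrow> \<sigma> \<le> \<rho> \<and> cstar c\<^sub>G d * \<sigma> * ln (chain_const\<^sup>2 * \<rho> powr d) powr (5 / \<alpha>) \<le> \<rho>"

text \<open>
  The sign \<open>e\<close> selects which of $1\pm(q-c)/H$ is large on half of the late part of
  the cylinder. That function is bounded below on the next cylinder, so the interval of values
  shrinks from the opposite end and its centre moves in the direction \<open>e\<close>.
\<close>

lemma oscillation_shrinks_towards_half:
  assumes C0: "0 < C\<^sub>0" and x: "x \<in> gball G v\<^sub>0 (2 * R)" and r: "0 < r" "r \<le> R"
    and adm: "admissible (space_ratio C\<^sub>0 * r)" and H: "0 < H"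
    and T: "T = time_const * (space_ratio C\<^sub>0 * r) powr \<alpha>"
    and sol: "mild_solution (jump_rate G d \<alpha>) s (s + C\<^sub>0 * r powr \<alpha>) (gball G x r) (\<lambda>\<tau> y. jump_mean G d \<alpha> y (q \<tau>)) q"
    and bdd: "\<And>\<tau> z. \<tau> \<in> {s..s + C\<^sub>0 * r powr \<alpha>} \<Longrightarrow> z \<in> V \<Longrightarrow> \<bar>q \<tau> z\<bar> \<le> K"
    and ctrl: "controlled C\<^sub>0 q s x c r H" and e: "e = 1 \<or> e = - 1"
    and half: "(T / 4) * (\<Sum>z\<in>gball G x (space_ratio C\<^sub>0 * r). m z)
      \<le> integral {s + T / 2..s + T} (\<lambda>\<tau>. \<Sum>z\<in>gball G x (space_ratio C\<^sub>0 * r). soft_step (1 + e * (q \<tau> z - c) / H) * m z)"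
  shows "controlled C\<^sub>0 q s x (c + e * H * (1 - scale_ratio C\<^sub>0 powr hoelder_exponent C\<^sub>0))
     (scale_ratio C\<^sub>0 * r) (scale_ratio C\<^sub>0 powr hoelder_exponent C\<^sub>0 * H)"
proof -
  define \<beta> where "\<beta> = hoelder_exponent C\<^sub>0"
  define \<gamma> where "\<gamma> = scale_ratio C\<^sub>0"
  define \<rho> where "\<rho> = space_ratio C\<^sub>0 * r"
  define \<eta> where "\<eta> = \<gamma> powr \<beta>"
  note sp = space_ratio_bounds[OF C0]
  note sc = scale_ratio_bounds[OF C0, folded \<gamma>_def]
  note he = hoelder_exponent_bounds[OF C0, folded \<gamma>_def \<beta>_def]
  have xV: "x \<in> V" using x gball_verts by auto
  have \<eta>: "0 < \<eta>" "\<eta> \<le> 1" "1 - growth_const / 4 \<le> \<eta>"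
    using sc he by (auto simp: \<eta>_def powr_le1)
  have \<rho>: "\<sigma> \<le> \<rho>" "2 * \<rho> \<le> r" "0 < \<rho>"
    using adm sp r by (auto simp: admissible_def \<rho>_def field_simps)
  (* The window of the growth lemma fits into the cylinder. *)
  have TC: "T \<le> C\<^sub>0 * r powr \<alpha>"
    using mult_right_mono[OF sp(3), of "r powr \<alpha>"] r sp(1) by (simp add: T powr_mult mult.assoc)
  have T0: "0 < T" using T time_const_bounds sp r by simp
  define u where "u = (\<lambda>\<tau> z. (1 - e * c / H) + (e / H) * q \<tau> z)"
  have u_eq: "u \<tau> z = 1 + e * (q \<tau> z - c) / H" for \<tau> z by (simp add: u_def field_simps diff_divide_distrib)
  have ctrlD: "\<bar>q \<tau> z - c\<bar> \<le> (if real (\<delta> x z) \<le> r then H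
      else H * (2 * (real (\<delta> x z) / (r * \<gamma>)) powr \<beta> - 1))"
    if "\<tau> \<in> {s..s + C\<^sub>0 * r powr \<alpha>}" "z \<in> V" for \<tau> z
    using ctrl that unfolding controlled_def \<gamma>_def \<beta>_def by blast
  have near: "0 \<le> u \<tau> z" "u \<tau> z \<le> 2" if "\<tau> \<in> {s..s + C\<^sub>0 * r powr \<alpha>}" "z \<in> gball G x r" for \<tau> z
  proof -
    have "\<bar>q \<tau> z - c\<bar> \<le> H" using ctrlD[OF that(1), of z] that(2) by (simp add: gball_def)
    moreover define w where "w = (q \<tau> z - c) / H"
    ultimately have "\<bar>w\<bar> \<le> 1" using H by (simp add: abs_divide)
    moreover have "u \<tau> z = 1 + e * w" unfolding u_eq w_def by simp
    ultimately show "0 \<le> u \<tau> z" "u \<tau> z \<le> 2" using e by auto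
  qed
  have far: "- (2 * ((real (\<delta> x z) / (2 * \<rho> * \<gamma>)) powr \<beta> - 1)) \<le> u \<tau> z"
    if tau: "\<tau> \<in> {s..s + C\<^sub>0 * r powr \<alpha>}" and z: "z \<in> V" "2 * \<rho> < real (\<delta> x z)" for \<tau> z
  proof (cases "real (\<delta> x z) \<le> r")
    case True
    have "2 * \<rho> * \<gamma> \<le> 2 * \<rho> * 1" using sc \<rho> by (intro mult_left_mono) auto
    hence "2 * \<rho> * \<gamma> \<le> real (\<delta> x z)" using z by linarith
    hence "1 \<le> real (\<delta> x z) / (2 * \<rho> * \<gamma>)" using sc \<rho> by simp
    hence "1 \<le> (real (\<delta> x z) / (2 * \<rho> * \<gamma>)) powr \<beta>" using he by (intro ge_one_powr_ge_zero) auto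
    thus ?thesis using near(1)[OF tau, of z] True z by (simp add: gball_def)
  next
    case False
    let ?a = "(real (\<delta> x z) / (r * \<gamma>)) powr \<beta>"
    have "\<bar>q \<tau> z - c\<bar> \<le> H * (2 * ?a - 1)"
      using ctrlD[OF tau z(1)] False by simp
    hence "\<bar>q \<tau> z - c\<bar> / H \<le> 2 * ?a - 1" using H by (simp add: pos_divide_le_eq mult.commute)
    moreover have "- (\<bar>q \<tau> z - c\<bar> / H) \<le> e * (q \<tau> z - c) / H"
    proof -
      have "- \<bar>q \<tau> z - c\<bar> \<le> e * (q \<tau> z - c)" using e by auto
      from divide_right_mono[OF this, of H] H show ?thesis by simp
    qed
    moreover have "?a \<le> (real (\<delta> x z) / (2 * \<rho> * \<gamma>)) powr \<beta>"
    proof (rule powr_mono2)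
      show "real (\<delta> x z) / (r * \<gamma>) \<le> real (\<delta> x z) / (2 * \<rho> * \<gamma>)"
        using \<rho> sc r by (intro divide_left_mono mult_right_mono) auto
    qed (use he sc r in auto)
    moreover have "- (2 * (b' - 1)) \<le> 1 + w" if "X \<le> 2 * a' - 1" "- X \<le> w" "a' \<le> b'" for X w a' b' :: real
    proof -
      have "2 * a' \<le> 2 * b'" using that(3) by simp
      hence "- w \<le> 2 * b' - 1" using that(1,2) by linarith
      hence "2 - 2 * b' \<le> 1 + w" by linarith
      moreover have "- (2 * (b' - 1)) = 2 - 2 * b'" by simp
      ultimately show ?thesis by (simp only:)
    qed
    ultimately show ?thesis unfolding u_eq by blast
  qed
  have u_bdd: "\<bar>u \<tau> z\<bar> \<le> \<bar>1 - e * c / H\<bar> + \<bar>e / H\<bar> * K"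
    if "\<tau> \<in> {s..s + C\<^sub>0 * r powr \<alpha>}" "z \<in> V" for \<tau> z
  proof -
    have "\<bar>u \<tau> z\<bar> \<le> \<bar>1 - e * c / H\<bar> + \<bar>e / H\<bar> * \<bar>q \<tau> z\<bar>" unfolding u_def by (metis abs_mult abs_triangle_ineq)
    also have "\<dots> \<le> \<bar>1 - e * c / H\<bar> + \<bar>e / H\<bar> * K" using bdd[OF that] by (intro add_left_mono mult_left_mono) auto
    finally show ?thesis .
  qed
  have B_sub: "gball G x \<rho> \<subseteq> gball G x r" "gball G x (2 * \<rho>) \<subseteq> gball G x r" using \<rho> by (auto simp: gball_def)
  have gain: "growth_const / 2 \<le> u \<tau> y" if tau: "\<tau> \<in> {s..s + T / 2}" and y: "y \<in> gball G x (\<rho> / 16)" for \<tau> y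
  proof -
    have "growth_const - 4 * \<beta> / \<alpha> * \<gamma> powr (- \<alpha> / 2) * tail_const \<le> u \<tau> y"
    proof (rule growth_of_positive_solutions[OF x \<rho>(1) _ _ _ _ _ _ _ _ tau y])
      show "2 * \<rho> \<le> R" using \<rho> r by simp
      show "cstar c\<^sub>G d * \<sigma> * ln (chain_const\<^sup>2 * \<rho> powr d) powr (5 / \<alpha>) \<le> \<rho>"
        using adm by (simp add: admissible_def \<rho>_def)
      show "T = time_const * \<rho> powr \<alpha>" by (simp add: T \<rho>_def)
      have "mild_solution (jump_rate G d \<alpha>) s (s + C\<^sub>0 * r powr \<alpha>) (gball G x r) (\<lambda>\<tau> y. jump_mean G d \<alpha> y (u \<tau>)) u"
        unfolding u_def by (rule mild_solution_affine[OF sol gball_subset_verts bdd])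
      thus "mild_solution (jump_rate G d \<alpha>) s (s + T) (gball G x \<rho>) (\<lambda>\<tau> y. jump_mean G d \<alpha> y (u \<tau>)) u"
        by (rule mild_solution_subinterval) (use TC B_sub in auto)
      show "0 \<le> u \<tau> z" if "\<tau> \<in> {s..s + T}" "z \<in> gball G x (2 * \<rho>)" for \<tau> z
        using that TC B_sub by (intro near) auto
      show "(\<Sum>z\<in>gball G x (2 * \<rho>). J y z * u \<tau> z) - 4 * \<beta> / \<alpha> * \<gamma> powr (- \<alpha> / 2) * tail_const * \<rho> powr (- \<alpha>)
          \<le> jump_mean G d \<alpha> y (u \<tau>)" if "\<tau> \<in> {s..s + T}" "y \<in> gball G x \<rho>" for \<tau> y
      proof -
        have tau: "\<tau> \<in> {s..s + C\<^sub>0 * r powr \<alpha>}" using that TC by auto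
        have "2 * \<rho> \<le> R" using \<rho> r by simp
        thus ?thesis
          by (rule jump_mean_hoelder_tail[OF x \<rho>(1) _ that(2) u_bdd[OF tau] he(1,3) sc(1) far[OF tau]])
      qed
      show "0 \<le> 4 * \<beta> / \<alpha> * \<gamma> powr (- \<alpha> / 2) * tail_const" using he \<alpha>_pos tail_const_pos by simp
      show "T / 4 * (\<Sum>z\<in>gball G x \<rho>. m z)
          \<le> integral {s + T / 2..s + T} (\<lambda>\<tau>. \<Sum>z\<in>gball G x \<rho>. soft_step (u \<tau> z) * m z)"
        using half by (simp add: u_eq \<rho>_def)
    qed
    thus ?thesis using he(4) by linarith
  qed
  have next_time: "C\<^sub>0 * (\<gamma> * r) powr \<alpha> \<le> T / 2"
    using mult_right_mono[OF sc(4), of "r powr \<alpha>"] r sc(1) sp(1) by (simp add: T powr_mult mult.assoc)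
  have next_space: "\<gamma> * r \<le> \<rho> / 16" using mult_right_mono[OF sc(3), of r] r by (simp add: \<rho>_def)
  let ?c = "c + e * H * (1 - \<eta>)"
  have e_abs: "\<bar>e\<bar> = 1" using e by auto
  have shift: "\<bar>q \<tau> z - ?c\<bar> \<le> \<bar>q \<tau> z - c\<bar> + H * (1 - \<eta>)" for \<tau> z
  proof -
    have "\<bar>e * H * (1 - \<eta>)\<bar> = H * (1 - \<eta>)" using e_abs H \<eta> by (simp add: abs_mult)
    thus ?thesis by linarith
  qed
  have "\<bar>q \<tau> z - ?c\<bar> \<le> (if real (\<delta> x z) \<le> \<gamma> * r then \<eta> * H
      else \<eta> * H * (2 * (real (\<delta> x z) / (\<gamma> * r * \<gamma>)) powr \<beta> - 1))"
    if tau': "\<tau> \<in> {s..s + C\<^sub>0 * (\<gamma> * r) powr \<alpha>}" and z: "z \<in> V" for \<tau> z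
  proof -
    have tau: "\<tau> \<in> {s..s + T / 2}" "\<tau> \<in> {s..s + C\<^sub>0 * r powr \<alpha>}" using tau' next_time TC T0 by auto
    show ?thesis
    proof (cases "real (\<delta> x z) \<le> \<gamma> * r")
      case True
      have zB: "z \<in> gball G x (\<rho> / 16)" "z \<in> gball G x r" using True z next_space \<rho> by (auto simp: gball_def)
      define w where "w = e * (q \<tau> z - c) / H"
      have "growth_const / 2 \<le> 1 + w" "1 + w \<le> 2"
        using gain[OF tau(1) zB(1)] near(2)[OF tau(2) zB(2)] unfolding u_eq w_def by auto
      hence "\<bar>w - (1 - \<eta>)\<bar> \<le> \<eta>" using \<eta>(3) by linarith
      moreover have "q \<tau> z - ?c = e * H * (w - (1 - \<eta>))"
      proof -
        have "e * H * w = (e * e) * (q \<tau> z - c)" using H by (simp add: w_def)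
        also have "e * e = 1" using e by auto
        finally show ?thesis by (simp add: algebra_simps)
      qed
      ultimately have "\<bar>q \<tau> z - ?c\<bar> \<le> 1 * H * \<eta>"
        using e_abs H by (simp add: abs_mult mult_left_mono)
      thus ?thesis using True by (simp add: mult.commute)
    next
      case False
      let ?a = "(real (\<delta> x z) / (r * \<gamma>)) powr \<beta>"
      (* The factor \<eta> = \<gamma> powr \<beta> cancels one \<gamma>. *)
      have eqa: "\<eta> * (real (\<delta> x z) / (\<gamma> * r * \<gamma>)) powr \<beta> = ?a"
      proof -
        have "real (\<delta> x z) / (r * \<gamma>) = \<gamma> * (real (\<delta> x z) / (\<gamma> * r * \<gamma>))" using sc by simp
        thus ?thesis unfolding \<eta>_def using sc r by (simp add: powr_mult[symmetric] mult.commute[of r])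
      qed
      have rhs: "\<eta> * H * (2 * (real (\<delta> x z) / (\<gamma> * r * \<gamma>)) powr \<beta> - 1) = H * (2 * ?a - \<eta>)"
        unfolding eqa[symmetric] by (simp add: algebra_simps)
      have "\<bar>q \<tau> z - c\<bar> \<le> H * (2 * ?a - 1)"
      proof (cases "real (\<delta> x z) \<le> r")
        case True
        have "1 \<le> real (\<delta> x z) / (r * \<gamma>)" using False r sc by (simp add: mult.commute)
        hence "1 \<le> ?a" using he by (intro ge_one_powr_ge_zero) auto
        hence "H * 1 \<le> H * (2 * ?a - 1)" using H by (intro mult_left_mono) auto
        thus ?thesis using ctrlD[OF tau(2) z] True by simp
      next
        case False
        thus ?thesis using ctrlD[OF tau(2) z] by simp
      qed
      hence "\<bar>q \<tau> z - ?c\<bar> \<le> H * (2 * ?a - 1) + H * (1 - \<eta>)" using shift[of \<tau> z] by linarith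
      also have "\<dots> = H * (2 * ?a - \<eta>)" by (simp add: algebra_simps)
      finally show ?thesis unfolding rhs[symmetric] using False by simp
    qed
  qed
  thus ?thesis unfolding controlled_def \<gamma>_def[symmetric] \<beta>_def[symmetric] \<eta>_def[symmetric] by simp
qed

lemma oscillation_step:
  assumes C0: "0 < C\<^sub>0" and x: "x \<in> gball G v\<^sub>0 (2 * R)" and r: "0 < r" "r \<le> R"
    and adm: "admissible (space_ratio C\<^sub>0 * r)" and H: "0 < H"
    and sol: "mild_solution (jump_rate G d \<alpha>) s (s + C\<^sub>0 * r powr \<alpha>) (gball G x r) (\<lambda>\<tau> y. jump_mean G d \<alpha> y (q \<tau>)) q"
    and bdd: "\<And>\<tau> z. \<tau> \<in> {s..s + C\<^sub>0 * r powr \<alpha>} \<Longrightarrow> z \<in> V \<Longrightarrow> \<bar>q \<tau> z\<bar> \<le> K"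
    and ctrl: "controlled C\<^sub>0 q s x c r H"
  shows "\<exists>c'. controlled C\<^sub>0 q s x c' (scale_ratio C\<^sub>0 * r) (scale_ratio C\<^sub>0 powr hoelder_exponent C\<^sub>0 * H)"
proof -
  define T where "T = time_const * (space_ratio C\<^sub>0 * r) powr \<alpha>"
  let ?B = "gball G x (space_ratio C\<^sub>0 * r)" and ?I = "{s + T / 2..s + T}"
  note sp = space_ratio_bounds[OF C0]
  have xV: "x \<in> V" using x gball_verts by auto
  have TC: "T \<le> C\<^sub>0 * r powr \<alpha>"
    using mult_right_mono[OF sp(3), of "r powr \<alpha>"] r sp(1) by (simp add: T_def powr_mult mult.assoc)
  have T0: "0 < T" using time_const_bounds sp r by (simp add: T_def)
  have B_sub: "?B \<subseteq> gball G x r"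
  proof -
    have "space_ratio C\<^sub>0 * r \<le> r" using mult_right_mono[OF sp(2), of r] r by linarith
    thus ?thesis by (auto simp: gball_def)
  qed
  define N where "N = (\<lambda>e \<tau>. \<Sum>z\<in>?B. soft_step (1 + e * (q \<tau> z - c) / H) * m z)"
  have cont: "continuous_on {s..s + C\<^sub>0 * r powr \<alpha>} (\<lambda>\<tau>. q \<tau> z)" if "z \<in> ?B" for z
    using mild_solution_continuous[OF sol, of z] that B_sub by auto
  have int: "N e integrable_on ?I" for e
    unfolding N_def soft_step_def using H TC T0
    by (intro integrable_continuous_real continuous_intros continuous_on_subset[OF cont]) auto
  have sum_ge: "(\<Sum>z\<in>?B. m z) \<le> N 1 \<tau> + N (- 1) \<tau>" for \<tau>
    unfolding N_def sum.distrib[symmetric]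
  proof (rule sum_mono)
    fix z assume z: "z \<in> ?B"
    have "1 \<le> soft_step (1 + 1 * (q \<tau> z - c) / H) + soft_step (1 + (- 1) * (q \<tau> z - c) / H)"
    proof (cases "0 \<le> (q \<tau> z - c) / H")
      case True
      hence "soft_step (1 + 1 * (q \<tau> z - c) / H) = 1" by (intro soft_step_props(4)) simp
      thus ?thesis using soft_step_props(1)[of "1 + (- 1) * (q \<tau> z - c) / H"] by linarith
    next
      case False
      have "(- 1) * a / H = - (a / H)" for a by simp
      from this[of "q \<tau> z - c"] False have "0 \<le> (- 1) * (q \<tau> z - c) / H" by linarith
      hence "soft_step (1 + (- 1) * (q \<tau> z - c) / H) = 1" by (intro soft_step_props(4)) linarith
      thus ?thesis using soft_step_props(1)[of "1 + 1 * (q \<tau> z - c) / H"] by linarith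
    qed
    from mult_right_mono[OF this, of "m z"] mass_pos[OF gball_verts[OF z]]
    show "m z \<le> soft_step (1 + 1 * (q \<tau> z - c) / H) * m z + soft_step (1 + (- 1) * (q \<tau> z - c) / H) * m z"
      by (simp add: distrib_right)
  qed
  have "T / 2 * (\<Sum>z\<in>?B. m z) \<le> integral ?I (N 1) + integral ?I (N (- 1))"
  proof -
    have "((\<lambda>_. \<Sum>z\<in>?B. m z) has_integral T / 2 * (\<Sum>z\<in>?B. m z)) ?I"
      using has_integral_const_real[of "\<Sum>z\<in>?B. m z" "s + T / 2" "s + T"] T0 by simp
    moreover have "((\<lambda>\<tau>. N 1 \<tau> + N (- 1) \<tau>) has_integral integral ?I (N 1) + integral ?I (N (- 1))) ?I"
      by (intro has_integral_add integrable_integral int)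
    ultimately show ?thesis using sum_ge by (rule has_integral_le)
  qed
  then consider "T / 4 * (\<Sum>z\<in>?B. m z) \<le> integral ?I (N 1)" | "T / 4 * (\<Sum>z\<in>?B. m z) \<le> integral ?I (N (- 1))"
    by linarith
  hence "\<exists>e. (e = 1 \<or> e = - 1) \<and> T / 4 * (\<Sum>z\<in>?B. m z) \<le> integral ?I (N e)" by cases blast+
  then obtain e where e: "e = 1 \<or> e = - 1" and half: "T / 4 * (\<Sum>z\<in>?B. m z) \<le> integral ?I (N e)" by blast
  from oscillation_shrinks_towards_half[OF C0 x r adm H T_def sol bdd ctrl e half[unfolded N_def]] show ?thesis by blast
qed

lemma oscillation_decay:
  assumes C0: "0 < C\<^sub>0" and x: "x \<in> gball G v\<^sub>0 (2 * R)" and r: "0 < r" "r \<le> R"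
    and H: "0 < H"
    and sol: "mild_solution (jump_rate G d \<alpha>) s (s + C\<^sub>0 * r powr \<alpha>) (gball G x r) (\<lambda>\<tau> y. jump_mean G d \<alpha> y (q \<tau>)) q"
    and bdd: "\<And>\<tau> z. \<tau> \<in> {s..s + C\<^sub>0 * r powr \<alpha>} \<Longrightarrow> z \<in> V \<Longrightarrow> \<bar>q \<tau> z\<bar> \<le> H"
    and adm: "\<And>j. j < n \<Longrightarrow> admissible (space_ratio C\<^sub>0 * (scale_ratio C\<^sub>0 ^ j * r))"
  shows "\<exists>c. controlled C\<^sub>0 q s x c (scale_ratio C\<^sub>0 ^ n * r) ((scale_ratio C\<^sub>0 powr hoelder_exponent C\<^sub>0) ^ n * H)"
  using adm
proof (induction n)
  case 0
  let ?\<gamma> = "scale_ratio C\<^sub>0" and ?\<beta> = "hoelder_exponent C\<^sub>0"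
  note sc = scale_ratio_bounds[OF C0] and he = hoelder_exponent_bounds[OF C0]
  have "H \<le> H * (2 * (real (\<delta> x z) / (r * ?\<gamma>)) powr ?\<beta> - 1)" if "\<not> real (\<delta> x z) \<le> r" for z
  proof -
    have "r * ?\<gamma> \<le> r * 1" using sc r by (intro mult_left_mono) auto
    hence "r * ?\<gamma> \<le> real (\<delta> x z)" using that by linarith
    hence "1 \<le> real (\<delta> x z) / (r * ?\<gamma>)" using sc r by simp
    hence "1 \<le> (real (\<delta> x z) / (r * ?\<gamma>)) powr ?\<beta>" using he by (intro ge_one_powr_ge_zero) auto
    hence "H * 1 \<le> H * (2 * (real (\<delta> x z) / (r * ?\<gamma>)) powr ?\<beta> - 1)" using H by (intro mult_left_mono) auto
    thus ?thesis by simp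
  qed
  moreover have "\<bar>q \<tau> z - 0\<bar> \<le> H" if "\<tau> \<in> {s..s + C\<^sub>0 * r powr \<alpha>}" "z \<in> V" for \<tau> z
    using bdd[OF that] by simp
  ultimately have "controlled C\<^sub>0 q s x 0 r H" unfolding controlled_def by (smt (verit, best))
  thus ?case by auto
next
  case (Suc n)
  let ?\<gamma> = "scale_ratio C\<^sub>0" and ?\<eta> = "scale_ratio C\<^sub>0 powr hoelder_exponent C\<^sub>0"
  note sc = scale_ratio_bounds[OF C0]
  obtain c where c: "controlled C\<^sub>0 q s x c (?\<gamma> ^ n * r) (?\<eta> ^ n * H)" using Suc by auto
  have g1: "?\<gamma> ^ n \<le> 1" using sc by (intro power_le_one) auto
  have rn: "0 < ?\<gamma> ^ n * r" "?\<gamma> ^ n * r \<le> r" using sc r g1 by (auto simp: mult_left_le_one_le)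
  have time: "C\<^sub>0 * (?\<gamma> ^ n * r) powr \<alpha> \<le> C\<^sub>0 * r powr \<alpha>"
    using rn C0 \<alpha>_pos by (intro mult_left_mono powr_mono2) auto
  have "\<exists>c'. controlled C\<^sub>0 q s x c' (?\<gamma> * (?\<gamma> ^ n * r)) (?\<eta> * (?\<eta> ^ n * H))"
  proof (rule oscillation_step[OF C0 x rn(1) _ _ _ _ _ c])
    show "mild_solution (jump_rate G d \<alpha>) s (s + C\<^sub>0 * (?\<gamma> ^ n * r) powr \<alpha>) (gball G x (?\<gamma> ^ n * r))
        (\<lambda>\<tau> y. jump_mean G d \<alpha> y (q \<tau>)) q"
      by (rule mild_solution_subinterval[OF sol]) (use time rn in \<open>auto simp: gball_def\<close>)
    show "\<bar>q \<tau> z\<bar> \<le> H" if "\<tau> \<in> {s..s + C\<^sub>0 * (?\<gamma> ^ n * r) powr \<alpha>}" "z \<in> V" for \<tau> z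
      using that time by (intro bdd) auto
  qed (use order_trans[OF rn(2) r(2)] Suc.prems sc H in auto)
  thus ?case by (simp add: mult.assoc)
qed

text \<open>
  Iterate down to the last cylinder that still contains both points.
\<close>

lemma hoelder_estimate:
  assumes C0: "0 < C\<^sub>0" and x: "x \<in> gball G v\<^sub>0 (2 * R)" and r: "0 < r" "r \<le> R" and H: "0 < H"
    and sol: "mild_solution (jump_rate G d \<alpha>) s (s + C\<^sub>0 * r powr \<alpha>) (gball G x r) (\<lambda>\<tau> y. jump_mean G d \<alpha> y (q \<tau>)) q"
    and bdd: "\<And>\<tau> z. \<tau> \<in> {s..s + C\<^sub>0 * r powr \<alpha>} \<Longrightarrow> z \<in> V \<Longrightarrow> \<bar>q \<tau> z\<bar> \<le> H"
    and adm: "\<And>r'. l \<le> r' \<Longrightarrow> r' \<le> r \<Longrightarrow> admissible (space_ratio C\<^sub>0 * r')"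
    and l: "0 < l" "l \<le> r" and ty: "s \<le> t" "t \<le> s + C\<^sub>0 * l powr \<alpha>" "y \<in> gball G x l"
  shows "\<bar>q s x - q t y\<bar> \<le> 2 * H * (l / (scale_ratio C\<^sub>0 * r)) powr hoelder_exponent C\<^sub>0"
proof -
  let ?\<gamma> = "scale_ratio C\<^sub>0" and ?\<beta> = "hoelder_exponent C\<^sub>0"
  note sc = scale_ratio_bounds[OF C0] and he = hoelder_exponent_bounds[OF C0]
  have ex: "\<exists>n. ?\<gamma> ^ n * r < l"
  proof -
    obtain n where "?\<gamma> ^ n < l / r" using real_arch_pow_inv[of "l / r" ?\<gamma>] sc l r by auto
    thus ?thesis using r by (auto simp: field_simps)
  qed
  define n' where "n' = (LEAST n. ?\<gamma> ^ n * r < l)"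
  have n': "?\<gamma> ^ n' * r < l" unfolding n'_def by (rule LeastI_ex[OF ex])
  have "n' \<noteq> 0"
  proof
    assume "n' = 0"
    thus False using n' l by simp
  qed
  then obtain n where n: "n' = Suc n" by (cases n') auto
  have ge: "l \<le> ?\<gamma> ^ n * r" using not_less_Least[of n "\<lambda>n. ?\<gamma> ^ n * r < l"] n n'_def by auto
  have "\<exists>c. controlled C\<^sub>0 q s x c (?\<gamma> ^ n * r) ((?\<gamma> powr ?\<beta>) ^ n * H)"
  proof (rule oscillation_decay[OF C0 x r H sol bdd])
    fix j assume "j < n"
    hence "?\<gamma> ^ n * r \<le> ?\<gamma> ^ j * r" using sc r by (intro mult_right_mono power_decreasing) auto
    moreover have "?\<gamma> ^ j * r \<le> 1 * r" using sc r by (intro mult_right_mono power_le_one) auto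
    ultimately show "admissible (space_ratio C\<^sub>0 * (?\<gamma> ^ j * r))" using ge by (intro adm) auto
  qed auto
  then obtain c where c: "controlled C\<^sub>0 q s x c (?\<gamma> ^ n * r) ((?\<gamma> powr ?\<beta>) ^ n * H)" by blast
  have lp: "l powr \<alpha> \<le> (?\<gamma> ^ n * r) powr \<alpha>" using ge l \<alpha>_pos by (intro powr_mono2) auto
  have xV: "x \<in> V" using x gball_verts by auto
  have "C\<^sub>0 * l powr \<alpha> \<le> C\<^sub>0 * (?\<gamma> ^ n * r) powr \<alpha>" using lp C0 by (intro mult_left_mono) auto
  hence "t \<in> {s..s + C\<^sub>0 * (?\<gamma> ^ n * r) powr \<alpha>}" "s \<in> {s..s + C\<^sub>0 * (?\<gamma> ^ n * r) powr \<alpha>}"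
    using ty by auto
  moreover have "real (\<delta> x y) \<le> ?\<gamma> ^ n * r" "y \<in> V" using ty ge by (auto simp: gball_def)
  moreover have "real (\<delta> x x) \<le> ?\<gamma> ^ n * r" using ge l by simp
  moreover have "\<bar>q \<tau> z - c\<bar> \<le> (?\<gamma> powr ?\<beta>) ^ n * H"
    if "\<tau> \<in> {s..s + C\<^sub>0 * (?\<gamma> ^ n * r) powr \<alpha>}" "z \<in> V" "real (\<delta> x z) \<le> ?\<gamma> ^ n * r" for \<tau> z
    using bspec[OF bspec[OF c[unfolded controlled_def] that(1)] that(2)] that(3) by (simp only: if_True)
  ultimately have "\<bar>q s x - c\<bar> \<le> (?\<gamma> powr ?\<beta>) ^ n * H" "\<bar>q t y - c\<bar> \<le> (?\<gamma> powr ?\<beta>) ^ n * H"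
    using xV by blast+
  hence "\<bar>q s x - q t y\<bar> \<le> 2 * H * (?\<gamma> powr ?\<beta>) ^ n" by (simp add: mult.commute)
  also have "(?\<gamma> powr ?\<beta>) ^ n = (?\<gamma> ^ n) powr ?\<beta>"
    using sc by (simp add: powr_realpow[symmetric] powr_powr mult.commute)
  also have "\<dots> \<le> (l / (?\<gamma> * r)) powr ?\<beta>"
    using n' n sc r he by (intro powr_mono2) (auto simp: field_simps)
  finally show ?thesis using H by (simp add: mult_left_mono)
qed

end

section \<open>Regularity of caloric functions\<close>

context model_constants
begin

text \<open>
  The cylinders of the iteration start at a point of the cylinder of radius $r$ and must end
  before the one of radius $2r$ does. The time left is only $(2^\alpha-1)r^\alpha C_0$, which
  for $\alpha<1$ is less than $C_0r^\alpha$.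
\<close>

definition radius_factor :: real where
  "radius_factor = min 1 ((2 powr \<alpha> - 1) powr (1 / \<alpha>))"

lemma radius_factor_bounds:
  "0 < radius_factor" "radius_factor \<le> 1" "radius_factor powr \<alpha> \<le> 2 powr \<alpha> - 1"
proof -
  have p: "0 < 2 powr \<alpha> - 1" using \<alpha>_pos powr_less_mono[of 0 \<alpha> 2] by simp
  show pos: "0 < radius_factor" and "radius_factor \<le> 1" using p by (auto simp: radius_factor_def)
  have "radius_factor powr \<alpha> \<le> ((2 powr \<alpha> - 1) powr (1 / \<alpha>)) powr \<alpha>"
    using pos \<alpha>_pos by (intro powr_mono2) (auto simp: radius_factor_def)
  also have "\<dots> = (2 powr \<alpha> - 1) powr 1" using \<alpha>_pos by (simp only: powr_powr) simp
  also have "\<dots> = 2 powr \<alpha> - 1" by (rule powr_one[OF less_imp_le[OF p]])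
  finally show "radius_factor powr \<alpha> \<le> 2 powr \<alpha> - 1" .
qed

definition hoelder_const :: "real \<Rightarrow> real" where
  "hoelder_const C\<^sub>0 = 2 * ((1 + C\<^sub>0 powr (- 1 / \<alpha>)) / (scale_ratio C\<^sub>0 * radius_factor)) powr hoelder_exponent C\<^sub>0"

end

context scale_window
begin

lemma caloric_mild_solution:
  assumes q: "caloric G d \<alpha> (cylinder G \<alpha> C\<^sub>0 t\<^sub>0 x\<^sub>0 (2 * r)) q" and t0: "0 \<le> t\<^sub>0"
    and s: "t\<^sub>0 < s" "s' < t\<^sub>0 + C\<^sub>0 * (2 * r) powr \<alpha>" and B: "B \<subseteq> gball G x\<^sub>0 (2 * r)"
  shows "mild_solution (jump_rate G d \<alpha>) s s' B
    (\<lambda>\<tau> y. jump_mean G d \<alpha> y (\<lambda>z. q (\<tau>, z))) (\<lambda>\<tau> z. q (\<tau>, z))"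
  unfolding mild_solution_def
proof (intro ballI allI impI)
  fix y v w assume y: "y \<in> B" and vw: "s \<le> v \<and> v < w \<and> w \<le> s'"
  show "((\<lambda>\<tau>. exp (- jump_rate G d \<alpha> y * (\<tau> - v)) * jump_mean G d \<alpha> y (\<lambda>z. q (\<tau>, z))) has_integral
      (q (v, y) - exp (- jump_rate G d \<alpha> y * (w - v)) * q (w, y))) {v..w}"
  proof (rule caloric_mean_value[OF q])
    show "{(t\<^sub>0 + s) / 2..w} \<times> {y} \<subseteq> cylinder G \<alpha> C\<^sub>0 t\<^sub>0 x\<^sub>0 (2 * r)"
      using y B s vw by (auto simp: cylinder_def)
  qed (use y B s vw t0 gball_verts in auto)
qed

text \<open>
  If the separation \<open>l\<close> of the points exceeds the radius \<open>r0\<close> of the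
  first cylinder, the bound on \<open>q\<close> alone suffices.
\<close>

lemma caloric_hoelder:
  assumes C0: "0 < C\<^sub>0" and x0: "x\<^sub>0 \<in> gball G v\<^sub>0 R" and r: "0 < r" "r \<le> R" and t0: "0 \<le> t\<^sub>0"
    and q: "caloric G d \<alpha> (cylinder G \<alpha> C\<^sub>0 t\<^sub>0 x\<^sub>0 (2 * r)) q"
    and sx: "(s, x) \<in> cylinder G \<alpha> C\<^sub>0 t\<^sub>0 x\<^sub>0 r" and ty: "(t, y) \<in> cylinder G \<alpha> C\<^sub>0 t\<^sub>0 x\<^sub>0 r" and st: "s \<le> t"
    and M: "0 < M" and bdd: "\<And>\<tau> z. \<tau> \<in> {t\<^sub>0..t\<^sub>0 + C\<^sub>0 * (2 * r) powr \<alpha>} \<Longrightarrow> z \<in> V \<Longrightarrow> \<bar>q (\<tau>, z)\<bar> \<le> M"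
    and l: "l\<^sub>0 \<le> (\<bar>s - t\<bar> / C\<^sub>0) powr (1 / \<alpha>) + real (\<delta> x y)" "0 < l\<^sub>0"
    and adm: "\<And>r'. l\<^sub>0 \<le> r' \<Longrightarrow> r' \<le> R \<Longrightarrow> admissible (space_ratio C\<^sub>0 * r')"
  shows "\<bar>q (s, x) - q (t, y)\<bar>
    \<le> hoelder_const C\<^sub>0 * M * ((\<bar>t - s\<bar> powr (1 / \<alpha>) + real (\<delta> x y)) / r) powr hoelder_exponent C\<^sub>0"
proof -
  let ?\<gamma> = "scale_ratio C\<^sub>0" and ?\<beta> = "hoelder_exponent C\<^sub>0"
  note sc = scale_ratio_bounds[OF C0] and he = hoelder_exponent_bounds[OF C0]
  define l where "l = (\<bar>s - t\<bar> / C\<^sub>0) powr (1 / \<alpha>) + real (\<delta> x y)"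
  define r0 where "r0 = radius_factor * r"
  have l_pos: "0 < l" and l0: "l\<^sub>0 \<le> l" using l by (auto simp: l_def)
  have r0: "0 < r0" "r0 \<le> r" using radius_factor_bounds r by (auto simp: r0_def mult_left_le_one_le)
  have x0V: "x\<^sub>0 \<in> V" and xV: "x \<in> V" and yV: "y \<in> V" using x0 sx ty gball_verts by (auto simp: cylinder_def)
  have x2: "x \<in> gball G v\<^sub>0 (2 * R)"
    using gball_mono[OF v0 x0V, of r "2 * R"] sx x0 r by (auto simp: cylinder_def gball_def)
  have big: "C\<^sub>0 * r powr \<alpha> + C\<^sub>0 * r0 powr \<alpha> \<le> C\<^sub>0 * (2 * r) powr \<alpha>"
  proof -
    have "r0 powr \<alpha> \<le> (2 powr \<alpha> - 1) * r powr \<alpha>"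
      using mult_right_mono[OF radius_factor_bounds(3), of "r powr \<alpha>"] radius_factor_bounds(1) r
      by (simp add: r0_def powr_mult)
    hence "r powr \<alpha> + r0 powr \<alpha> \<le> (2 * r) powr \<alpha>" using r by (simp add: powr_mult algebra_simps)
    from mult_left_mono[OF this, of C\<^sub>0] C0 show ?thesis by (simp add: distrib_left)
  qed
  have s: "t\<^sub>0 < s" "s < t\<^sub>0 + C\<^sub>0 * r powr \<alpha>" and t: "t\<^sub>0 < t" "t < t\<^sub>0 + C\<^sub>0 * r powr \<alpha>"
    using sx ty by (auto simp: cylinder_def)
  (* Strict, since the caloric property is available on open cylinders only. *)
  have end_lt: "s + C\<^sub>0 * r0 powr \<alpha> < t\<^sub>0 + C\<^sub>0 * (2 * r) powr \<alpha>" using s big by linarith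
  have r0_nn: "0 \<le> C\<^sub>0 * r0 powr \<alpha>" using C0 by simp
  have qs: "\<bar>q (s, x)\<bar> \<le> M" "\<bar>q (t, y)\<bar> \<le> M"
    using s t big r0_nn xV yV by (auto intro!: bdd)
  have main: "\<bar>q (s, x) - q (t, y)\<bar> \<le> 2 * M * (l / (?\<gamma> * r0)) powr ?\<beta>"
  proof (cases "l \<le> r0")
    case True
    have sub: "gball G x r0 \<subseteq> gball G x\<^sub>0 (2 * r)"
      using sx r0 x0V xV by (intro gball_mono) (auto simp: cylinder_def gball_def)
    have "(\<bar>s - t\<bar> / C\<^sub>0) powr (1 / \<alpha>) \<le> l" by (simp add: l_def)
    hence "((\<bar>s - t\<bar> / C\<^sub>0) powr (1 / \<alpha>)) powr \<alpha> \<le> l powr \<alpha>" using \<alpha>_pos by (intro powr_mono2) auto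
    hence "\<bar>s - t\<bar> / C\<^sub>0 \<le> l powr \<alpha>" using \<alpha>_pos C0 by (simp add: powr_powr)
    hence "t \<le> s + C\<^sub>0 * l powr \<alpha>" using C0 st by (simp add: field_simps)
    moreover have "y \<in> gball G x l" using yV by (simp add: gball_def l_def)
    moreover have "\<bar>q (\<tau>, z)\<bar> \<le> M" if "\<tau> \<in> {s..s + C\<^sub>0 * r0 powr \<alpha>}" "z \<in> V" for \<tau> z
      using that s end_lt by (intro bdd) auto
    moreover have "mild_solution (jump_rate G d \<alpha>) s (s + C\<^sub>0 * r0 powr \<alpha>) (gball G x r0)
        (\<lambda>\<tau> y. jump_mean G d \<alpha> y (\<lambda>z. q (\<tau>, z))) (\<lambda>\<tau> z. q (\<tau>, z))"
      by (rule caloric_mild_solution[OF q t0 s(1) end_lt sub])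
    ultimately show ?thesis
      using hoelder_estimate[OF C0 x2 r0(1) _ M, where q="\<lambda>\<tau> z. q (\<tau>, z)" and s=s and l=l and t=t and y=y]
        r0 r l_pos l0 True st adm by auto
  next
    case False
    have "?\<gamma> * r0 \<le> 1 * r0" using sc r0 by (intro mult_right_mono) auto
    hence "?\<gamma> * r0 \<le> l" using False by simp
    hence "1 \<le> l / (?\<gamma> * r0)" using sc r0 by simp
    hence "1 \<le> (l / (?\<gamma> * r0)) powr ?\<beta>" using he by (intro ge_one_powr_ge_zero) auto
    hence "2 * M * 1 \<le> 2 * M * (l / (?\<gamma> * r0)) powr ?\<beta>" using M by (intro mult_left_mono) auto
    thus ?thesis using qs by linarith
  qed
  define D where "D = \<bar>t - s\<bar> powr (1 / \<alpha>) + real (\<delta> x y)"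
  have D: "0 \<le> D" by (simp add: D_def)
  have k: "0 \<le> C\<^sub>0 powr (- 1 / \<alpha>)" by simp
  have "l \<le> (1 + C\<^sub>0 powr (- 1 / \<alpha>)) * D"
  proof -
    have "(\<bar>s - t\<bar> / C\<^sub>0) powr (1 / \<alpha>) = C\<^sub>0 powr (- 1 / \<alpha>) * \<bar>t - s\<bar> powr (1 / \<alpha>)"
      using C0 by (simp add: powr_divide powr_minus field_simps abs_minus_commute)
    thus ?thesis using k by (simp add: l_def D_def algebra_simps)
  qed
  hence "l / (?\<gamma> * r0) \<le> (1 + C\<^sub>0 powr (- 1 / \<alpha>)) * D / (?\<gamma> * r0)"
    using sc r0 by (intro divide_right_mono) auto
  also have "\<dots> = (1 + C\<^sub>0 powr (- 1 / \<alpha>)) / (?\<gamma> * radius_factor) * (D / r)" by (simp add: r0_def)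
  finally have "(l / (?\<gamma> * r0)) powr ?\<beta> \<le> ((1 + C\<^sub>0 powr (- 1 / \<alpha>)) / (?\<gamma> * radius_factor) * (D / r)) powr ?\<beta>"
    using l_pos sc r0 he by (intro powr_mono2) auto
  also have "\<dots> = ((1 + C\<^sub>0 powr (- 1 / \<alpha>)) / (?\<gamma> * radius_factor)) powr ?\<beta> * (D / r) powr ?\<beta>"
    by (rule powr_mult)
  finally have "2 * M * (l / (?\<gamma> * r0)) powr ?\<beta>
      \<le> 2 * M * (((1 + C\<^sub>0 powr (- 1 / \<alpha>)) / (?\<gamma> * radius_factor)) powr ?\<beta> * (D / r) powr ?\<beta>)"
    using M by (intro mult_left_mono) auto
  also have "\<dots> = hoelder_const C\<^sub>0 * M * (D / r) powr ?\<beta>" by (simp add: hoelder_const_def)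
  finally show ?thesis using main by (simp add: D_def)
qed

end

lemma hypotheses_give_scale_window:
  assumes num: "model_constants d \<alpha> c\<^sub>M c\<^sub>G c\<^sub>0 C"
    and G: "stable_like_graph G d \<alpha> c\<^sub>M c\<^sub>G r\<^sub>G" and v0: "v\<^sub>0 \<in> verts G"
    and loc: "local_weight_bounds G v\<^sub>0 d \<alpha> c\<^sub>G r\<^sub>G \<theta> R\<^sub>0 c\<^sub>0 C"
    and tail: "tail_weight_bound G v\<^sub>0 d \<alpha> r\<^sub>G \<theta> R\<^sub>0 C"
    and R: "R\<^sub>0 < R" "ereal R < r\<^sub>G / ereal (2 * cstar c\<^sub>G d)" "0 < R" "1 \<le> R powr \<theta> / 2"
  shows "scale_window d \<alpha> c\<^sub>M c\<^sub>G c\<^sub>0 C G r\<^sub>G v\<^sub>0 (R powr \<theta> / 2) R"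
proof -
  interpret model_constants d \<alpha> c\<^sub>M c\<^sub>G c\<^sub>0 C by (rule num)
  have r1: "1 \<le> r\<^sub>G" using G by (simp add: stable_like_graph_def)
  have R2: "ereal (2 * R) < r\<^sub>G"
  proof (cases r\<^sub>G)
    case (real g)
    hence "R < g / (2 * cstar c\<^sub>G d)" using R cstar_ge by simp
    hence "R * (2 * cstar c\<^sub>G d) < g" using cstar_ge by (simp add: pos_less_divide_eq)
    moreover have "2 * R * 1 \<le> 2 * R * cstar c\<^sub>G d" using R cstar_ge by (intro mult_left_mono) auto
    ultimately show ?thesis using real by (simp add: mult_ac)
  qed (use r1 in auto)
  have RG: "ereal R < r\<^sub>G" by (rule le_less_trans[OF _ R2]) (use R(3) in simp)
  show ?thesis
  proof
    show "stable_like_graph G d \<alpha> c\<^sub>M c\<^sub>G r\<^sub>G" by (rule G)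
    show "v\<^sub>0 \<in> verts G" by (rule v0)
    show "1 \<le> R powr \<theta> / 2" by (rule R(4))
    show "ereal (2 * R) < r\<^sub>G" by (rule R2)
  qed (use loc tail R(1) RG in \<open>auto simp: local_weight_bounds_def tail_weight_bound_def\<close>)
qed

theorem theorem3p6:
  fixes d \<alpha> \<theta> c\<^sub>M c\<^sub>G c\<^sub>0 C C\<^sub>0 \<delta>\<^sub>e :: real
  assumes "d > 0" and "0 < \<alpha>" and "\<alpha> < 2" and "0 < \<theta>" and "\<theta> < 1"
    and "c\<^sub>M \<ge> 1" and "c\<^sub>G \<ge> 1"
    and "1 / 2 < c\<^sub>0" and "c\<^sub>0 < 1" and "C > 0"
    and "C\<^sub>0 > 0" and "\<theta> < \<delta>\<^sub>e" and "\<delta>\<^sub>e < 1"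
  shows "\<exists>\<delta> \<beta> C\<^sub>1::real. \<theta> < \<delta> \<and> \<delta> < 1 \<and> 0 < \<beta> \<and> \<beta> < 1 \<and> 0 < C\<^sub>1 \<and>
    (\<forall>R\<^sub>0 R\<^sub>e::real. 1 \<le> R\<^sub>0 \<and> 1 \<le> R\<^sub>e \<longrightarrow> (\<exists>R\<^sub>1\<ge>1.
      \<forall>(G::'a wgraph) (v\<^sub>0::'a) (r\<^sub>G::ereal).
        stable_like_graph G d \<alpha> c\<^sub>M c\<^sub>G r\<^sub>G \<and> v\<^sub>0 \<in> verts G \<and>
        local_weight_bounds G v\<^sub>0 d \<alpha> c\<^sub>G r\<^sub>G \<theta> R\<^sub>0 c\<^sub>0 C \<and>
        tail_weight_bound G v\<^sub>0 d \<alpha> r\<^sub>G \<theta> R\<^sub>0 C \<and>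
        exit_time_bound G v\<^sub>0 d \<alpha> c\<^sub>G r\<^sub>G C\<^sub>0 R\<^sub>e \<delta>\<^sub>e \<longrightarrow>
        (\<forall>(R::real) (x\<^sub>0::'a) (r::real) (t\<^sub>0::real) (q::real \<times> 'a \<Rightarrow> real).
          R\<^sub>1 < R \<and> ereal R < r\<^sub>G / ereal (2 * cstar c\<^sub>G d) \<and>
          x\<^sub>0 \<in> gball G v\<^sub>0 R \<and> R powr \<delta> \<le> r \<and> r \<le> R \<and> 0 \<le> t\<^sub>0 \<and>
          caloric G d \<alpha> (cylinder G \<alpha> C\<^sub>0 t\<^sub>0 x\<^sub>0 (2 * r)) q \<longrightarrow>
          (\<forall>s x t y.
            (s, x) \<in> cylinder G \<alpha> C\<^sub>0 t\<^sub>0 x\<^sub>0 r \<and> (t, y) \<in> cylinder G \<alpha> C\<^sub>0 t\<^sub>0 x\<^sub>0 r \<and>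
            2 * r powr \<delta> \<le> (\<bar>s - t\<bar> / C\<^sub>0) powr (1 / \<alpha>) + real (gdist G x y) \<longrightarrow>
            ennreal \<bar>q (s, x) - q (t, y)\<bar>
              \<le> ennreal C\<^sub>1
                * sup_norm_on q ({t\<^sub>0..t\<^sub>0 + C\<^sub>0 * (2 * r) powr \<alpha>} \<times> verts G)
                * ennreal (((\<bar>t - s\<bar> powr (1 / \<alpha>) + real (gdist G x y)) / r) powr \<beta>)))))"
proof -
  have num: "model_constants d \<alpha> c\<^sub>M c\<^sub>G c\<^sub>0 C" by standard (use assms in auto)
  interpret model_constants d \<alpha> c\<^sub>M c\<^sub>G c\<^sub>0 C by (rule num)
  define \<delta> where "\<delta> = sqrt ((1 + \<theta>) / 2)"
  define \<beta> where "\<beta> = hoelder_exponent C\<^sub>0"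
  define C\<^sub>1 where "C\<^sub>1 = hoelder_const C\<^sub>0"
  have d2: "\<delta> * \<delta> = (1 + \<theta>) / 2" using assms by (simp add: \<delta>_def)
  have \<delta>1: "0 < \<delta>" "\<delta> < 1" using assms by (auto simp: \<delta>_def)
  have d2\<theta>: "\<theta> < \<delta> * \<delta>" using assms d2 by simp
  have "\<delta> * \<delta> < \<delta> * 1" using \<delta>1 by (intro mult_strict_left_mono) auto
  hence \<theta>\<delta>: "\<theta> < \<delta>" using d2\<theta> by simp
  note he = hoelder_exponent_bounds[OF \<open>C\<^sub>0 > 0\<close>, folded \<beta>_def]
  note sp = space_ratio_bounds[OF \<open>C\<^sub>0 > 0\<close>] and sc = scale_ratio_bounds[OF \<open>C\<^sub>0 > 0\<close>]
  have C1: "0 < C\<^sub>1"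
  proof -
    have "0 < (1 + C\<^sub>0 powr (- 1 / \<alpha>)) / (scale_ratio C\<^sub>0 * radius_factor)"
      using sc radius_factor_bounds by (intro divide_pos_pos mult_pos_pos) (auto intro: add_pos_nonneg)
    hence "0 < ((1 + C\<^sub>0 powr (- 1 / \<alpha>)) / (scale_ratio C\<^sub>0 * radius_factor)) powr hoelder_exponent C\<^sub>0"
      unfolding powr_gt_zero by (rule less_imp_neq[THEN not_sym])
    thus ?thesis unfolding C\<^sub>1_def hoelder_const_def by linarith
  qed
  obtain R\<^sub>2 where R2: "1 \<le> R\<^sub>2"
    "\<And>R \<rho>. R\<^sub>2 \<le> R \<Longrightarrow> space_ratio C\<^sub>0 * R powr (\<delta> * \<delta>) \<le> \<rho> \<Longrightarrow> \<rho> \<le> R \<Longrightarrow>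
       1 \<le> R powr \<theta> / 2 \<and> R powr \<theta> / 2 \<le> \<rho> \<and>
       cstar c\<^sub>G d * (R powr \<theta> / 2) * ln (chain_const\<^sup>2 * \<rho> powr d) powr (5 / \<alpha>) \<le> \<rho>"
    using scale_threshold[OF \<open>0 < \<theta>\<close> d2\<theta> sp(1)] by blast
  show ?thesis
  proof (rule exI[of _ \<delta>], rule exI[of _ \<beta>], rule exI[of _ C\<^sub>1], intro conjI allI impI)
    fix R\<^sub>0 R\<^sub>e :: real
    show "\<exists>R\<^sub>1\<ge>1. \<forall>(G::'a wgraph) (v\<^sub>0::'a) (r\<^sub>G::ereal).
        stable_like_graph G d \<alpha> c\<^sub>M c\<^sub>G r\<^sub>G \<and> v\<^sub>0 \<in> verts G \<and>
        local_weight_bounds G v\<^sub>0 d \<alpha> c\<^sub>G r\<^sub>G \<theta> R\<^sub>0 c\<^sub>0 C \<and>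
        tail_weight_bound G v\<^sub>0 d \<alpha> r\<^sub>G \<theta> R\<^sub>0 C \<and>
        exit_time_bound G v\<^sub>0 d \<alpha> c\<^sub>G r\<^sub>G C\<^sub>0 R\<^sub>e \<delta>\<^sub>e \<longrightarrow>
        (\<forall>(R::real) (x\<^sub>0::'a) (r::real) (t\<^sub>0::real) (q::real \<times> 'a \<Rightarrow> real).
          R\<^sub>1 < R \<and> ereal R < r\<^sub>G / ereal (2 * cstar c\<^sub>G d) \<and>
          x\<^sub>0 \<in> gball G v\<^sub>0 R \<and> R powr \<delta> \<le> r \<and> r \<le> R \<and> 0 \<le> t\<^sub>0 \<and>
          caloric G d \<alpha> (cylinder G \<alpha> C\<^sub>0 t\<^sub>0 x\<^sub>0 (2 * r)) q \<longrightarrow>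
          (\<forall>s x t y.
            (s, x) \<in> cylinder G \<alpha> C\<^sub>0 t\<^sub>0 x\<^sub>0 r \<and> (t, y) \<in> cylinder G \<alpha> C\<^sub>0 t\<^sub>0 x\<^sub>0 r \<and>
            2 * r powr \<delta> \<le> (\<bar>s - t\<bar> / C\<^sub>0) powr (1 / \<alpha>) + real (gdist G x y) \<longrightarrow>
            ennreal \<bar>q (s, x) - q (t, y)\<bar>
              \<le> ennreal C\<^sub>1
                * sup_norm_on q ({t\<^sub>0..t\<^sub>0 + C\<^sub>0 * (2 * r) powr \<alpha>} \<times> verts G)
                * ennreal (((\<bar>t - s\<bar> powr (1 / \<alpha>) + real (gdist G x y)) / r) powr \<beta>)))"
    proof (intro exI[of _ "max R\<^sub>0 R\<^sub>2"] conjI allI impI, goal_cases)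
      case 1
      show ?case using R2(1) by simp
    next
      case (2 G v\<^sub>0 r\<^sub>G R x\<^sub>0 r t\<^sub>0 q s x t y)
      hence hyp: "stable_like_graph G d \<alpha> c\<^sub>M c\<^sub>G r\<^sub>G" "v\<^sub>0 \<in> verts G"
          "local_weight_bounds G v\<^sub>0 d \<alpha> c\<^sub>G r\<^sub>G \<theta> R\<^sub>0 c\<^sub>0 C" "tail_weight_bound G v\<^sub>0 d \<alpha> r\<^sub>G \<theta> R\<^sub>0 C"
        and R: "R\<^sub>0 < R" "R\<^sub>2 < R" "ereal R < r\<^sub>G / ereal (2 * cstar c\<^sub>G d)"
        and x0: "x\<^sub>0 \<in> gball G v\<^sub>0 R" and r: "R powr \<delta> \<le> r" "r \<le> R" and t0: "0 \<le> t\<^sub>0"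
        and q: "caloric G d \<alpha> (cylinder G \<alpha> C\<^sub>0 t\<^sub>0 x\<^sub>0 (2 * r)) q"
        and sx: "(s, x) \<in> cylinder G \<alpha> C\<^sub>0 t\<^sub>0 x\<^sub>0 r" and ty: "(t, y) \<in> cylinder G \<alpha> C\<^sub>0 t\<^sub>0 x\<^sub>0 r"
        and l: "2 * r powr \<delta> \<le> (\<bar>s - t\<bar> / C\<^sub>0) powr (1 / \<alpha>) + real (gdist G x y)"
        by auto
      have R1: "1 < R" using R R2(1) by linarith
      have r_pos: "0 < r" using r R1 by (smt (verit) powr_gt_zero)
      have low: "R powr (\<delta> * \<delta>) \<le> r powr \<delta>"
      proof -
        have "(R powr \<delta>) powr \<delta> \<le> r powr \<delta>" using r \<delta>1 by (intro powr_mono2) auto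
        thus ?thesis by (simp add: powr_powr)
      qed
      have thr: "1 \<le> R powr \<theta> / 2"
      proof -
        have "R powr (\<delta> * \<delta>) \<le> R powr 1" using R1 \<delta>1 by (intro powr_mono) (auto intro: mult_le_one)
        hence "space_ratio C\<^sub>0 * R powr (\<delta> * \<delta>) \<le> R" using sp R1 mult_mono[of "space_ratio C\<^sub>0" 1 "R powr (\<delta> * \<delta>)" R] by simp
        thus ?thesis using R2(2)[of R R] R by simp
      qed
      interpret scale_window d \<alpha> c\<^sub>M c\<^sub>G c\<^sub>0 C G r\<^sub>G v\<^sub>0 "R powr \<theta> / 2" R
        by (rule hypotheses_give_scale_window[OF num hyp R(1,3) _ thr]) (use R1 in simp)
      have adm: "admissible (space_ratio C\<^sub>0 * r')" if "2 * r powr \<delta> \<le> r'" "r' \<le> R" for r'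
      proof -
        have "R powr (\<delta> * \<delta>) \<le> r'" using that low powr_ge_zero[of r \<delta>] by linarith
        hence "space_ratio C\<^sub>0 * R powr (\<delta> * \<delta>) \<le> space_ratio C\<^sub>0 * r'" using sp by (intro mult_left_mono) auto
        moreover have "space_ratio C\<^sub>0 * r' \<le> R"
        proof -
          have "0 \<le> r'" using that powr_ge_zero[of r \<delta>] by linarith
          hence "space_ratio C\<^sub>0 * r' \<le> 1 * r'" using sp by (intro mult_right_mono) auto
          thus ?thesis using that by simp
        qed
        ultimately show ?thesis using R2(2)[of R "space_ratio C\<^sub>0 * r'"] R by (simp add: admissible_def)
      qed
      let ?S = "{t\<^sub>0..t\<^sub>0 + C\<^sub>0 * (2 * r) powr \<alpha>} \<times> verts G"
      define D where "D = \<bar>t - s\<bar> powr (1 / \<alpha>) + real (gdist G x y)"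
      have l_pos: "0 < 2 * r powr \<delta>" using r_pos by simp
      have D: "0 < D"
      proof -
        have "0 < (\<bar>s - t\<bar> / C\<^sub>0) powr (1 / \<alpha>) \<or> 0 < real (gdist G x y)" using l l_pos
          by (smt (verit) of_nat_0_le_iff powr_ge_zero)
        hence "0 < \<bar>t - s\<bar> powr (1 / \<alpha>) \<or> 0 < real (gdist G x y)" by auto
        thus ?thesis unfolding D_def by (smt (verit) of_nat_0_le_iff powr_ge_zero)
      qed
      hence Dp: "0 < (D / r) powr \<beta>" using r_pos by simp
      have real_bound: "\<bar>q (s, x) - q (t, y)\<bar> \<le> C\<^sub>1 * M * (D / r) powr \<beta>"
        if M: "0 < M" and bdd: "\<And>\<tau> z. (\<tau>, z) \<in> ?S \<Longrightarrow> \<bar>q (\<tau>, z)\<bar> \<le> M" for M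
      proof (cases "s \<le> t")
        case True
        show ?thesis unfolding C\<^sub>1_def \<beta>_def D_def
          using caloric_hoelder[OF \<open>C\<^sub>0 > 0\<close> x0 r_pos r(2) t0 q sx ty True M _ l l_pos adm] bdd by auto
      next
        case False
        have l': "2 * r powr \<delta> \<le> (\<bar>t - s\<bar> / C\<^sub>0) powr (1 / \<alpha>) + real (gdist G y x)"
          using l by (simp add: abs_minus_commute gdist_sym[of y x])
        have "\<bar>q (t, y) - q (s, x)\<bar> \<le> hoelder_const C\<^sub>0 * M
            * ((\<bar>s - t\<bar> powr (1 / \<alpha>) + real (gdist G y x)) / r) powr hoelder_exponent C\<^sub>0"
          using caloric_hoelder[OF \<open>C\<^sub>0 > 0\<close> x0 r_pos r(2) t0 q ty sx _ M _ l' l_pos adm] bdd False by auto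
        thus ?thesis unfolding C\<^sub>1_def \<beta>_def D_def
          by (simp add: abs_minus_commute gdist_sym[of y x])
      qed
      have "ennreal \<bar>q (s, x) - q (t, y)\<bar> \<le> ennreal C\<^sub>1 * sup_norm_on q ?S * ennreal ((D / r) powr \<beta>)"
      proof (cases "sup_norm_on q ?S = \<infinity>")
        case True
        thus ?thesis using C1 Dp by (simp add: ennreal_mult_top ennreal_top_mult)
      next
        case False
        define M where "M = enn2real (sup_norm_on q ?S)"
        have M: "sup_norm_on q ?S = ennreal M" "0 \<le> M" using False by (auto simp: M_def less_top)
        have bdd: "\<bar>q z\<bar> \<le> M" if "z \<in> ?S" for z
        proof -
          have "ennreal \<bar>q z\<bar> \<le> ennreal M" unfolding M(1)[symmetric] sup_norm_on_def using that by (rule SUP_upper)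
          thus ?thesis using M(2) by simp
        qed
        (* The supremum may be 0, while the iteration needs a positive bound. *)
        have "\<bar>q (s, x) - q (t, y)\<bar> \<le> C\<^sub>1 * (M + \<epsilon>) * (D / r) powr \<beta>" if "0 < \<epsilon>" for \<epsilon>
        proof (rule real_bound)
          show "\<bar>q (\<tau>, z)\<bar> \<le> M + \<epsilon>" if "(\<tau>, z) \<in> ?S" for \<tau> z
            using bdd[OF that] \<open>0 < \<epsilon>\<close> by linarith
        qed (use that M(2) in simp)
        note approx = this
        have "\<bar>q (s, x) - q (t, y)\<bar> \<le> C\<^sub>1 * M * (D / r) powr \<beta> + e" if e: "0 < e" for e
        proof -
          define k where "k = C\<^sub>1 * (D / r) powr \<beta>"
          have k: "0 < k" using C1 Dp by (simp add: k_def)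
          have "C\<^sub>1 * (M + e / k) * (D / r) powr \<beta> = C\<^sub>1 * M * (D / r) powr \<beta> + k * (e / k)"
            by (simp add: k_def algebra_simps)
          also have "k * (e / k) = e" using k by simp
          finally show ?thesis using approx[of "e / k"] e k by simp
        qed
        hence "\<bar>q (s, x) - q (t, y)\<bar> \<le> C\<^sub>1 * M * (D / r) powr \<beta>" by (rule field_le_epsilon)
        hence "ennreal \<bar>q (s, x) - q (t, y)\<bar> \<le> ennreal (C\<^sub>1 * M * (D / r) powr \<beta>)" by (rule ennreal_leI)
        also have "\<dots> = ennreal C\<^sub>1 * sup_norm_on q ?S * ennreal ((D / r) powr \<beta>)"
          unfolding M(1) using C1 M(2) by (simp add: ennreal_mult)
        finally show ?thesis .
      qed
      thus ?case by (simp only: D_def)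
    qed
  qed (use \<theta>\<delta> \<delta>1 he C1 in auto)
qed

end
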